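(* (i) There exists $c^\ast\in[1/\sqrt e,\,4.342)$ such that the function $\varphi_0:(0,\infty)\to\mathbb R$ is non-analytic at $c=c^\ast$. (ii) More generally, there exists a constant $\eta_\ell\approx .0091$ such that for every $\eta\in[0,\eta_\ell)$ there exists $c^\ast_\eta\in(0,\infty)$ such that $\varphi_\eta$ is non-analytic at $c=c^\ast_\eta$.
   Context: $\mathbb P_p$ and $\mathbb E_p$ are probability and expectation for the Erdős–Rényi random graph $G(n,p)$ on $n$ labeled vertices, and $X$ is its number of triangles. For $\eta\in[0,1)$ and $c>0$ define $$\varphi_\eta(c)=\liminf_{n\to\infty}\frac1{n^{3/2}}\log\mathbb P_{c/\sqrt n}\big(X\le\eta\,\mathbb E_{c/\sqrt n}X\big).$$ Non-analytic at a point means not real-analytic at that point (this is what the paper calls a phase transition in the lower-tail problem at that point). The value of $\eta_\ell$ is a specific number, the cube of a threshold value $\approx .209$ obtained in earlier work of Zhao on the triangle lower-tail variational problem as the maximum of a univariate function on the unit interval; "$\approx .0091$" indicates its decimal value to the printed precision. *)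

theory Defs
  imports "HOL-Probability.Probability" "HOL-Probability.Product_PMF"
    "HOL-Analysis.FPS_Convergence"
begin

definition complete_edges :: "nat \<Rightarrow> nat set set" where
  "complete_edges n = {e. e \<subseteq> {..<n} \<and> card e = 2}"

text \<open>
  A graph on the vertex set \<open>{..<n}\<close> is identified with its set of edges.  Note that
  \<^const>\<open>bernoulli_pmf\<close> clamps its parameter to the unit interval; for \<open>p = c / sqrt n\<close> this
  concerns only the finitely many \<open>n < c\<^sup>2\<close>.
\<close>

definition gnp :: "nat \<Rightarrow> real \<Rightarrow> nat set set pmf" where
  "gnp n p =
     map_pmf (\<lambda>\<omega>. {e \<in> complete_edges n. \<omega> e})
       (Pi_pmf (complete_edges n) False (\<lambda>_. bernoulli_pmf p))"

definition triangle_count :: "nat \<Rightarrow> nat set set \<Rightarrow> nat" where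
  "triangle_count n G =
     card {T. T \<subseteq> {..<n} \<and> card T = 3 \<and> (\<forall>e. e \<subseteq> T \<and> card e = 2 \<longrightarrow> e \<in> G)}"

definition lower_tail_prob :: "real \<Rightarrow> nat \<Rightarrow> real \<Rightarrow> real" where
  "lower_tail_prob \<eta> n p =
     measure_pmf.prob (gnp n p)
       {G. real (triangle_count n G)
             \<le> \<eta> * measure_pmf.expectation (gnp n p) (\<lambda>G. real (triangle_count n G))}"

text \<open>
  The lower limit is taken in the extended reals.  For \<open>\<eta> \<ge> 0\<close> and \<open>c > 0\<close> it is finite: the
  empty graph is contained in the event, so for \<open>n > c\<^sup>2\<close> the sequence lies between
  \<open>(n choose 2) * ln (1 - c / sqrt n) / n powr (3/2)\<close>, which tends to \<open>- c / 2\<close>, and \<open>0\<close>.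
  Hence the conversion back to the reals loses nothing.
\<close>

definition phi :: "real \<Rightarrow> real \<Rightarrow> real" where
  "phi \<eta> c =
     real_of_ereal
       (liminf (\<lambda>n. ereal (ln (lower_tail_prob \<eta> n (c / sqrt (real n))) / real n powr (3/2))))"

text \<open>Real-analyticity at a point: local representability by a convergent power series.\<close>

definition real_analytic_at :: "(real \<Rightarrow> real) \<Rightarrow> real \<Rightarrow> bool" where
  "real_analytic_at f x \<longleftrightarrow> (\<exists>F :: real fps. (\<lambda>h. f (x + h)) has_fps_expansion F)"

text \<open>
  Zhao's threshold for the sparse triangle lower-tail variational problem: minimise
  \<open>\<integral> h(W) / 2\<close>, where \<open>h(u) = u ln u - u + 1\<close>, over nonnegative graphons \<open>W\<close> of triangle
  density at most \<open>q\<^sup>3\<close>.  The constant graphon \<open>q\<close> is compared with the graphons having two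
  blocks of measure 1/2, value \<open>a\<close> inside the blocks and value \<open>b\<close> across.  The triangle
  density of the latter is \<open>((a + b) / 2)\<^sup>3 + ((a - b) / 2)\<^sup>3 = a (a\<^sup>2 + 3 b\<^sup>2) / 4\<close>, so the ratio
  \<open>x = a / b\<close> and the density \<open>q\<^sup>3\<close> determine \<open>b = q s\<close> and \<open>a = q s x\<close> with
  \<open>s = (4 / (x (x\<^sup>2 + 3))) powr (1/3)\<close>.  For \<open>0 < x < 1\<close> one has \<open>s + s x > 2\<close>, and
  \<open>(h(a) + h(b)) / 2 < h(q)\<close> unfolds to \<open>q < zhao_fun x\<close>.  Thus the supremum of \<open>zhao_fun\<close> is
  the largest \<open>q\<close> below which some such two-block graphon beats the constant one.
\<close>

definition zhao_fun :: "real \<Rightarrow> real" where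
  "zhao_fun x =
     (let s = (4 / (x * (x\<^sup>2 + 3))) powr (1/3)
      in exp (1 - (s * x * ln (s * x) + s * ln s) / (s + s * x - 2)))"

definition zhao_threshold :: real where
  "zhao_threshold = (SUP x\<in>{0<..<1}. zhao_fun x)"

text \<open>
  Numerically \<open>zhao_threshold\<close> is 0.20967 (attained near \<open>x = 0.02006\<close>), and its cube is
  0.009217.  The value .0091 found in the literature is the cube of the truncation .209.
\<close>

definition eta_l :: real where
  "eta_l = zhao_threshold ^ 3"

end

theory Submission
  imports Defs "HOL-Real_Asymp.Real_Asymp" "HOL-Complex_Analysis.Complex_Analysis"
begin

text \<open>
  Weight every triangle of \<open>G(n, c / sqrt n)\<close> by a factor \<open>1 - t\<close>.  The triangles form a linear
  3-uniform hypergraph on the edges, so exposing edges one at a time gives a recursion for the edge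
  marginals; its limit map \<open>\<rho> \<mapsto> exp (- t * c\<^sup>2 * \<rho>\<^sup>2)\<close> is a contraction when \<open>2 * c\<^sup>2 < exp 1\<close>.
  Integrating the marginals in the activity gives the exponential moments of \<open>X\<close>, and a Chernoff and
  tilting argument turns them into an explicit formula for \<open>\<phi>\<^sub>\<eta> c\<close>, analytic in \<open>c\<close>, for small \<open>c\<close>.

  If \<open>\<phi>\<^sub>\<eta>\<close> were analytic, this formula would persist for larger \<open>c\<close>: it is a curve parametrised by the
  edge marginal \<open>x\<close>, and the identity theorem applies in \<open>x\<close>.  Random graphs with two vertex classes of
  equal size and different densities inside and across satisfy the lower-tail event with a
  probability that eventually exceeds the continued formula, for \<open>\<eta> = 0\<close> because bipartite graphs are
  triangle-free, and for \<open>0 < \<eta> < eta_l\<close> by Zhao's comparison, since the formula divided by \<open>c\<close> tends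
  to minus half the entropy cost of the constant graphon \<open>root 3 \<eta>\<close> as \<open>c\<close> grows.
\<close>

subsection \<open>Edge marginals on a linear hypergraph\<close>

text \<open>The bound for one edge marginal involves the marginals of two further edges after more
  edges have been exposed, so nothing closes up at a fixed state. All bounds are therefore uniform
  over states with at most \<open>k\<close> exposed edges, with \<open>k\<close> fixed before
  \<open>n\<close> grows, and each step of the recursion costs two exposures. Linearity limits the
  triangles spoilt by \<open>k\<close> exposed edges to \<open>k + k\<^sup>2\<close> per edge,
  negligible against the degree \<open>n - 2\<close>. The limit map is decreasing, so upper and
  lower bounds feed each other. Its steepest slope is \<open>c * sqrt (2 * t / exp 1)\<close> in
  absolute value; hence the condition \<open>2 * c\<^sup>2 < exp 1\<close>, which serves all tilts
  \<open>t \<le> 1\<close> at once. Past that range only lower bounds for \<open>phi\<close> are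
  proved, so the critical point is not located: analyticity throughout the relevant range of
  \<open>c\<close> is refuted. For \<eta> = 0 the number 4.342 is rounded up from the
  \<open>c\<close> at which the continued formula equals \<open>- c / 4\<close>, the exponent of the
  event that every edge crosses a balanced bipartition.\<close>

locale linear_hypergraph =
  fixes E :: "'a set" and TT :: "'a set set" and D :: nat and lam t :: real
  assumes finE: "finite E"
    and subE: "\<And>T. T \<in> TT \<Longrightarrow> T \<subseteq> E"
    and card3: "\<And>T. T \<in> TT \<Longrightarrow> card T = 3"
    and linear: "\<And>T T' e f. T \<in> TT \<Longrightarrow> T' \<in> TT \<Longrightarrow> e \<noteq> f \<Longrightarrow> {e, f} \<subseteq> T \<Longrightarrow> {e, f} \<subseteq> T' \<Longrightarrow> T = T'"
    and regular: "\<And>e. e \<in> E \<Longrightarrow> card {T \<in> TT. e \<in> T} = D"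
    and lam: "0 \<le> lam" "lam \<le> 1"
    and t: "0 \<le> t" "t \<le> 1"
begin

text \<open>
  \<open>B\<close> is the set of edges already exposed and \<open>Q\<close> the set of triangles none of whose exposed edges is
  absent; \<open>S\<close> ranges over the configurations of the remaining edges.
\<close>

definition wt :: "'a set \<Rightarrow> 'a set set \<Rightarrow> 'a set \<Rightarrow> real" where
  "wt B Q S = lam ^ card S * (1 - t) ^ card {T \<in> Q. T - B \<subseteq> S}"

definition pf :: "'a set \<Rightarrow> 'a set set \<Rightarrow> real" where
  "pf B Q = (\<Sum>S\<in>Pow (E - B). wt B Q S)"

text \<open>The probability that \<open>f\<close> is present is \<open>lam * pres B Q f\<close>.\<close>

definition pres :: "'a set \<Rightarrow> 'a set set \<Rightarrow> 'a \<Rightarrow> real" where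
  "pres B Q f = pf (insert f B) Q / pf B Q"

definition st :: "'a set \<Rightarrow> 'a set set \<Rightarrow> nat \<Rightarrow> bool" where
  "st B Q k \<longleftrightarrow> B \<subseteq> E \<and> card B \<le> k \<and> Q \<subseteq> TT \<and> (\<forall>T\<in>TT. T \<inter> B = {} \<longrightarrow> T \<in> Q) \<and> (\<forall>T\<in>Q. \<not> T \<subseteq> B)"

lemma finTT: "finite TT"
  by (rule finite_subset[of _ "Pow E"]) (use subE finE in auto)

lemma wt_nonneg: "0 \<le> wt B Q S"
  unfolding wt_def using lam t by simp

lemma pf_nonneg: "0 \<le> pf B Q"
  unfolding pf_def by (intro sum_nonneg wt_nonneg)

lemma wt_antimono:
  assumes "Q \<subseteq> Q'" "Q' \<subseteq> TT" shows "wt B Q' S \<le> wt B Q S"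
proof -
  have "finite {T \<in> Q'. T - B \<subseteq> S}" using finTT assms by (auto intro: finite_subset)
  then have "card {T \<in> Q. T - B \<subseteq> S} \<le> card {T \<in> Q'. T - B \<subseteq> S}"
    using assms by (intro card_mono) auto
  then show ?thesis unfolding wt_def using lam t
    by (intro mult_left_mono power_decreasing) auto
qed

lemma pf_antimono:
  assumes "Q \<subseteq> Q'" "Q' \<subseteq> TT" shows "pf B Q' \<le> pf B Q"
  unfolding pf_def by (intro sum_mono wt_antimono assms)

text \<open>Once its factor \<open>lam\<close> is taken out, a present edge behaves like an exposed
  one. The extra factor \<open>g\<close> carries along a condition on a second edge, as needed when
  two edges of a triangle are still open.\<close>

lemma sum_containing:
  assumes "f \<in> E - B"
  shows "(\<Sum>S\<in>{S \<in> Pow (E - B). f \<in> S}. wt B Q S * g S)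
    = lam * (\<Sum>S\<in>Pow (E - insert f B). wt (insert f B) Q S * g (insert f S))"
proof -
  have inj: "inj_on (insert f) (Pow (E - insert f B))"
    by (auto simp: inj_on_def)
  have im: "{S \<in> Pow (E - B). f \<in> S} = insert f ` Pow (E - insert f B)" (is "?L = ?R")
  proof
    show "?R \<subseteq> ?L" using assms by auto
    show "?L \<subseteq> ?R"
    proof
      fix S assume S: "S \<in> ?L"
      have "S = insert f (S - {f})" "S - {f} \<in> Pow (E - insert f B)" using S by auto
      then show "S \<in> ?R" by blast
    qed
  qed
  have w: "wt B Q (insert f S) = lam * wt (insert f B) Q S" if "S \<in> Pow (E - insert f B)" for S
  proof -
    have "finite S" using that finE by (auto intro: finite_subset)
    moreover have "f \<notin> S" using that by auto
    ultimately have c: "card (insert f S) = Suc (card S)" by simp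
    have "{T \<in> Q. T - B \<subseteq> insert f S} = {T \<in> Q. T - insert f B \<subseteq> S}" by auto
    then show ?thesis unfolding wt_def c by simp
  qed
  show ?thesis unfolding im sum.reindex[OF inj] o_def sum_distrib_left
    by (intro sum.cong refl) (simp add: w)
qed

lemma sum_present:
  assumes "f \<in> E - B"
  shows "(\<Sum>S\<in>{S \<in> Pow (E - B). f \<in> S}. wt B Q S) = lam * pf (insert f B) Q"
  using sum_containing[OF assms, of Q "\<lambda>_. 1"] by (simp add: pf_def)

text \<open>Without \<open>f\<close> no triangle through it can be completed, so those triangles
  leave \<open>Q\<close>.\<close>

lemma sum_absent:
  assumes "f \<in> E - B"
  shows "(\<Sum>S\<in>{S \<in> Pow (E - B). f \<notin> S}. wt B Q S) = pf (insert f B) (Q - {T. f \<in> T})"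
proof -
  have "{S \<in> Pow (E - B). f \<notin> S} = Pow (E - insert f B)" by auto
  moreover have "wt B Q S = wt (insert f B) (Q - {T. f \<in> T}) S" if "S \<in> Pow (E - insert f B)" for S
  proof -
    have "{T \<in> Q. T - B \<subseteq> S} = {T \<in> Q - {T. f \<in> T}. T - insert f B \<subseteq> S}" using that assms by auto
    then show ?thesis unfolding wt_def by simp
  qed
  ultimately show ?thesis unfolding pf_def by simp
qed

lemma pf_split:
  assumes "f \<in> E - B"
  shows "pf B Q = pf (insert f B) (Q - {T. f \<in> T}) + lam * pf (insert f B) Q"
proof -
  have fin: "finite (Pow (E - B))" using finE by simp
  have "pf B Q = (\<Sum>S\<in>{S \<in> Pow (E - B). f \<notin> S}. wt B Q S) + (\<Sum>S\<in>{S \<in> Pow (E - B). f \<in> S}. wt B Q S)"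
    unfolding pf_def
    by (subst sum.union_disjoint[symmetric]) (use fin in \<open>auto intro!: sum.cong\<close>)
  then show ?thesis by (simp only: sum_present[OF assms] sum_absent[OF assms])
qed

text \<open>Compared with its absence, the presence of \<open>f\<close> only adds penalised
  triangles.\<close>

lemma pf_insert_le:
  assumes "f \<in> E - B" "Q \<subseteq> TT"
  shows "pf (insert f B) Q \<le> pf B Q"
proof -
  have "pf (insert f B) Q \<le> pf (insert f B) (Q - {T. f \<in> T})"
    using assms by (intro pf_antimono) auto
  also have "\<dots> \<le> pf B Q" using pf_split[OF assms(1), of Q] pf_nonneg lam by simp
  finally show ?thesis .
qed

text \<open>The empty configuration completes no triangle of \<open>Q\<close> and has weight 1. This
  keeps the quotients \<open>pres\<close> meaningful even at \<open>t = 1\<close>, where completed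
  triangles have weight 0.\<close>

lemma pf_ge_1:
  assumes "\<forall>T\<in>Q. \<not> T \<subseteq> B"
  shows "1 \<le> pf B Q"
proof -
  have "{T \<in> Q. T - B \<subseteq> {}} = {}" using assms by auto
  then have "wt B Q {} = 1" unfolding wt_def by (simp only: card.empty power_0 mult_1)
  moreover have "wt B Q {} \<le> pf B Q" unfolding pf_def
    by (rule member_le_sum) (use finE wt_nonneg in auto)
  ultimately show ?thesis by simp
qed

lemma pres_nonneg: "0 \<le> pres B Q f"
  unfolding pres_def by (simp add: pf_nonneg)

lemma pres_le_1:
  assumes "f \<in> E - B" "Q \<subseteq> TT" shows "pres B Q f \<le> 1"
  unfolding pres_def using pf_insert_le[OF assms] pf_nonneg
  by (metis divide_le_eq_1 dual_order.trans leI less_eq_real_def)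

text \<open>The new triangle multiplies the weight by \<open>1 - t\<close> exactly on the
  configurations that complete it. The ratio bounds below come from iterating this identity.\<close>

lemma pf_add_edge:
  assumes "T \<notin> Q" "insert T Q \<subseteq> TT"
  shows "pf B (insert T Q) = pf B Q - t * (\<Sum>S\<in>{S \<in> Pow (E - B). T - B \<subseteq> S}. wt B Q S)"
proof -
  have fQ: "finite Q" using finTT assms by (auto intro: finite_subset)
  have w: "wt B (insert T Q) S = wt B Q S - t * (if T - B \<subseteq> S then wt B Q S else 0)" for S
  proof (cases "T - B \<subseteq> S")
    case True
    then have "{T' \<in> insert T Q. T' - B \<subseteq> S} = insert T {T' \<in> Q. T' - B \<subseteq> S}" by auto
    then show ?thesis using True fQ assms unfolding wt_def by (simp add: algebra_simps)
  next
    case False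
    then have "{T' \<in> insert T Q. T' - B \<subseteq> S} = {T' \<in> Q. T' - B \<subseteq> S}" by auto
    then show ?thesis using False unfolding wt_def by simp
  qed
  show ?thesis unfolding pf_def w sum_subtractf sum_distrib_left[symmetric]
    using finE by (subst sum.inter_filter) auto
qed

lemma pf_add_edge_1:
  assumes "T \<notin> Q" "insert T Q \<subseteq> TT" "T - B = {g}"
  shows "pf B (insert T Q) = pf B Q - t * lam * pf (insert g B) Q"
proof -
  have g: "g \<in> E - B" using assms subE by auto
  show ?thesis using pf_add_edge[OF assms(1,2), of B] sum_present[OF g, of Q] assms(3) by simp
qed

lemma pf_add_edge_2:
  assumes "T \<notin> Q" "insert T Q \<subseteq> TT" "T - B = {g, h}" "g \<noteq> h"
  shows "pf B (insert T Q) = pf B Q - t * lam\<^sup>2 * pf (insert h (insert g B)) Q"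
proof -
  have g: "g \<in> E - B" and h: "h \<in> E - insert g B" using assms subE by auto
  have "(\<Sum>S\<in>{S \<in> Pow (E - B). T - B \<subseteq> S}. wt B Q S)
     = (\<Sum>S\<in>{S \<in> Pow (E - B). g \<in> S}. wt B Q S * (if h \<in> S then 1 else 0))"
    using finE unfolding assms(3) by (intro sum.mono_neutral_cong_left) auto
  also have "\<dots> = lam * (\<Sum>S\<in>Pow (E - insert g B). wt (insert g B) Q S * (if h \<in> S then 1 else 0))"
    by (subst sum_containing[OF g]) (use assms in simp)
  also have "(\<Sum>S\<in>Pow (E - insert g B). wt (insert g B) Q S * (if h \<in> S then 1 else 0))
     = (\<Sum>S\<in>{S \<in> Pow (E - insert g B). h \<in> S}. wt (insert g B) Q S)"
    using finE by (intro sum.mono_neutral_cong_right) auto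
  also have "\<dots> = lam * pf (insert h (insert g B)) Q" by (rule sum_present[OF h])
  finally show ?thesis using pf_add_edge[OF assms(1,2), of B] by (simp add: power2_eq_square)
qed

text \<open>Exposing an edge outside this set cannot close a triangle. An unexposed edge inside it
  can face a triangle with two exposed edges, whose single penalty \<open>1 - t\<close> need not be
  close to 1.\<close>

definition clos :: "'a set \<Rightarrow> 'a set" where
  "clos B = B \<union> {g. \<exists>T\<in>TT. g \<in> T \<and> T - {g} \<subseteq> B}"

text \<open>By linearity a pair of exposed edges lies in at most one triangle, hence completes at
  most one further edge; there are at most \<open>k\<^sup>2\<close> ordered pairs.\<close>

lemma card_clos:
  assumes "B \<subseteq> E" "card B \<le> k"
  shows "finite (clos B)" "card (clos B) \<le> k + k\<^sup>2"
proof -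
  have fB: "finite B" using assms(1) finE by (rule finite_subset)
  define K where "K = {g. \<exists>T\<in>TT. g \<in> T \<and> T - {g} \<subseteq> B}"
  define \<phi> where "\<phi> = (\<lambda>(b, b'). THE g. \<exists>T\<in>TT. {b, b'} \<subseteq> T \<and> g \<in> T \<and> g \<noteq> b \<and> g \<noteq> b')"
  have "K \<subseteq> \<phi> ` (B \<times> B)"
  proof
    fix g assume "g \<in> K"
    then obtain T where T: "T \<in> TT" "g \<in> T" "T - {g} \<subseteq> B" by (auto simp: K_def)
    have "finite T" using card3[OF T(1)] by (simp add: card_ge_0_finite)
    then have "card (T - {g}) = 2" using card3[OF T(1)] T(2) by simp
    then obtain b b' where bb: "T - {g} = {b, b'}" "b \<noteq> b'" unfolding card_2_iff by blast
    have Teq: "T = {g, b, b'}" using insert_Diff[OF T(2), unfolded bb(1)] by (rule sym)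
    have Tne: "g \<noteq> b" "g \<noteq> b'" using bb(1) by blast+
    have "\<phi> (b, b') = g" unfolding \<phi>_def prod.case
    proof (rule the_equality)
      show "\<exists>T\<in>TT. {b, b'} \<subseteq> T \<and> g \<in> T \<and> g \<noteq> b \<and> g \<noteq> b'" unfolding Teq using T(1) Tne unfolding Teq by blast
      fix g' assume "\<exists>T\<in>TT. {b, b'} \<subseteq> T \<and> g' \<in> T \<and> g' \<noteq> b \<and> g' \<noteq> b'"
      then obtain T' where T': "T' \<in> TT" "{b, b'} \<subseteq> T'" "g' \<in> T'" "g' \<noteq> b" "g' \<noteq> b'" by auto
      have "{b, b'} \<subseteq> T" unfolding Teq by blast
      then have "T = T'" using linear[OF T(1) T'(1) bb(2)] T' by blast
      then show "g' = g" using T' unfolding Teq by blast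
    qed
    moreover have "(b, b') \<in> B \<times> B" using T(3) bb by auto
    ultimately show "g \<in> \<phi> ` (B \<times> B)" by (metis imageI)
  qed
  moreover have "finite (B \<times> B)" using fB by simp
  ultimately have fK: "finite K" and "card K \<le> card (B \<times> B)"
    by (auto intro: finite_subset surj_card_le simp del: card_cartesian_product)
  then have "card K \<le> k * k" using assms(2) mult_le_mono[OF assms(2) assms(2)]
    by (simp add: card_cartesian_product)
  moreover have "clos B = B \<union> K" by (simp add: clos_def K_def)
  ultimately show "finite (clos B)" "card (clos B) \<le> k + k\<^sup>2"
    using fB fK card_Un_le[of B K] assms(2) by (auto simp: power2_eq_square)
qed

text \<open>Two triangles through \<open>f\<close> share no other edge, so picking from each a
  second edge in \<open>C\<close> is injective.\<close>

lemma card_avoiding: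
  assumes "f \<in> E" "finite C" "card C \<le> m"
  shows "D - m \<le> card {T \<in> TT. f \<in> T \<and> (T - {f}) \<inter> C = {}}"
    and "card {T \<in> TT. f \<in> T \<and> (T - {f}) \<inter> C \<noteq> {}} \<le> m"
proof -
  define X where "X = {T \<in> TT. f \<in> T \<and> (T - {f}) \<inter> C \<noteq> {}}"
  define Y where "Y = {T \<in> TT. f \<in> T \<and> (T - {f}) \<inter> C = {}}"
  have fX: "finite X" and fY: "finite Y" using finTT by (auto simp: X_def Y_def)
  define \<psi> where "\<psi> T = (SOME c. c \<in> (T - {f}) \<inter> C)" for T
  have \<psi>: "\<psi> T \<in> (T - {f}) \<inter> C" if "T \<in> X" for T
  proof -
    have "\<exists>c. c \<in> (T - {f}) \<inter> C" using that unfolding X_def by blast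
    then show ?thesis unfolding \<psi>_def by (rule someI_ex)
  qed
  have "inj_on \<psi> X"
  proof
    fix T T' assume TX: "T \<in> X" "T' \<in> X" and eq: "\<psi> T = \<psi> T'"
    have a: "T \<in> TT" "T' \<in> TT" "f \<in> T" "f \<in> T'" using TX unfolding X_def by blast+
    have b: "\<psi> T \<in> T" "\<psi> T \<noteq> f" using \<psi>[OF TX(1)] by blast+
    have c: "\<psi> T \<in> T'" using \<psi>[OF TX(2)] unfolding eq by blast
    show "T = T'" by (rule linear[of T T' f "\<psi> T"]) (use a b c in blast)+
  qed
  moreover have "\<psi> ` X \<subseteq> C" using \<psi> by auto
  ultimately have "card X \<le> card C" using assms(2) card_inj_on_le by blast
  then show cX: "card X \<le> m" using assms(3) by simp
  have "{T \<in> TT. f \<in> T} = X \<union> Y" "X \<inter> Y = {}" by (auto simp: X_def Y_def)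
  then have "D = card X + card Y" using regular[OF assms(1)] card_Un_disjoint[OF fX fY] by simp
  then show "D - m \<le> card Y" using cX by simp
qed

lemma other_two:
  assumes "T \<in> TT" "f \<in> T"
  obtains g h where "T = {f, g, h}" "g \<noteq> h" "f \<noteq> g" "f \<noteq> h"
proof -
  have "finite T" using card3[OF assms(1)] by (simp add: card_ge_0_finite)
  then have "card (T - {f}) = 2" using card3[OF assms(1)] assms(2) by simp
  then obtain b b' where bb: "T - {f} = {b, b'}" "b \<noteq> b'" unfolding card_2_iff by blast
  have "T = {f, b, b'}" using insert_Diff[OF assms(2), unfolded bb(1)] by (rule sym)
  moreover have "f \<noteq> b" "f \<noteq> b'" using bb(1) by blast+
  ultimately show ?thesis using that[of b b'] bb(2) by blast
qed

text \<open>Delete the triangles through \<open>f\<close> and restore them one at a time. Each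
  restored triangle whose other two edges avoid the closure multiplies the partition function by one
  minus \<open>t * lam\<^sup>2\<close> times two successive values of \<open>pres\<close>, both at
  least \<open>l\<close>. Dropping the remaining triangles can only enlarge an upper bound.\<close>

lemma odds_upper:
  assumes s: "st B Q k" and f: "f \<in> E - B" and l: "0 \<le> l" "l \<le> 1"
    and low: "\<And>B' Q' g. st B' Q' (k + 2) \<Longrightarrow> g \<in> E - B' \<Longrightarrow> \<forall>T\<in>Q'. \<not> T \<subseteq> insert g B' \<Longrightarrow> l \<le> pres B' Q' g"
  shows "pres B Q f \<le> (1 - t * (lam * l)\<^sup>2) ^ (D - (k + k\<^sup>2))"
proof -
  have B: "B \<subseteq> E" "card B \<le> k" "Q \<subseteq> TT" "\<And>T. T \<in> TT \<Longrightarrow> T \<inter> B = {} \<Longrightarrow> T \<in> Q" "\<And>T. T \<in> Q \<Longrightarrow> \<not> T \<subseteq> B"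
    using s by (auto simp: st_def)
  have finB: "finite B" using B(1) finE by (rule finite_subset)
  define q where "q = 1 - t * (lam * l)\<^sup>2"
  have "t * (lam * l)\<^sup>2 \<le> 1 * 1" using t lam l
    by (intro mult_mono) (auto intro: power_le_one mult_le_one)
  moreover have "0 \<le> t * (lam * l)\<^sup>2" using t by simp
  ultimately have q: "0 \<le> q" "q \<le> 1" by (auto simp: q_def)
  define G where "G = {T \<in> TT. f \<in> T \<and> (T - {f}) \<inter> clos B = {}}"
  define Q0 where "Q0 = Q - {T. f \<in> T}"
  have fG: "finite G" using finTT by (simp add: G_def)
  have GQ: "G \<subseteq> Q"
  proof
    fix T assume "T \<in> G"
    then have "T \<in> TT" "T \<inter> B = {}" using f by (auto simp: G_def clos_def)
    then show "T \<in> Q" using B by auto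
  qed
  have main: "pf (insert f B) (Q0 \<union> F) \<le> pf (insert f B) Q0 * q ^ card F" if "finite F" "F \<subseteq> G" for F
    using that
  proof (induction F rule: finite_induct)
    case empty then show ?case by simp
  next
    case (insert T F)
    let ?R = "Q0 \<union> F"
    have TG: "T \<in> G" and FG: "F \<subseteq> G" using insert by auto
    have TT: "T \<in> TT" "f \<in> T" "(T - {f}) \<inter> clos B = {}" using TG by (auto simp: G_def)
    obtain g h where gh: "T = {f, g, h}" "g \<noteq> h" "f \<noteq> g" "f \<noteq> h" using other_two[OF TT(1,2)] .
    have gc: "g \<notin> clos B" "h \<notin> clos B" using TT gh by auto
    then have gB: "g \<notin> B" "h \<notin> B" by (auto simp: clos_def)
    have gE: "g \<in> E" "h \<in> E" using subE[OF TT(1)] gh by auto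
    have TR: "T \<notin> ?R" using insert TT by (auto simp: Q0_def)
    have RT: "insert T ?R \<subseteq> TT" using B FG TT by (auto simp: Q0_def G_def)
    have Rcont: "T' \<in> ?R" if "T' \<in> TT" "T' \<inter> insert f B = {}" for T'
      using that B by (auto simp: Q0_def)
    \<comment> \<open>A triangle of \<open>?R\<close> contains \<open>f\<close> only if it belongs
      to \<open>F\<close>; then it is disjoint from \<open>B\<close> and too large to fit into
      \<open>{g, f}\<close>. Any other one would put \<open>g\<close> into the closure.\<close>
    have no1: "\<not> T' \<subseteq> insert g (insert f B)" if "T' \<in> ?R" for T'
    proof
      assume sub: "T' \<subseteq> insert g (insert f B)"
      have T': "T' \<in> TT" using that RT by auto
      show False
      proof (cases "T' \<in> F")
        case True
        then have "T' \<inter> B = {}" using FG f by (auto simp: G_def clos_def)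
        then have "T' \<subseteq> {g, f}" using sub by auto
        then have "card T' \<le> card {g, f}" by (intro card_mono) auto
        also have "\<dots> \<le> 2" by (simp add: card_insert_if)
        finally show False using card3[OF T'] by simp
      next
        case False
        then have "f \<notin> T'" "T' \<in> Q" using that by (auto simp: Q0_def)
        then have "T' - {g} \<subseteq> B" using sub by auto
        moreover have "g \<in> T'" using B(5)[OF \<open>T' \<in> Q\<close>] \<open>T' - {g} \<subseteq> B\<close> by auto
        ultimately show False using gc T' by (auto simp: clos_def)
      qed
    qed
    \<comment> \<open>By \<open>no1\<close> such a triangle contains \<open>h\<close>. By linearity
      it shares no other edge with \<open>T\<close>, so it would put \<open>h\<close> into the
      closure of \<open>B\<close>.\<close>
    have no2: "\<not> T' \<subseteq> insert h (insert g (insert f B))" if "T' \<in> ?R" for T'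
    proof
      assume sub: "T' \<subseteq> insert h (insert g (insert f B))"
      have T': "T' \<in> TT" using that RT by auto
      have hT: "h \<in> T'" using no1[OF that] sub by auto
      have "T' \<noteq> T" using that TR by auto
      then have "f \<notin> T'" "g \<notin> T'" using linear[OF T' TT(1), of f h] linear[OF T' TT(1), of g h] gh hT by auto
      then show False using sub hT gc T' by (auto simp: clos_def)
    qed
    \<comment> \<open>First \<open>f\<close> and then \<open>g\<close> is exposed, whence
      \<open>k + 2\<close>.\<close>
    have c1: "card (insert f B) \<le> k + 1" using B finB by (simp add: card_insert_if)
    then have c2: "card (insert g (insert f B)) \<le> k + 2" using finB by (simp add: card_insert_if)
    have no0: "\<not> T' \<subseteq> insert f B" if "T' \<in> ?R" for T' using no1[OF that] by blast
    have st1: "st (insert f B) ?R (k + 2)"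
      using B(1) f c1 RT Rcont no0 unfolding st_def by auto
    have st2: "st (insert g (insert f B)) ?R (k + 2)"
      using B(1) f c2 RT Rcont no1 gE unfolding st_def by auto
    have p1: "l \<le> pres (insert f B) ?R g"
      by (rule low[OF st1]) (use gE gB gh no1 in auto)
    have p2: "l \<le> pres (insert g (insert f B)) ?R h"
      by (rule low[OF st2]) (use gE gB gh no2 in auto)
    have pos1: "1 \<le> pf (insert f B) ?R" using no0 by (intro pf_ge_1) blast
    have pos2: "1 \<le> pf (insert g (insert f B)) ?R" using no1 by (intro pf_ge_1) blast
    have "l * l * pf (insert f B) ?R \<le> l * pf (insert g (insert f B)) ?R"
      using p1 pos1 l unfolding pres_def by (simp add: field_simps mult_left_mono)
    also have "\<dots> \<le> pf (insert h (insert g (insert f B))) ?R"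
      using p2 pos2 unfolding pres_def by (simp add: field_simps)
    finally have pp: "l\<^sup>2 * pf (insert f B) ?R \<le> pf (insert h (insert g (insert f B))) ?R"
      by (simp add: power2_eq_square)
    have "T - insert f B = {g, h}" using gh gB by auto
    then have "pf (insert f B) (insert T ?R) = pf (insert f B) ?R - t * lam\<^sup>2 * pf (insert h (insert g (insert f B))) ?R"
      using pf_add_edge_2[OF TR RT _ gh(2)] by simp
    also have "\<dots> \<le> pf (insert f B) ?R - t * lam\<^sup>2 * (l\<^sup>2 * pf (insert f B) ?R)"
      using pp t by (intro diff_left_mono mult_left_mono) auto
    also have "\<dots> = pf (insert f B) ?R * q" by (simp add: q_def algebra_simps power_mult_distrib)
    also have "\<dots> \<le> pf (insert f B) Q0 * q ^ card F * q"
      using insert q by (intro mult_right_mono) auto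
    finally show ?case using insert by (simp add: mult_ac)
  qed
  have Q0T: "Q0 \<union> G \<subseteq> Q" using GQ by (auto simp: Q0_def)
  have "pf (insert f B) Q \<le> pf (insert f B) (Q0 \<union> G)" using Q0T B by (intro pf_antimono) auto
  also have "\<dots> \<le> pf (insert f B) Q0 * q ^ card G" using main[OF fG] by simp
  also have "\<dots> \<le> pf B Q * q ^ card G"
    using pf_split[OF f, of Q] pf_nonneg lam q unfolding Q0_def by (intro mult_right_mono) auto
  finally have "pres B Q f \<le> q ^ card G"
    using pf_ge_1[of Q B] B unfolding pres_def by (simp add: divide_le_eq mult.commute)
  also have "\<dots> \<le> q ^ (D - (k + k\<^sup>2))"
    using card_avoiding(1)[of f "clos B" "k + k\<^sup>2"] card_clos[OF B(1,2)] f q unfolding G_def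
    by (intro power_decreasing) auto
  finally show ?thesis unfolding q_def .
qed

text \<open>The same restoration of triangles, now keeping account of all of them: a triangle away
  from the closure preserves at least the fraction \<open>1 - t * (lam * u)\<^sup>2\<close> of the
  partition function, any other one at least \<open>1 - lam\<close>, and there are at most
  \<open>k + k\<^sup>2\<close> of the latter. The denominator \<open>1 + lam\<close> covers the
  passage from the absence of \<open>f\<close> to the whole partition function.\<close>

lemma odds_lower:
  assumes s: "st B Q k" and f: "f \<in> E - B" and nof: "\<forall>T\<in>Q. \<not> T \<subseteq> insert f B" and u: "0 \<le> u" "u \<le> 1"
    and up: "\<And>B' Q' g. st B' Q' (k + 2) \<Longrightarrow> g \<in> E - B' \<Longrightarrow> pres B' Q' g \<le> u"
  shows "(1 - t * (lam * u)\<^sup>2) ^ D * (1 - lam) ^ (k + k\<^sup>2) / (1 + lam) \<le> pres B Q f"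
proof -
  have B: "B \<subseteq> E" "card B \<le> k" "Q \<subseteq> TT" "\<And>T. T \<in> TT \<Longrightarrow> T \<inter> B = {} \<Longrightarrow> T \<in> Q" "\<And>T. T \<in> Q \<Longrightarrow> \<not> T \<subseteq> B"
    using s by (auto simp: st_def)
  have finB: "finite B" using B(1) finE by (rule finite_subset)
  define q where "q = 1 - t * (lam * u)\<^sup>2"
  have "t * (lam * u)\<^sup>2 \<le> 1 * 1" using t lam u
    by (intro mult_mono) (auto intro: power_le_one mult_le_one)
  moreover have "0 \<le> t * (lam * u)\<^sup>2" using t by simp
  ultimately have q: "0 \<le> q" "q \<le> 1" by (auto simp: q_def)
  define G where "G = {T \<in> TT. f \<in> T \<and> (T - {f}) \<inter> clos B = {}}"
  define \<beta> where "\<beta> T = (if T \<in> G then q else 1 - lam)" for T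
  have \<beta>: "0 \<le> \<beta> T" for T using q lam by (auto simp: \<beta>_def)
  define Q0 where "Q0 = Q - {T. f \<in> T}"
  define Q1 where "Q1 = {T \<in> Q. f \<in> T}"
  have fQ1: "finite Q1" using finTT B by (auto simp: Q1_def intro: finite_subset)
  have main: "pf (insert f B) Q0 * (\<Prod>T\<in>F. \<beta> T) \<le> pf (insert f B) (Q0 \<union> F)" if "finite F" "F \<subseteq> Q1" for F
    using that
  proof (induction F rule: finite_induct)
    case empty then show ?case by simp
  next
    case (insert T F)
    let ?R = "Q0 \<union> F"
    have TQ: "T \<in> Q" "f \<in> T" and FQ: "F \<subseteq> Q1" using insert by (auto simp: Q1_def)
    have TT: "T \<in> TT" using TQ B by auto
    obtain g h where gh: "T = {f, g, h}" "g \<noteq> h" "f \<noteq> g" "f \<noteq> h" using other_two[OF TT TQ(2)] .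
    have gE: "g \<in> E" "h \<in> E" using subE[OF TT] gh by auto
    have TR: "T \<notin> ?R" using insert TQ by (auto simp: Q0_def)
    have RQ: "?R \<subseteq> Q" using FQ by (auto simp: Q0_def Q1_def)
    have RT: "insert T ?R \<subseteq> TT" using B RQ TT by auto
    have Rcont: "T' \<in> ?R" if "T' \<in> TT" "T' \<inter> insert f B = {}" for T'
      using that B by (auto simp: Q0_def)
    have nof': "\<not> T' \<subseteq> insert f B" if "T' \<in> ?R" for T' using nof RQ that by auto
    have pos1: "1 \<le> pf (insert f B) ?R" using nof' by (intro pf_ge_1) blast
    have c1: "card (insert f B) \<le> k + 1" using B finB by (simp add: card_insert_if)
    have st1: "st (insert f B) ?R (k + 2)"
      using B f c1 RT Rcont nof' unfolding st_def by auto
    have step: "pf (insert f B) ?R * \<beta> T \<le> pf (insert f B) (insert T ?R)"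
    proof (cases "T \<in> G")
      case True
      then have gc: "g \<notin> clos B" "h \<notin> clos B" using gh by (auto simp: G_def)
      then have gB: "g \<notin> B" "h \<notin> B" by (auto simp: clos_def)
      have no1: "\<not> T' \<subseteq> insert g (insert f B)" if "T' \<in> ?R" for T'
      proof
        assume sub: "T' \<subseteq> insert g (insert f B)"
        have T': "T' \<in> TT" using that RT by auto
        have gT: "g \<in> T'" using nof'[OF that] sub by auto
        have "T' \<noteq> T" using that TR by auto
        then have "f \<notin> T'" using linear[OF T' TT(1), of f g] gh gT by auto
        then show False using sub gT gc T' by (auto simp: clos_def)
      qed
      have c2: "card (insert g (insert f B)) \<le> k + 2" using c1 finB by (simp add: card_insert_if)
      have st2: "st (insert g (insert f B)) ?R (k + 2)"
        using B f c2 RT Rcont no1 gE unfolding st_def by auto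
      have pos2: "1 \<le> pf (insert g (insert f B)) ?R" using no1 by (intro pf_ge_1) blast
      have p1: "pres (insert f B) ?R g \<le> u" by (rule up[OF st1]) (use gE gB gh in auto)
      have p2: "pres (insert g (insert f B)) ?R h \<le> u" by (rule up[OF st2]) (use gE gB gh in auto)
      have "pf (insert h (insert g (insert f B))) ?R \<le> u * pf (insert g (insert f B)) ?R"
        using p2 pos2 unfolding pres_def by (simp add: field_simps)
      also have "\<dots> \<le> u * (u * pf (insert f B) ?R)"
        using p1 pos1 u unfolding pres_def by (intro mult_left_mono) (auto simp: field_simps)
      finally have pp: "pf (insert h (insert g (insert f B))) ?R \<le> u\<^sup>2 * pf (insert f B) ?R"
        by (simp add: power2_eq_square mult_ac)
      have "T - insert f B = {g, h}" using gh gB by auto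
      then have "pf (insert f B) (insert T ?R) = pf (insert f B) ?R - t * lam\<^sup>2 * pf (insert h (insert g (insert f B))) ?R"
        using pf_add_edge_2[OF TR RT _ gh(2)] by simp
      moreover have "\<dots> \<ge> pf (insert f B) ?R - t * lam\<^sup>2 * (u\<^sup>2 * pf (insert f B) ?R)"
        using pp t by (intro diff_left_mono mult_left_mono) auto
      moreover have "pf (insert f B) ?R - t * lam\<^sup>2 * (u\<^sup>2 * pf (insert f B) ?R) = pf (insert f B) ?R * q"
        by (simp add: q_def algebra_simps power_mult_distrib)
      ultimately show ?thesis using True by (simp add: \<beta>_def)
    next
      case False
      have tl: "t * lam * x \<le> lam * x" if "0 \<le> x" for x :: real
        using that t lam mult_right_mono[of t 1 "lam * x"] by (simp add: mult_ac)
      have "pf (insert f B) (insert T ?R) \<ge> pf (insert f B) ?R * (1 - lam)"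
      proof -
        \<comment> \<open>At least one edge of \<open>T\<close> is still open, so completing
          \<open>T\<close> brings at least one factor \<open>lam\<close>; a second one is bounded by
          1.\<close>
        have "\<not> T \<subseteq> insert f B" using nof TQ by auto
        then consider "g \<notin> B" "h \<notin> B" | "g \<notin> B" "h \<in> B" | "g \<in> B" "h \<notin> B" using gh by auto
        then show ?thesis
        proof cases
          case 1
          then have d: "T - insert f B = {g, h}" using gh by auto
          have "pf (insert h (insert g (insert f B))) ?R \<le> pf (insert g (insert f B)) ?R"
            using 1 gh gE RT by (intro pf_insert_le) auto
          also have "\<dots> \<le> pf (insert f B) ?R" using 1 gh gE RT by (intro pf_insert_le) auto
          finally have x: "pf (insert h (insert g (insert f B))) ?R \<le> pf (insert f B) ?R" .
          have "t * lam\<^sup>2 * pf (insert h (insert g (insert f B))) ?R \<le> 1 * (lam * 1) * pf (insert f B) ?R"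
            unfolding power2_eq_square using x t lam pf_nonneg by (intro mult_mono) auto
          then show ?thesis using pf_add_edge_2[OF TR RT d gh(2)] by (simp add: algebra_simps)
        next
          case 2
          then have d: "T - insert f B = {g}" using gh by auto
          have x: "pf (insert g (insert f B)) ?R \<le> pf (insert f B) ?R"
            using 2 gh gE RT by (intro pf_insert_le) auto
          have "t * lam * pf (insert g (insert f B)) ?R \<le> 1 * lam * pf (insert f B) ?R"
            using x t lam pf_nonneg by (intro mult_mono) auto
          then show ?thesis using pf_add_edge_1[OF TR RT d] by (simp add: algebra_simps)
        next
          case 3
          then have d: "T - insert f B = {h}" using gh by auto
          have x: "pf (insert h (insert f B)) ?R \<le> pf (insert f B) ?R"
            using 3 gh gE RT by (intro pf_insert_le) auto
          have "t * lam * pf (insert h (insert f B)) ?R \<le> 1 * lam * pf (insert f B) ?R"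
            using x t lam pf_nonneg by (intro mult_mono) auto
          then show ?thesis using pf_add_edge_1[OF TR RT d] by (simp add: algebra_simps)
        qed
      qed
      then show ?thesis using False by (simp add: \<beta>_def)
    qed
    have "pf (insert f B) Q0 * (\<Prod>T\<in>insert T F. \<beta> T) = pf (insert f B) Q0 * (\<Prod>T\<in>F. \<beta> T) * \<beta> T"
      using insert by (simp add: mult_ac)
    also have "\<dots> \<le> pf (insert f B) ?R * \<beta> T" using insert \<beta> by (intro mult_right_mono) auto
    also have "\<dots> \<le> pf (insert f B) (Q0 \<union> insert T F)" using step by simp
    finally show ?case .
  qed
  have Qu: "Q0 \<union> Q1 = Q" by (auto simp: Q0_def Q1_def)
  have prod: "q ^ D * (1 - lam) ^ (k + k\<^sup>2) \<le> (\<Prod>T\<in>Q1. \<beta> T)"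
  proof -
    have "(\<Prod>T\<in>Q1. \<beta> T) = (\<Prod>T\<in>Q1 \<inter> G. \<beta> T) * (\<Prod>T\<in>Q1 - G. \<beta> T)"
      using fQ1 by (metis prod.Int_Diff)
    also have "(\<Prod>T\<in>Q1 \<inter> G. \<beta> T) = q ^ card (Q1 \<inter> G)"
      by (simp add: \<beta>_def)
    also have "(\<Prod>T\<in>Q1 - G. \<beta> T) = (1 - lam) ^ card (Q1 - G)"
      by (simp add: \<beta>_def)
    finally have e: "(\<Prod>T\<in>Q1. \<beta> T) = q ^ card (Q1 \<inter> G) * (1 - lam) ^ card (Q1 - G)" .
    have "card (Q1 \<inter> G) \<le> card {T \<in> TT. f \<in> T}" using finTT by (intro card_mono) (auto simp: G_def)
    then have c1: "card (Q1 \<inter> G) \<le> D" using regular f by auto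
    have "card (Q1 - G) \<le> card {T \<in> TT. f \<in> T \<and> (T - {f}) \<inter> clos B \<noteq> {}}"
      using finTT B by (intro card_mono) (auto simp: G_def Q1_def)
    also have "\<dots> \<le> k + k\<^sup>2" using card_avoiding(2)[of f "clos B" "k + k\<^sup>2"] card_clos[OF B(1,2)] f by auto
    finally have c2: "card (Q1 - G) \<le> k + k\<^sup>2" .
    show ?thesis unfolding e using q lam c1 c2 by (intro mult_mono power_decreasing) auto
  qed
  define z0 where "z0 = pf (insert f B) Q0"
  define z1 where "z1 = pf (insert f B) Q"
  have z0: "1 \<le> z0" unfolding z0_def using nof by (intro pf_ge_1) (auto simp: Q0_def)
  have z1: "0 \<le> z1" "z1 \<le> z0" unfolding z0_def z1_def using pf_nonneg B
    by (auto intro!: pf_antimono simp: Q0_def)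
  have "z0 * (q ^ D * (1 - lam) ^ (k + k\<^sup>2)) \<le> z0 * (\<Prod>T\<in>Q1. \<beta> T)"
    using prod z0 by (intro mult_left_mono) auto
  also have "\<dots> \<le> z1" using main[OF fQ1] by (simp add: Qu z0_def z1_def)
  finally have zz: "z0 * (q ^ D * (1 - lam) ^ (k + k\<^sup>2)) \<le> z1" .
  have "pf B Q = z0 + lam * z1" using pf_split[OF f, of Q] by (simp add: z0_def z1_def Q0_def)
  also have "\<dots> \<le> z0 * (1 + lam)" using z1 lam by (simp add: algebra_simps mult_left_mono)
  finally have le: "pf B Q \<le> z0 * (1 + lam)" .
  have pos: "0 < pf B Q" using pf_ge_1[of Q B] B by auto
  have "q ^ D * (1 - lam) ^ (k + k\<^sup>2) \<le> z1 / z0"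
    using zz z0 by (subst pos_le_divide_eq) (auto simp: mult.commute)
  then have "q ^ D * (1 - lam) ^ (k + k\<^sup>2) / (1 + lam) \<le> z1 / (z0 * (1 + lam))"
    using divide_right_mono[of _ "z1 / z0" "1 + lam"] lam by simp
  also have "\<dots> \<le> z1 / pf B Q" using le pos z1 by (intro divide_left_mono) auto
  finally show ?thesis unfolding pres_def z1_def q_def .
qed

end

section \<open>Contraction and convergence of the edge marginals\<close>

lemma mult_exp_minus_le:
  fixes y :: real shows "y * exp (- y) \<le> exp (- 1)"
proof -
  have "y \<le> exp (y - 1)" using exp_ge_add_one_self[of "y - 1"] by simp
  then have "y * exp (- y) \<le> exp (y - 1) * exp (- y)" by (intro mult_right_mono) auto
  also have "\<dots> = exp (- 1)" by (simp flip: exp_add)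
  finally show ?thesis .
qed

text \<open>By the mean value theorem it is enough to bound the slope by 1. Its square is
  \<open>2 * a * (v * exp (- v))\<close> with \<open>v = 2 * a * z\<^sup>2\<close>, hence at most
  \<open>2 * a / exp 1\<close>.\<close>

lemma gauss_contraction:
  fixes a l u :: real
  assumes "0 \<le> a" "2 * a < exp 1" "0 \<le> l" "l < u"
  shows "exp (- a * l\<^sup>2) - exp (- a * u\<^sup>2) < u - l"
proof -
  define F where "F z = exp (- a * z\<^sup>2)" for z :: real
  have der: "(F has_real_derivative (- (2 * a * z) * exp (- a * z\<^sup>2))) (at z)" for z
    unfolding F_def by (auto intro!: derivative_eq_intros)
  obtain z where z: "l < z" "z < u" "F u - F l = (u - l) * (- (2 * a * z) * exp (- a * z\<^sup>2))"
    using MVT2[OF assms(4), of F, OF der] by blast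
  define y where "y = 2 * a * z * exp (- a * z\<^sup>2)"
  have "y\<^sup>2 = 2 * a * ((2 * a * z\<^sup>2) * exp (- (2 * a * z\<^sup>2)))"
    by (simp add: y_def power2_eq_square algebra_simps flip: exp_add)
  also have "\<dots> \<le> 2 * a * exp (- 1)"
    by (intro mult_left_mono mult_exp_minus_le) (use assms in auto)
  also have "\<dots> < exp 1 * exp (- 1)" using assms by (intro mult_strict_right_mono) auto
  also have "\<dots> = 1\<^sup>2" by (simp flip: exp_add)
  finally have "y < 1" by (rule power_less_imp_less_base) simp
  have "F l - F u = (u - l) * y" using z by (simp add: y_def algebra_simps)
  also have "\<dots> < (u - l) * 1" using \<open>y < 1\<close> assms by (intro mult_strict_left_mono) auto
  finally show ?thesis by (simp add: F_def)
qed

text \<open>At activity of order \<open>1 / sqrt D\<close> the \<open>D\<close> triangles through an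
  edge carry a total penalty of order \<open>t * c\<^sup>2\<close> times two marginals, so the
  recursion has a nontrivial limit.\<close>

locale hypergraph_seq =
  fixes E :: "nat \<Rightarrow> 'a set" and TT :: "nat \<Rightarrow> 'a set set" and D :: "nat \<Rightarrow> nat" and c t :: real
  assumes lin: "\<forall>\<^sub>F n in sequentially. linear_hypergraph (E n) (TT n) (D n) (c / sqrt (D n)) t"
    and nonempty: "\<forall>\<^sub>F n in sequentially. E n \<noteq> {}"
    and D_top: "filterlim D at_top sequentially"
    and c: "0 \<le> c" and t: "0 \<le> t" "t \<le> 1"
begin

abbreviation "lam n \<equiv> c / sqrt (D n)"
abbreviation "st n \<equiv> linear_hypergraph.st (E n) (TT n)"
abbreviation "pres n \<equiv> linear_hypergraph.pres (E n) (lam n) t"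

text \<open>The order of quantifiers matters: how large \<open>n\<close> must be may depend on the
  number of exposed edges, which each use of the recursion raises by 2.\<close>

definition up :: "real \<Rightarrow> bool" where
  "up \<rho> \<longleftrightarrow> (\<forall>\<epsilon>>0. \<forall>k. \<forall>\<^sub>F n in sequentially. \<forall>B Q f.
     st n B Q k \<longrightarrow> f \<in> E n - B \<longrightarrow> pres n B Q f \<le> \<rho> + \<epsilon>)"

text \<open>An edge completing a triangle with two exposed edges is penalised by
  \<open>1 - t\<close> at once, possibly down to 0, so it has to be excepted from the lower
  bound.\<close>

definition lo :: "real \<Rightarrow> bool" where
  "lo \<rho> \<longleftrightarrow> (\<forall>\<epsilon>>0. \<forall>k. \<forall>\<^sub>F n in sequentially. \<forall>B Q f.
     st n B Q k \<longrightarrow> f \<in> E n - B \<longrightarrow> (\<forall>T\<in>Q. \<not> T \<subseteq> insert f B) \<longrightarrow> \<rho> - \<epsilon> \<le> pres n B Q f)"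

definition F :: "real \<Rightarrow> real" where "F \<rho> = exp (- (t * c\<^sup>2) * \<rho>\<^sup>2)"

lemma up_1: "up 1"
  unfolding up_def
proof (intro allI impI)
  fix \<epsilon> :: real and k :: nat assume "\<epsilon> > 0"
  show "\<forall>\<^sub>F n in sequentially. \<forall>B Q f. st n B Q k \<longrightarrow> f \<in> E n - B \<longrightarrow> pres n B Q f \<le> 1 + \<epsilon>"
    using lin
  proof eventually_elim
    case (elim n)
    interpret H: linear_hypergraph "E n" "TT n" "D n" "lam n" t by (rule elim)
    show ?case
    proof (intro allI impI)
      fix B Q f assume "st n B Q k" "f \<in> E n - B"
      then have "pres n B Q f \<le> 1" by (intro H.pres_le_1) (auto simp: H.st_def)
      then show "pres n B Q f \<le> 1 + \<epsilon>" using \<open>\<epsilon> > 0\<close> by simp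
    qed
  qed
qed

lemma lo_0: "lo 0"
  unfolding lo_def
proof (intro allI impI)
  fix \<epsilon> :: real and k :: nat assume "\<epsilon> > 0"
  show "\<forall>\<^sub>F n in sequentially. \<forall>B Q f. st n B Q k \<longrightarrow> f \<in> E n - B \<longrightarrow>
     (\<forall>T\<in>Q. \<not> T \<subseteq> insert f B) \<longrightarrow> 0 - \<epsilon> \<le> pres n B Q f"
    using lin
  proof eventually_elim
    case (elim n)
    interpret H: linear_hypergraph "E n" "TT n" "D n" "lam n" t by (rule elim)
    show ?case using H.pres_nonneg \<open>\<epsilon> > 0\<close> by (auto intro: order_trans[of _ 0])
  qed
qed

lemma lam_tendsto: "(\<lambda>n. lam n) \<longlonglongrightarrow> 0"
proof -
  have "(\<lambda>d::nat. c / sqrt d) \<longlonglongrightarrow> 0" by real_asymp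
  then show ?thesis by (rule filterlim_compose[OF _ D_top])
qed

lemma pow_tendsto: "(\<lambda>n. (1 - t * (lam n * r)\<^sup>2) ^ D n) \<longlonglongrightarrow> F r"
proof -
  have "(\<lambda>n. (1 + (- (t * c\<^sup>2 * r\<^sup>2)) / real (D n)) ^ D n) \<longlonglongrightarrow> exp (- (t * c\<^sup>2 * r\<^sup>2))"
    by (rule filterlim_compose[OF tendsto_exp_limit_sequentially D_top])
  then show ?thesis by (simp add: F_def power_mult_distrib power_divide algebra_simps)
qed

text \<open>The correction factors in \<open>odds_lower\<close> tend to 1, since \<open>k\<close> is
  fixed and \<open>lam n\<close> tends to 0; what remains is \<open>pow_tendsto\<close>.\<close>

lemma lo_F:
  assumes "up \<rho>" "0 \<le> \<rho>" shows "lo (F \<rho>)"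
  unfolding lo_def
proof (intro allI impI)
  fix \<epsilon> :: real and k :: nat assume \<epsilon>: "\<epsilon> > 0"
  have "isCont F \<rho>" unfolding F_def by (intro continuous_intros)
  then obtain \<delta> where \<delta>: "\<delta> > 0" "\<And>r. \<bar>r - \<rho>\<bar> < \<delta> \<Longrightarrow> \<bar>F r - F \<rho>\<bar> < \<epsilon> / 2"
    using \<epsilon> unfolding continuous_at_eps_delta dist_real_def by (metis half_gt_zero)
  \<comment> \<open>Clipping at 1 respects the range required of \<open>u\<close> and loses nothing,
    because \<open>pres\<close> never exceeds 1.\<close>
  define u where "u = min 1 (\<rho> + \<delta> / 2)"
  have u: "0 \<le> u" "u \<le> 1" using assms \<delta> by (auto simp: u_def)
  have "F (\<rho> + \<delta> / 2) \<le> F u" unfolding F_def u_def using t c assms \<delta>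
    by (auto simp: mult_left_mono intro!: mult_left_mono power_mono)
  moreover have "F \<rho> - \<epsilon> / 2 < F (\<rho> + \<delta> / 2)" using \<delta>(2)[of "\<rho> + \<delta> / 2"] \<delta>(1) by (simp add: abs_if split: if_splits)
  ultimately have Fu: "F \<rho> - \<epsilon> < F u" using \<epsilon> by simp
  have "(\<lambda>n. (1 - t * (lam n * u)\<^sup>2) ^ D n * (1 - lam n) ^ (k + k\<^sup>2) / (1 + lam n)) \<longlonglongrightarrow> F u * (1 - 0) ^ (k + k\<^sup>2) / (1 + 0)"
    by (intro tendsto_intros pow_tendsto lam_tendsto) auto
  then have "\<forall>\<^sub>F n in sequentially. F \<rho> - \<epsilon> < (1 - t * (lam n * u)\<^sup>2) ^ D n * (1 - lam n) ^ (k + k\<^sup>2) / (1 + lam n)"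
    using Fu by (intro order_tendstoD(1)) auto
  moreover have "\<forall>\<^sub>F n in sequentially. \<forall>B Q f. st n B Q (k + 2) \<longrightarrow> f \<in> E n - B \<longrightarrow> pres n B Q f \<le> \<rho> + \<delta> / 2"
    using assms(1) \<delta>(1) unfolding up_def by (meson half_gt_zero)
  ultimately show "\<forall>\<^sub>F n in sequentially. \<forall>B Q f. st n B Q k \<longrightarrow> f \<in> E n - B \<longrightarrow>
     (\<forall>T\<in>Q. \<not> T \<subseteq> insert f B) \<longrightarrow> F \<rho> - \<epsilon> \<le> pres n B Q f"
    using lin
  proof eventually_elim
    case (elim n)
    interpret H: linear_hypergraph "E n" "TT n" "D n" "lam n" t by (rule elim)
    show ?case
    proof (intro allI impI)
      fix B Q f assume a: "st n B Q k" "f \<in> E n - B" "\<forall>T\<in>Q. \<not> T \<subseteq> insert f B"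
      have "pres n B' Q' g \<le> u" if "st n B' Q' (k + 2)" "g \<in> E n - B'" for B' Q' g
      proof -
        have "Q' \<subseteq> TT n" using that(1) by (simp add: H.st_def)
        then show ?thesis using elim(2) H.pres_le_1[OF that(2)] that unfolding u_def by auto
      qed
      from H.odds_lower[OF a u this] show "F \<rho> - \<epsilon> \<le> pres n B Q f" using elim(1) by auto
    qed
  qed
qed

lemma up_F:
  assumes "lo \<rho>" "0 \<le> \<rho>" "\<rho> \<le> 1" shows "up (F \<rho>)"
  unfolding up_def
proof (intro allI impI)
  fix \<epsilon> :: real and k :: nat assume \<epsilon>: "\<epsilon> > 0"
  have "isCont F \<rho>" unfolding F_def by (intro continuous_intros)
  then obtain \<delta> where \<delta>: "\<delta> > 0" "\<And>r. \<bar>r - \<rho>\<bar> < \<delta> \<Longrightarrow> \<bar>F r - F \<rho>\<bar> < \<epsilon> / 2"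
    using \<epsilon> unfolding continuous_at_eps_delta dist_real_def by (metis half_gt_zero)
  \<comment> \<open>Clipped at 0, which is harmless because \<open>pres\<close> is
    nonnegative.\<close>
  define l where "l = max 0 (\<rho> - \<delta> / 2)"
  have l: "0 \<le> l" "l \<le> 1" using assms \<delta> by (auto simp: l_def)
  have "\<bar>l - \<rho>\<bar> < \<delta>" using assms \<delta>(1) by (auto simp: l_def)
  then have Fl: "F l < F \<rho> + \<epsilon>" using \<delta>(2)[of l] \<epsilon> by linarith
  define m where "m = k + k\<^sup>2"
  \<comment> \<open>Dividing by a fixed power with limit 1 converts the exponent
    \<open>D n - m\<close> into \<open>D n\<close>.\<close>
  have "(\<lambda>n. (1 - t * (lam n * l)\<^sup>2) ^ D n / (1 - t * (lam n * l)\<^sup>2) ^ m) \<longlonglongrightarrow> F l / (1 - t * (0 * l)\<^sup>2) ^ m"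
    by (intro tendsto_intros pow_tendsto lam_tendsto) auto
  then have ev1: "\<forall>\<^sub>F n in sequentially. (1 - t * (lam n * l)\<^sup>2) ^ D n / (1 - t * (lam n * l)\<^sup>2) ^ m < F \<rho> + \<epsilon>"
    using Fl by (intro order_tendstoD(2)) auto
  have "(\<lambda>n. 1 - t * (lam n * l)\<^sup>2) \<longlonglongrightarrow> 1 - t * (0 * l)\<^sup>2"
    by (intro tendsto_intros lam_tendsto)
  then have ev2: "\<forall>\<^sub>F n in sequentially. 0 < 1 - t * (lam n * l)\<^sup>2"
    by (intro order_tendstoD(1)) auto
  have ev3: "\<forall>\<^sub>F n in sequentially. m \<le> D n" using D_top by (simp add: filterlim_at_top)
  have ev4: "\<forall>\<^sub>F n in sequentially. \<forall>B Q f. st n B Q (k + 2) \<longrightarrow> f \<in> E n - B \<longrightarrow>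
     (\<forall>T\<in>Q. \<not> T \<subseteq> insert f B) \<longrightarrow> \<rho> - \<delta> / 2 \<le> pres n B Q f"
    using assms(1) \<delta>(1) unfolding lo_def by (meson half_gt_zero)
  show "\<forall>\<^sub>F n in sequentially. \<forall>B Q f. st n B Q k \<longrightarrow> f \<in> E n - B \<longrightarrow> pres n B Q f \<le> F \<rho> + \<epsilon>"
    using lin ev1 ev2 ev3 ev4
  proof eventually_elim
    case (elim n)
    interpret H: linear_hypergraph "E n" "TT n" "D n" "lam n" t by (rule elim)
    show ?case
    proof (intro allI impI)
      fix B Q f assume a: "st n B Q k" "f \<in> E n - B"
      have lw: "l \<le> pres n B' Q' g" if "st n B' Q' (k + 2)" "g \<in> E n - B'" "\<forall>T\<in>Q'. \<not> T \<subseteq> insert g B'" for B' Q' g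
        using elim(5) H.pres_nonneg that unfolding l_def by auto
      have "pres n B Q f \<le> (1 - t * (lam n * l)\<^sup>2) ^ (D n - m)"
        unfolding m_def by (rule H.odds_upper[OF a l lw])
      also have "\<dots> = (1 - t * (lam n * l)\<^sup>2) ^ D n / (1 - t * (lam n * l)\<^sup>2) ^ m"
        using elim(3,4) by (intro power_diff) auto
      finally show "pres n B Q f \<le> F \<rho> + \<epsilon>" using elim(2) by simp
    qed
  qed
qed

text \<open>Both bounds apply to one and the same quotient, that of the state with nothing exposed;
  nonemptiness of \<open>E n\<close> provides the edge.\<close>

lemma lo_le_up:
  assumes "lo l" "up u" shows "l \<le> u"
proof (rule field_le_epsilon)
  fix e :: real assume e: "e > 0"
  have "\<forall>\<^sub>F n in sequentially. \<forall>B Q f. st n B Q 0 \<longrightarrow> f \<in> E n - B \<longrightarrow> pres n B Q f \<le> u + e / 2"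
    using assms(2) e unfolding up_def by (meson half_gt_zero)
  moreover have "\<forall>\<^sub>F n in sequentially. \<forall>B Q f. st n B Q 0 \<longrightarrow> f \<in> E n - B \<longrightarrow>
     (\<forall>T\<in>Q. \<not> T \<subseteq> insert f B) \<longrightarrow> l - e / 2 \<le> pres n B Q f"
    using assms(1) e unfolding lo_def by (meson half_gt_zero)
  ultimately have "\<forall>\<^sub>F n in sequentially. l - e / 2 \<le> u + e / 2" using lin nonempty
  proof eventually_elim
    case (elim n)
    interpret H: linear_hypergraph "E n" "TT n" "D n" "lam n" t by (rule elim)
    obtain f where f: "f \<in> E n" using elim by auto
    have nsub: "\<not> T \<subseteq> X" if "T \<in> TT n" "finite X" "card X < 3" for T X
      using card_mono[OF that(2), of T] H.card3[OF that(1)] that(3) by auto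
    have "st n {} (TT n) 0" unfolding H.st_def using nsub[of _ "{}"] by auto
    moreover have "\<forall>T\<in>TT n. \<not> T \<subseteq> {f}" using nsub[of _ "{f}"] by auto
    ultimately have "l - e / 2 \<le> pres n {} (TT n) f" "pres n {} (TT n) f \<le> u + e / 2"
      using elim f by auto
    then show ?case by linarith
  qed
  then have "l - e / 2 \<le> u + e / 2" using eventually_happens'[OF sequentially_bot] by blast
  then show "l \<le> u + e" by simp
qed

text \<open>The best upper bound \<open>u\<close> and the best lower bound \<open>l\<close> are
  themselves valid bounds, and one step of the recursion gives \<open>F u \<le> l\<close> and
  \<open>u \<le> F l\<close>. As \<open>l \<le> u\<close>, strict contraction leaves only
  \<open>l = u\<close>, a fixed point. This replaces an iteration of the recursion.\<close>

theorem pres_tendsto: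
  assumes small: "2 * c\<^sup>2 < exp 1" and x: "0 \<le> x" "x = exp (- (t * c\<^sup>2) * x\<^sup>2)" and \<epsilon>: "\<epsilon> > 0"
  shows "\<forall>\<^sub>F n in sequentially. \<forall>f\<in>E n. \<bar>pres n {} (TT n) f - x\<bar> \<le> \<epsilon>"
proof -
  have F1: "0 \<le> F r" "F r \<le> 1" for r unfolding F_def using t by auto
  define U where "U = {\<rho>. 0 \<le> \<rho> \<and> up \<rho>}"
  define L where "L = {\<rho>. 0 \<le> \<rho> \<and> lo \<rho>}"
  have U1: "1 \<in> U" and L0: "0 \<in> L" using up_1 lo_0 by (auto simp: U_def L_def)
  have bU: "bdd_below U" by (auto simp: U_def)
  have bL: "bdd_above L" unfolding L_def using lo_le_up[OF _ up_1] by (intro bdd_aboveI[of _ 1]) auto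
  define u where "u = Inf U"
  define l where "l = Sup L"
  have u0: "0 \<le> u" unfolding u_def
  proof (rule cInf_greatest)
    show "U \<noteq> {}" using U1 by blast
  qed (simp add: U_def)
  have l0: "0 \<le> l" unfolding l_def using L0 bL by (intro cSup_upper)
  have upu: "up u" unfolding up_def
  proof (intro allI impI)
    fix e :: real and k :: nat assume e: "e > 0"
    have "Inf U < u + e / 2" using e by (simp add: u_def)
    then obtain \<rho> where \<rho>: "\<rho> \<in> U" "\<rho> < u + e / 2" using U1 bU cInf_less_iff[of U] by auto
    then have "\<forall>\<^sub>F n in sequentially. \<forall>B Q f. st n B Q k \<longrightarrow> f \<in> E n - B \<longrightarrow> pres n B Q f \<le> \<rho> + e / 2"
      using e unfolding U_def up_def by (auto dest!: spec[of _ "e / 2"])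
    then show "\<forall>\<^sub>F n in sequentially. \<forall>B Q f. st n B Q k \<longrightarrow> f \<in> E n - B \<longrightarrow> pres n B Q f \<le> u + e"
      by eventually_elim (use \<rho>(2) in fastforce)
  qed
  have lol: "lo l" unfolding lo_def
  proof (intro allI impI)
    fix e :: real and k :: nat assume e: "e > 0"
    have "l - e / 2 < Sup L" using e by (simp add: l_def)
    then obtain \<rho> where \<rho>: "\<rho> \<in> L" "l - e / 2 < \<rho>" using L0 bL less_cSup_iff[of L] by auto
    then have "\<forall>\<^sub>F n in sequentially. \<forall>B Q f. st n B Q k \<longrightarrow> f \<in> E n - B \<longrightarrow>
       (\<forall>T\<in>Q. \<not> T \<subseteq> insert f B) \<longrightarrow> \<rho> - e / 2 \<le> pres n B Q f"
      using e unfolding L_def lo_def by (auto dest!: spec[of _ "e / 2"])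
    then show "\<forall>\<^sub>F n in sequentially. \<forall>B Q f. st n B Q k \<longrightarrow> f \<in> E n - B \<longrightarrow>
       (\<forall>T\<in>Q. \<not> T \<subseteq> insert f B) \<longrightarrow> l - e \<le> pres n B Q f"
      by eventually_elim (use \<rho>(2) in fastforce)
  qed
  have lu: "l \<le> u" by (rule lo_le_up[OF lol upu])
  have u1: "u \<le> 1" unfolding u_def using U1 bU by (intro cInf_lower)
  have a: "F u \<le> l" unfolding l_def using lo_F[OF upu u0] F1 bL by (intro cSup_upper) (auto simp: L_def)
  have b: "u \<le> F l" unfolding u_def using up_F[OF lol l0] lu u1 F1 bU by (intro cInf_lower) (auto simp: U_def)
  have tc: "2 * (t * c\<^sup>2) < exp 1"
    using small t mult_right_mono[of t 1 "c\<^sup>2"] by auto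
  have "l = u"
  proof (rule ccontr)
    assume "l \<noteq> u"
    then have "l < u" using lu by simp
    from gauss_contraction[of "t * c\<^sup>2", OF _ tc l0 this] t have "F l - F u < u - l" by (simp add: F_def)
    then show False using a b by simp
  qed
  then have fu: "u = F u" using a b by simp
  \<comment> \<open>A decreasing map has at most one fixed point, so the given \<open>x\<close> is
    \<open>u\<close>.\<close>
  have mono: "F r' \<le> F r" if "0 \<le> r" "r \<le> r'" for r r'
    unfolding F_def using t that by (auto intro!: mult_left_mono power_mono)
  have "x = F x" using x(2) unfolding F_def .
  then have "x = u" using mono[of x u] mono[of u x] fu x(1) u0 by linarith
  have "\<forall>\<^sub>F n in sequentially. \<forall>B Q f. st n B Q 0 \<longrightarrow> f \<in> E n - B \<longrightarrow> pres n B Q f \<le> x + \<epsilon>"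
    using upu \<epsilon> unfolding up_def \<open>x = u\<close> by blast
  moreover have "\<forall>\<^sub>F n in sequentially. \<forall>B Q f. st n B Q 0 \<longrightarrow> f \<in> E n - B \<longrightarrow>
     (\<forall>T\<in>Q. \<not> T \<subseteq> insert f B) \<longrightarrow> x - \<epsilon> \<le> pres n B Q f"
    using lol \<epsilon> unfolding lo_def \<open>x = u\<close> \<open>l = u\<close> by blast
  ultimately show ?thesis using lin
  proof eventually_elim
    case (elim n)
    interpret H: linear_hypergraph "E n" "TT n" "D n" "lam n" t by (rule elim)
    have nsub: "\<not> T \<subseteq> X" if "T \<in> TT n" "finite X" "card X < 3" for T X
      using card_mono[OF that(2), of T] H.card3[OF that(1)] that(3) by auto
    have s: "st n {} (TT n) 0" unfolding H.st_def using nsub[of _ "{}"] by auto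
    show ?case
    proof
      fix f assume f: "f \<in> E n"
      have "\<forall>T\<in>TT n. \<not> T \<subseteq> insert f {}" using nsub[of _ "{f}"] by auto
      then have "x - \<epsilon> \<le> pres n {} (TT n) f" "pres n {} (TT n) f \<le> x + \<epsilon>"
        using elim s f by auto
      then show "\<bar>pres n {} (TT n) f - x\<bar> \<le> \<epsilon>" by linarith
    qed
  qed
qed

end

text \<open>Differentiating \<open>s ^ card S\<close> marks an element of \<open>S\<close>; the sum
  is then grouped by the marked element.\<close>

lemma subset_sum_has_derivative:
  fixes v :: "'a set \<Rightarrow> real"
  assumes "finite E"
  shows "((\<lambda>s. \<Sum>S\<in>Pow E. s ^ card S * v S) has_real_derivative
     (\<Sum>e\<in>E. \<Sum>S\<in>Pow (E - {e}). s ^ card S * v (insert e S))) (at s within X)"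
proof -
  have fin: "finite S" if "S \<in> Pow E" for S using that assms finite_subset by blast
  have "((\<lambda>s. \<Sum>S\<in>Pow E. s ^ card S * v S) has_real_derivative
     (\<Sum>S\<in>Pow E. real (card S) * s ^ (card S - 1) * v S)) (at s within X)"
    by (auto intro!: derivative_eq_intros sum.cong)
  also have "(\<Sum>S\<in>Pow E. real (card S) * s ^ (card S - 1) * v S)
      = (\<Sum>S\<in>Pow E. \<Sum>e\<in>E. if e \<in> S then s ^ (card S - 1) * v S else 0)"
  proof (rule sum.cong[OF refl])
    fix S assume S: "S \<in> Pow E"
    have "(\<Sum>e\<in>E. if e \<in> S then s ^ (card S - 1) * v S else 0) = (\<Sum>e\<in>S. s ^ (card S - 1) * v S)"
      using S assms by (intro sum.mono_neutral_cong_right) auto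
    then show "real (card S) * s ^ (card S - 1) * v S = (\<Sum>e\<in>E. if e \<in> S then s ^ (card S - 1) * v S else 0)"
      by simp
  qed
  also have "\<dots> = (\<Sum>e\<in>E. \<Sum>S\<in>Pow E. if e \<in> S then s ^ (card S - 1) * v S else 0)"
    by (rule sum.swap)
  also have "\<dots> = (\<Sum>e\<in>E. \<Sum>S\<in>Pow (E - {e}). s ^ card S * v (insert e S))"
  proof (rule sum.cong[OF refl])
    fix e assume e: "e \<in> E"
    have im: "{S \<in> Pow E. e \<in> S} = insert e ` Pow (E - {e})"
    proof (intro equalityI subsetI)
      fix S assume "S \<in> {S \<in> Pow E. e \<in> S}"
      then have "S = insert e (S - {e})" "S - {e} \<in> Pow (E - {e})" by auto
      then show "S \<in> insert e ` Pow (E - {e})" by blast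
    qed (use e in auto)
    have inj: "inj_on (insert e) (Pow (E - {e}))" by (auto simp: inj_on_def)
    have "(\<Sum>S\<in>Pow E. if e \<in> S then s ^ (card S - 1) * v S else 0)
        = (\<Sum>S\<in>{S \<in> Pow E. e \<in> S}. s ^ (card S - 1) * v S)"
      using assms by (subst sum.inter_filter) auto
    also have "\<dots> = (\<Sum>S\<in>Pow (E - {e}). s ^ (card (insert e S) - 1) * v (insert e S))"
      unfolding im sum.reindex[OF inj] by simp
    also have "\<dots> = (\<Sum>S\<in>Pow (E - {e}). s ^ card S * v (insert e S))"
    proof (rule sum.cong[OF refl])
      fix S assume "S \<in> Pow (E - {e})"
      then have "finite S" "e \<notin> S" using assms finite_subset by auto
      then show "s ^ (card (insert e S) - 1) * v (insert e S) = s ^ card S * v (insert e S)" by simp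
    qed
    finally show "(\<Sum>S\<in>Pow E. if e \<in> S then s ^ (card S - 1) * v S else 0)
      = (\<Sum>S\<in>Pow (E - {e}). s ^ card S * v (insert e S))" .
  qed
  finally show ?thesis .
qed

subsection \<open>Free energy\<close>

text \<open>A lattice gas partition function: activity \<open>s\<close> per edge of the random graph
  and a soft constraint \<open>1 - t\<close> per triangle.\<close>

definition partfun :: "'a set \<Rightarrow> 'a set set \<Rightarrow> real \<Rightarrow> real \<Rightarrow> real" where
  "partfun E TT t s = (\<Sum>S\<in>Pow E. s ^ card S * (1 - t) ^ card {T \<in> TT. T \<subseteq> S})"

context linear_hypergraph
begin

lemma pf_eq_partfun: "pf {} TT = partfun E TT t lam"
  by (simp add: pf_def wt_def partfun_def)

lemma linear_hypergraph_lam: "0 \<le> s \<Longrightarrow> s \<le> 1 \<Longrightarrow> linear_hypergraph E TT D s t"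
  by unfold_locales (use finE subE card3 linear regular t in auto)

lemma edge_not_in_small: "T \<in> TT \<Longrightarrow> \<not> T \<subseteq> {}"
  using card3 by fastforce

lemma pf_ge_1': "1 \<le> pf {} TT"
  using edge_not_in_small by (intro pf_ge_1) blast

lemma partfun_has_derivative:
  "(partfun E TT t has_real_derivative (\<Sum>e\<in>E. pf {e} TT)) (at lam within X)"
proof -
  have "pf {e} TT = (\<Sum>S\<in>Pow (E - {e}). lam ^ card S * (1 - t) ^ card {T \<in> TT. T \<subseteq> insert e S})" for e
    unfolding pf_def wt_def by (simp add: Diff_subset_conv)
  then show ?thesis
    using subset_sum_has_derivative[OF finE, of "\<lambda>S. (1 - t) ^ card {T \<in> TT. T \<subseteq> S}" lam X]
    unfolding partfun_def[abs_def] by simp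
qed

text \<open>\<open>pres\<close> is the probability of presence divided by \<open>lam\<close>, so the
  logarithmic derivative carries no factor \<open>1 / lam\<close> and makes sense at activity
  0.\<close>

lemma ln_partfun_has_derivative:
  "((\<lambda>s. ln (partfun E TT t s)) has_real_derivative (\<Sum>e\<in>E. pres {} TT e)) (at lam within X)"
proof -
  have "((\<lambda>s. ln (partfun E TT t s)) has_real_derivative
     (1 / partfun E TT t lam * (\<Sum>e\<in>E. pf {e} TT))) (at lam within X)"
    using pf_ge_1' pf_eq_partfun
    by (intro DERIV_chain2[OF DERIV_ln_divide] partfun_has_derivative) auto
  then show ?thesis by (simp add: pres_def pf_eq_partfun sum_divide_distrib)
qed

lemma sum_pres_bounds: "0 \<le> (\<Sum>e\<in>E. pres {} TT e)" "(\<Sum>e\<in>E. pres {} TT e) \<le> card E"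
proof -
  show "0 \<le> (\<Sum>e\<in>E. pres {} TT e)" by (intro sum_nonneg pres_nonneg)
  have "(\<Sum>e\<in>E. pres {} TT e) \<le> (\<Sum>e\<in>E. 1)" by (intro sum_mono pres_le_1) auto
  then show "(\<Sum>e\<in>E. pres {} TT e) \<le> card E" by simp
qed

text \<open>Needed later to exchange the odds of an edge for the slightly different activity
  \<open>c / sqrt (n - 2)\<close>.\<close>

lemma ln_partfun_lipschitz:
  fixes s s' :: real
  assumes "0 \<le> s" "s \<le> 1" "0 \<le> s'" "s' \<le> 1"
  shows "\<bar>ln (partfun E TT t s) - ln (partfun E TT t s')\<bar> \<le> card E * \<bar>s - s'\<bar>"
proof -
  have "norm (ln (partfun E TT t s) - ln (partfun E TT t s')) \<le> card E * norm (s - s')"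
  proof (rule field_differentiable_bound[of "{0..1}"])
    fix z :: real assume z: "z \<in> {0..1}"
    then interpret H: linear_hypergraph E TT D z t by (intro linear_hypergraph_lam) auto
    show "((\<lambda>s. ln (partfun E TT t s)) has_field_derivative (\<Sum>e\<in>E. H.pres {} TT e)) (at z within {0..1})"
      by (rule H.ln_partfun_has_derivative)
    show "norm (\<Sum>e\<in>E. H.pres {} TT e) \<le> card E" using H.sum_pres_bounds by auto
  qed (use assms in auto)
  then show ?thesis by simp
qed

end

context hypergraph_seq
begin

text \<open>Integrating the marginals requires their limit at every activity between 0 and the final
  one.\<close>

lemma restrict_c:
  assumes "0 \<le> s" "s \<le> c" shows "hypergraph_seq E TT D s t"
proof
  show "\<forall>\<^sub>F n in sequentially. linear_hypergraph (E n) (TT n) (D n) (s / sqrt (D n)) t"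
    using lin
  proof eventually_elim
    case (elim n)
    interpret H: linear_hypergraph "E n" "TT n" "D n" "lam n" t by (rule elim)
    have "s / sqrt (D n) \<le> lam n" using assms by (intro divide_right_mono) auto
    then show ?case using H.lam assms by (intro H.linear_hypergraph_lam) (auto intro: order_trans)
  qed
qed (use nonempty D_top assms t in auto)

text \<open>
  Substituting \<open>s = g * exp (t * g\<^sup>2)\<close> for the activity makes the limiting edge marginal the
  explicit function \<open>exp (- t * g\<^sup>2)\<close> of \<open>g\<close>.
\<close>

theorem free_energy:
  assumes small: "2 * c\<^sup>2 < exp 1" and \<gamma>: "0 \<le> \<gamma>" "\<gamma> * exp (t * \<gamma>\<^sup>2) = c"
  shows "(\<lambda>n. sqrt (D n) / card (E n) * ln (partfun (E n) (TT n) t (lam n))) \<longlonglongrightarrow> \<gamma> + 2 * t * \<gamma> ^ 3 / 3"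
proof -
  define s where "s g = g * exp (t * g\<^sup>2)" for g
  define s' where "s' g = (1 + 2 * t * g\<^sup>2) * exp (t * g\<^sup>2)" for g
  define lm where "lm n g = s g / sqrt (D n)" for n g
  define avg where "avg n g = (\<Sum>e\<in>E n. linear_hypergraph.pres (E n) (lm n g) t {} (TT n) e) / card (E n)" for n g
  define K where "K n g = sqrt (D n) / card (E n) * ln (partfun (E n) (TT n) t (lm n g))" for n g
  have s_der: "(s has_real_derivative s' g) (at g within X)" for g X
    unfolding s_def[abs_def] s'_def by (auto intro!: derivative_eq_intros simp: algebra_simps power2_eq_square)
  have s_range: "0 \<le> s g \<and> s g \<le> c" if "g \<in> {0..\<gamma>}" for g
  proof -
    have "s g \<le> s \<gamma>" unfolding s_def using that t by (intro mult_mono) (auto intro!: mult_left_mono power_mono)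
    then show ?thesis using that \<gamma> by (simp add: s_def)
  qed
  have lm_lin: "linear_hypergraph (E n) (TT n) (D n) (lm n g) t"
    if "linear_hypergraph (E n) (TT n) (D n) (lam n) t" "g \<in> {0..\<gamma>}" for n g
  proof -
    interpret H: linear_hypergraph "E n" "TT n" "D n" "lam n" t by (rule that)
    have "lm n g \<le> lam n" unfolding lm_def using s_range[OF that(2)] by (intro divide_right_mono) auto
    then show ?thesis using H.lam s_range[OF that(2)] unfolding lm_def
      by (intro H.linear_hypergraph_lam) (auto intro: order_trans)
  qed
  have Dpos: "\<forall>\<^sub>F n in sequentially. 1 \<le> D n" using D_top by (simp add: filterlim_at_top)
  have good: "\<forall>\<^sub>F n in sequentially. linear_hypergraph (E n) (TT n) (D n) (lam n) t \<and> 1 \<le> D n \<and> E n \<noteq> {}"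
    using lin Dpos nonempty by eventually_elim auto
  \<comment> \<open>The bounds hold only eventually, whereas dominated convergence asks for them at
    every index; hence the shift by \<open>N\<close> below.\<close>
  then obtain N where N: "\<And>n. n \<ge> N \<Longrightarrow> linear_hypergraph (E n) (TT n) (D n) (lam n) t \<and> 1 \<le> D n \<and> E n \<noteq> {}"
    unfolding eventually_sequentially by blast
  have K_der: "(K n has_real_derivative avg n g * s' g) (at g within {0..\<gamma>})" if "n \<ge> N" "g \<in> {0..\<gamma>}" for n g
  proof -
    interpret H: linear_hypergraph "E n" "TT n" "D n" "lm n g" t
      using lm_lin N that by blast
    have l: "((\<lambda>g. lm n g) has_real_derivative s' g / sqrt (D n)) (at g within {0..\<gamma>})"
      unfolding lm_def by (intro DERIV_cdivide s_der)
    have "((\<lambda>g. ln (partfun (E n) (TT n) t (lm n g))) has_real_derivative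
       (\<Sum>e\<in>E n. H.pres {} (TT n) e) * (s' g / sqrt (D n))) (at g within {0..\<gamma>})"
      by (rule DERIV_chain2[OF H.ln_partfun_has_derivative l])
    then have "(K n has_real_derivative sqrt (D n) / card (E n) *
       ((\<Sum>e\<in>E n. H.pres {} (TT n) e) * (s' g / sqrt (D n)))) (at g within {0..\<gamma>})"
      unfolding K_def by (rule DERIV_cmult)
    moreover have "sqrt (D n) / card (E n) * ((\<Sum>e\<in>E n. H.pres {} (TT n) e) * (s' g / sqrt (D n)))
        = avg n g * s' g"
      using N[OF that(1)] by (simp add: avg_def)
    ultimately show ?thesis by simp
  qed
  have avg_bounds: "0 \<le> avg n g \<and> avg n g \<le> 1" if "n \<ge> N" "g \<in> {0..\<gamma>}" for n g
  proof -
    interpret H: linear_hypergraph "E n" "TT n" "D n" "lm n g" t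
      using lm_lin N that by blast
    have "0 < card (E n)" using N[OF that(1)] H.finE by (simp add: card_gt_0_iff)
    then show ?thesis using H.sum_pres_bounds by (simp add: avg_def)
  qed
  have K0: "K n 0 = 0" if "n \<ge> N" for n
  proof -
    interpret H: linear_hypergraph "E n" "TT n" "D n" "lam n" t using N that by blast
    \<comment> \<open>At activity 0 only the empty configuration survives, with
      \<open>0 ^ 0 = 1\<close>.\<close>
    have "partfun (E n) (TT n) t 0 = (\<Sum>S\<in>{{}}. 0 ^ card S * (1 - t) ^ card {T \<in> TT n. T \<subseteq> S})"
      unfolding partfun_def
    proof (rule sum.mono_neutral_right)
      show "\<forall>S\<in>Pow (E n) - {{}}. 0 ^ card S * (1 - t) ^ card {T \<in> TT n. T \<subseteq> S} = 0"
      proof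
        fix S assume "S \<in> Pow (E n) - {{}}"
        then have "card S > 0" using H.finE by (metis Diff_iff PowD card_gt_0_iff finite_subset singletonI)
        then show "0 ^ card S * (1 - t) ^ card {T \<in> TT n. T \<subseteq> S} = 0" by simp
      qed
    qed (use H.finE in auto)
    also have "{T \<in> TT n. T \<subseteq> {}} = {}" using H.edge_not_in_small by blast
    then have "(\<Sum>S\<in>{{}}. 0 ^ card S * (1 - t) ^ card {T \<in> TT n. T \<subseteq> S}) = 1"
      by (simp only: sum.insert[OF finite.emptyI] empty_iff sum.empty card.empty power_0 not_False_eq_True)
    finally show ?thesis by (simp add: K_def lm_def s_def)
  qed
  define f where "f n g = avg (n + N) g * s' g" for n g
  define b where "b = (1 + 2 * t * \<gamma>\<^sup>2) * exp (t * \<gamma>\<^sup>2)"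
  have f_int: "(f n has_integral K (n + N) \<gamma>) {0..\<gamma>}" for n
    using fundamental_theorem_of_calculus[OF \<gamma>(1), of "K (n + N)" "f n"] K_der[of "n + N"] K0[of "n + N"]
    by (simp add: f_def has_real_derivative_iff_has_vector_derivative)
  have s'_bound: "0 \<le> s' g \<and> s' g \<le> b" if "g \<in> {0..\<gamma>}" for g
    unfolding s'_def b_def using that t by (auto intro!: mult_mono mult_left_mono power_mono add_mono)
  have f_lim: "(\<lambda>n. f n g) \<longlonglongrightarrow> 1 + 2 * t * g\<^sup>2" if g: "g \<in> {0..\<gamma>}" for g
  proof -
    interpret G: hypergraph_seq E TT D "s g" t using s_range[OF g] by (intro restrict_c) auto
    define x where "x = exp (- (t * g\<^sup>2))"
    have sx: "s g * x = g" by (simp add: s_def x_def flip: exp_add)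
    have xe: "x = exp (- (t * (s g)\<^sup>2) * x\<^sup>2)"
    proof -
      have "- (t * (s g)\<^sup>2) * x\<^sup>2 = - (t * (s g * x)\<^sup>2)" by (simp add: power_mult_distrib)
      then show ?thesis unfolding sx by (simp only: x_def)
    qed
    have "(s g)\<^sup>2 \<le> c\<^sup>2" using s_range[OF g] by (intro power_mono) auto
    then have sm: "2 * (s g)\<^sup>2 < exp 1" using small by linarith
    have "(\<lambda>n. avg n g) \<longlonglongrightarrow> x"
    proof (rule LIMSEQ_I)
      fix r :: real assume r: "r > 0"
      have "\<forall>\<^sub>F n in sequentially. \<forall>e\<in>E n. \<bar>linear_hypergraph.pres (E n) (lm n g) t {} (TT n) e - x\<bar> \<le> r / 2"
        using G.pres_tendsto[OF sm _ xe, of "r / 2"] r by (simp add: x_def lm_def)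
      with good have "\<forall>\<^sub>F n in sequentially. norm (avg n g - x) < r"
      proof eventually_elim
        case (elim n)
        interpret H: linear_hypergraph "E n" "TT n" "D n" "lam n" t using elim by blast
        have cp: "0 < card (E n)" using elim H.finE by (simp add: card_gt_0_iff)
        have "avg n g - x = (\<Sum>e\<in>E n. linear_hypergraph.pres (E n) (lm n g) t {} (TT n) e - x) / card (E n)"
          using cp by (simp add: avg_def sum_subtractf diff_divide_distrib)
        also have "\<bar>\<dots>\<bar> \<le> (\<Sum>e\<in>E n. r / 2) / card (E n)"
          unfolding abs_divide using elim
          by (intro divide_mono order_trans[OF sum_abs] sum_mono) (auto simp: cp)
        also have "\<dots> = r / 2" using cp by simp
        finally show ?case using r by simp
      qed
      then show "\<exists>no. \<forall>n\<ge>no. norm (avg n g - x) < r" by (simp add: eventually_sequentially)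
    qed
    then have "(\<lambda>n. avg (n + N) g * s' g) \<longlonglongrightarrow> x * s' g"
      by (intro tendsto_mult_right LIMSEQ_ignore_initial_segment)
    moreover have "x * s' g = 1 + 2 * t * g\<^sup>2"
      by (simp add: x_def s'_def mult_ac flip: exp_add)
    ultimately show ?thesis by (simp add: f_def)
  qed
  have "(\<lambda>n. integral {0..\<gamma>} (f n)) \<longlonglongrightarrow> integral {0..\<gamma>} (\<lambda>g. 1 + 2 * t * g\<^sup>2)"
  proof (rule dominated_convergence(2))
    show "f n integrable_on {0..\<gamma>}" for n using f_int by blast
    show "(\<lambda>g. b) integrable_on {0..\<gamma>}" by (rule integrable_const_ivl)
    show "norm (f n g) \<le> b" if "g \<in> {0..\<gamma>}" for n g
    proof -
      have "norm (f n g) \<le> 1 * b" unfolding f_def norm_mult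
        using avg_bounds[of "n + N" g] s'_bound that by (intro mult_mono) auto
      then show ?thesis by simp
    qed
  qed (rule f_lim)
  moreover have "integral {0..\<gamma>} (f n) = K (n + N) \<gamma>" for n using f_int by (rule integral_unique)
  moreover have "integral {0..\<gamma>} (\<lambda>g. 1 + 2 * t * g\<^sup>2) = \<gamma> + 2 * t * \<gamma> ^ 3 / 3"
  proof (rule integral_unique)
    have "((\<lambda>g. 1 + 2 * t * g\<^sup>2) has_integral (\<gamma> + 2 * t * \<gamma> ^ 3 / 3) - (0 + 2 * t * 0 ^ 3 / 3)) {0..\<gamma>}"
      by (rule fundamental_theorem_of_calculus[OF \<gamma>(1)])
        (auto intro!: derivative_eq_intros simp flip: has_real_derivative_iff_has_vector_derivative simp: power2_eq_square)
    then show "((\<lambda>g. 1 + 2 * t * g\<^sup>2) has_integral \<gamma> + 2 * t * \<gamma> ^ 3 / 3) {0..\<gamma>}" by simp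
  qed
  ultimately have "(\<lambda>n. K (n + N) \<gamma>) \<longlonglongrightarrow> \<gamma> + 2 * t * \<gamma> ^ 3 / 3" by simp
  then have "(\<lambda>n. K n \<gamma>) \<longlonglongrightarrow> \<gamma> + 2 * t * \<gamma> ^ 3 / 3" by (rule LIMSEQ_offset)
  then show ?thesis by (simp add: K_def lm_def s_def \<gamma>(2))
qed

end

subsection \<open>Triangles in the random graph\<close>

lemma finite_complete_edges: "finite (complete_edges n)"
  unfolding complete_edges_def by (rule finite_subset[of _ "Pow {..<n}"]) auto

lemma card_complete_edges: "card (complete_edges n) = n choose 2"
  unfolding complete_edges_def using n_subsets[of "{..<n}" 2] by simp

lemma real_card_complete_edges: "real (card (complete_edges n)) = real n * (real n - 1) / 2"
proof -
  have "even (n * (n - 1))" by auto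
  then have "real (n * (n - 1) div 2) = real (n * (n - 1)) / 2" by (simp add: real_of_nat_div)
  then show ?thesis unfolding card_complete_edges choose_two by (cases n) (auto simp: algebra_simps)
qed

definition tri_edges :: "nat set \<Rightarrow> nat set set" where
  "tri_edges T = {e. e \<subseteq> T \<and> card e = 2}"

definition vtriples :: "nat \<Rightarrow> nat set set" where
  "vtriples n = {T. T \<subseteq> {..<n} \<and> card T = 3}"

text \<open>Triangles as sets of edges, so that they are hyperedges over
  \<open>complete_edges\<close>; by \<open>inj_on_tri_edges\<close> counting them is counting vertex
  triples.\<close>

definition triangles :: "nat \<Rightarrow> nat set set set" where
  "triangles n = tri_edges ` vtriples n"

lemma finite_vtriples: "finite (vtriples n)"
  unfolding vtriples_def by (rule finite_subset[of _ "Pow {..<n}"]) auto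

lemma Union_tri_edges:
  assumes "card T = 3" shows "\<Union> (tri_edges T) = T"
proof -
  obtain a b c where T: "T = {a, b, c}" "a \<noteq> b" "b \<noteq> c" "a \<noteq> c"
    using assms unfolding card_3_iff by auto
  have "{a, b} \<in> tri_edges T" "{b, c} \<in> tri_edges T" using T by (auto simp: tri_edges_def)
  then have "{a, b} \<union> {b, c} \<subseteq> \<Union> (tri_edges T)" by blast
  moreover have "\<Union> (tri_edges T) \<subseteq> T" by (auto simp: tri_edges_def)
  ultimately show ?thesis unfolding T by blast
qed

lemma inj_on_tri_edges: "inj_on tri_edges (vtriples n)"
  by (rule inj_on_inverseI[of _ Union]) (auto simp: vtriples_def Union_tri_edges)

lemma card_tri_edges:
  assumes "card T = 3" shows "card (tri_edges T) = 3"
proof -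
  have "finite T" using assms by (simp add: card_ge_0_finite)
  then have "card (tri_edges T) = 3 choose 2" unfolding tri_edges_def using n_subsets[of T 2] assms by simp
  then show ?thesis by (simp add: choose_two)
qed

lemma triangle_count_eq: "triangle_count n G = card {T \<in> triangles n. T \<subseteq> G}"
proof -
  have "{T \<in> triangles n. T \<subseteq> G} = tri_edges ` {T \<in> vtriples n. tri_edges T \<subseteq> G}"
    by (auto simp: triangles_def)
  then have "card {T \<in> triangles n. T \<subseteq> G} = card {T \<in> vtriples n. tri_edges T \<subseteq> G}"
    by (metis (no_types, lifting) card_image inj_on_subset inj_on_tri_edges mem_Collect_eq subsetI)
  moreover have "{T \<in> vtriples n. tri_edges T \<subseteq> G}
      = {T. T \<subseteq> {..<n} \<and> card T = 3 \<and> (\<forall>e. e \<subseteq> T \<and> card e = 2 \<longrightarrow> e \<in> G)}"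
    by (auto simp: vtriples_def tri_edges_def)
  ultimately show ?thesis by (simp add: triangle_count_def)
qed

lemma triple_eq_Un_edges:
  assumes "card T = 3" "e \<in> tri_edges T" "f \<in> tri_edges T" "e \<noteq> f"
  shows "T = e \<union> f"
proof -
  have fT: "finite T" using assms(1) by (simp add: card_ge_0_finite)
  have sub: "e \<union> f \<subseteq> T" and c: "card e = 2" "card f = 2" using assms by (auto simp: tri_edges_def)
  have fe: "finite e" "finite f" using c by (auto intro: card_ge_0_finite)
  have "\<not> f \<subseteq> e" using card_subset_eq[OF fe(1), of f] c assms(4) by auto
  then have "e \<subset> e \<union> f" by auto
  then have "card e < card (e \<union> f)" using fe by (intro psubset_card_mono) auto
  then have "card T \<le> card (e \<union> f)" using c assms(1) by simp
  then show ?thesis using card_seteq[OF fT sub] by simp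
qed

text \<open>Two distinct edges of a triangle already cover its three vertices, which gives
  linearity. The \<open>n - 2\<close> vertices off an edge are its possible apexes, which gives
  regularity.\<close>

lemma linear_hypergraph_triangles:
  assumes "0 \<le> s" "s \<le> 1" "0 \<le> t" "t \<le> 1"
  shows "linear_hypergraph (complete_edges n) (triangles n) (n - 2) s t"
proof
  show "finite (complete_edges n)" by (rule finite_complete_edges)
  show "0 \<le> s" "s \<le> 1" "0 \<le> t" "t \<le> 1" by fact+
  show "T \<subseteq> complete_edges n" if "T \<in> triangles n" for T
    using that by (auto simp: triangles_def tri_edges_def vtriples_def complete_edges_def)
  show "card T = 3" if "T \<in> triangles n" for T
    using that card_tri_edges by (auto simp: triangles_def vtriples_def)
  show "T = T'" if "T \<in> triangles n" "T' \<in> triangles n" "e \<noteq> f" "{e, f} \<subseteq> T" "{e, f} \<subseteq> T'" for T T' e f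
  proof -
    note TT' = \<open>T \<in> triangles n\<close> \<open>T' \<in> triangles n\<close>
    obtain V V' where V: "T = tri_edges V" "T' = tri_edges V'" "card V = 3" "card V' = 3"
      using TT' by (auto simp: triangles_def vtriples_def)
    have "V = e \<union> f" "V' = e \<union> f" using triple_eq_Un_edges[of V e f] triple_eq_Un_edges[of V' e f] that V by auto
    then show ?thesis using V by simp
  qed
  show "card {T \<in> triangles n. e \<in> T} = n - 2" if "e \<in> complete_edges n" for e
  proof -
    have e: "e \<subseteq> {..<n}" "card e = 2" "finite e" using that by (auto simp: complete_edges_def intro: card_ge_0_finite)
    define F where "F w = tri_edges (insert w e)" for w
    have ce: "card (insert w e) = 3" if "w \<in> {..<n} - e" for w using that e by simp
    have "{T \<in> triangles n. e \<in> T} = F ` ({..<n} - e)"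
    proof (intro equalityI subsetI)
      fix T assume "T \<in> {T \<in> triangles n. e \<in> T}"
      then obtain V where V: "T = tri_edges V" "V \<subseteq> {..<n}" "card V = 3" "e \<subseteq> V"
        by (auto simp: triangles_def vtriples_def tri_edges_def)
      then have "card (V - e) = 1" using e by (simp add: card_Diff_subset)
      then obtain w where w: "V - e = {w}" by (auto simp: card_1_singleton_iff)
      then have "V = insert w e" "w \<in> {..<n} - e" using V by auto
      then show "T \<in> F ` ({..<n} - e)" using V by (auto simp: F_def)
    next
      fix T assume "T \<in> F ` ({..<n} - e)"
      then obtain w where w: "w \<in> {..<n} - e" "T = F w" by auto
      then show "T \<in> {T \<in> triangles n. e \<in> T}"
        using ce[OF w(1)] e by (auto simp: triangles_def vtriples_def F_def tri_edges_def)
    qed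
    moreover have "inj_on F ({..<n} - e)"
    proof
      fix w w' assume w: "w \<in> {..<n} - e" "w' \<in> {..<n} - e" "F w = F w'"
      then have "insert w e = insert w' e" using Union_tri_edges ce unfolding F_def by metis
      then show "w = w'" using w by auto
    qed
    ultimately have "card {T \<in> triangles n. e \<in> T} = card ({..<n} - e)" by (simp add: card_image)
    then show ?thesis using e by (simp add: card_Diff_subset)
  qed
qed

text \<open>The edge probabilities may differ, as the two-block comparison measure requires.\<close>

definition gprob :: "'a set \<Rightarrow> ('a \<Rightarrow> real) \<Rightarrow> 'a set \<Rightarrow> real" where
  "gprob E \<pi> G = (\<Prod>e\<in>G. \<pi> e) * (\<Prod>e\<in>E - G. 1 - \<pi> e)"

lemma gprob_nonneg:
  assumes "G \<subseteq> E" "\<And>e. e \<in> E \<Longrightarrow> 0 \<le> \<pi> e \<and> \<pi> e \<le> 1" shows "0 \<le> gprob E \<pi> G"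
  unfolding gprob_def using assms by (intro mult_nonneg_nonneg prod_nonneg) auto

lemma gprob_const: "finite E \<Longrightarrow> gprob E (\<lambda>_. p) G = p ^ card G * (1 - p) ^ card (E - G)"
  by (simp add: gprob_def)

text \<open>Expanding the right-hand product decides for each edge between present and absent, which
  enumerates the subsets \<open>G\<close>.\<close>

lemma sum_gprob_prod:
  assumes "finite E"
  shows "(\<Sum>G\<in>Pow E. gprob E \<pi> G * ((\<Prod>e\<in>G. f e) * (\<Prod>e\<in>E - G. g e))) = (\<Prod>e\<in>E. \<pi> e * f e + (1 - \<pi> e) * g e)"
  unfolding prod_add[OF assms] gprob_def
  by (intro sum.cong refl) (simp add: prod.distrib mult_ac)

lemma sum_gprob: "finite E \<Longrightarrow> (\<Sum>G\<in>Pow E. gprob E \<pi> G) = 1"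
  using sum_gprob_prod[of E \<pi> "\<lambda>_. 1" "\<lambda>_. 1"] by simp

lemma sum_gprob_superset:
  assumes "finite E" "T \<subseteq> E"
  shows "(\<Sum>G\<in>Pow E. gprob E \<pi> G * (if T \<subseteq> G then 1 else 0)) = (\<Prod>e\<in>T. \<pi> e)"
proof -
  \<comment> \<open>The indicator of \<open>T \<subseteq> G\<close> is a product over the absent
    edges, which vanishes as soon as one of them lies in \<open>T\<close>.\<close>
  have "(\<Sum>G\<in>Pow E. gprob E \<pi> G * (if T \<subseteq> G then 1 else 0))
      = (\<Sum>G\<in>Pow E. gprob E \<pi> G * ((\<Prod>e\<in>G. 1) * (\<Prod>e\<in>E - G. if e \<in> T then 0 else 1)))"
  proof (rule sum.cong[OF refl])
    fix G assume G: "G \<in> Pow E"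
    have "(\<Prod>e\<in>E - G. if e \<in> T then 0 else 1) = (if T \<subseteq> G then 1 else (0 :: real))"
    proof (cases "T \<subseteq> G")
      case True then show ?thesis by (auto intro!: prod.neutral)
    next
      case False
      then obtain e where "e \<in> T" "e \<notin> G" by auto
      then show ?thesis using assms False by (auto intro!: prod_zero)
    qed
    then show "gprob E \<pi> G * (if T \<subseteq> G then 1 else 0)
      = gprob E \<pi> G * ((\<Prod>e\<in>G. 1) * (\<Prod>e\<in>E - G. if e \<in> T then 0 else 1))" by simp
  qed
  also have "\<dots> = (\<Prod>e\<in>E. if e \<in> T then \<pi> e else 1)"
    unfolding sum_gprob_prod[OF assms(1)] by (intro prod.cong) auto
  also have "\<dots> = (\<Prod>e\<in>T. \<pi> e)"
    using assms by (intro prod.mono_neutral_cong_right) auto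
  finally show ?thesis .
qed

lemma sum_gprob_triangle_count:
  "(\<Sum>G\<in>Pow (complete_edges n). gprob (complete_edges n) \<pi> G * real (triangle_count n G))
     = (\<Sum>T\<in>vtriples n. \<Prod>e\<in>tri_edges T. \<pi> e)"
proof -
  let ?E = "complete_edges n"
  have fin: "finite (triangles n)" unfolding triangles_def using finite_vtriples by simp
  have tc: "real (triangle_count n G) = (\<Sum>T\<in>triangles n. if T \<subseteq> G then 1 else 0)" for G
    unfolding triangle_count_eq using fin by (simp add: sum.If_cases Int_def)
  have sub: "T \<subseteq> ?E" if "T \<in> triangles n" for T
    using that by (auto simp: triangles_def tri_edges_def vtriples_def complete_edges_def)
  have "(\<Sum>G\<in>Pow ?E. gprob ?E \<pi> G * real (triangle_count n G))
     = (\<Sum>T\<in>triangles n. \<Sum>G\<in>Pow ?E. gprob ?E \<pi> G * (if T \<subseteq> G then 1 else 0))"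
    unfolding tc sum_distrib_left by (rule sum.swap)
  also have "\<dots> = (\<Sum>T\<in>triangles n. \<Prod>e\<in>T. \<pi> e)"
    by (intro sum.cong refl sum_gprob_superset finite_complete_edges sub)
  also have "\<dots> = (\<Sum>T\<in>vtriples n. \<Prod>e\<in>tri_edges T. \<pi> e)"
    unfolding triangles_def by (simp add: sum.reindex[OF inj_on_tri_edges])
  finally show ?thesis .
qed

lemma pmf_gnp:
  assumes "0 \<le> p" "p \<le> 1"
  shows "pmf (gnp n p) G = (if G \<subseteq> complete_edges n then gprob (complete_edges n) (\<lambda>_. p) G else 0)"
proof -
  let ?E = "complete_edges n"
  let ?M = "Pi_pmf ?E False (\<lambda>_. bernoulli_pmf p)"
  let ?f = "\<lambda>\<omega>. {e \<in> ?E. \<omega> e}"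
  have sup: "set_pmf ?M \<subseteq> {f. \<forall>x. x \<notin> ?E \<longrightarrow> f x = False}"
    by (rule set_Pi_pmf_subset[OF finite_complete_edges])
  have "pmf (gnp n p) G = measure ?M (?f -` {G} \<inter> set_pmf ?M)"
    unfolding gnp_def pmf_map measure_Int_set_pmf ..
  also have "\<dots> = (if G \<subseteq> ?E then gprob ?E (\<lambda>_. p) G else 0)"
  proof (cases "G \<subseteq> ?E")
    case False
    then have "?f -` {G} = {}" by auto
    then show ?thesis using False by simp
  next
    case True
    have "?f -` {G} \<inter> set_pmf ?M = {\<lambda>e. e \<in> G} \<inter> set_pmf ?M"
      using sup True by (auto simp: fun_eq_iff)
    then have "measure ?M (?f -` {G} \<inter> set_pmf ?M) = pmf ?M (\<lambda>e. e \<in> G)"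
      by (simp add: measure_Int_set_pmf measure_pmf_single)
    also have "\<dots> = (\<Prod>e\<in>?E. pmf (bernoulli_pmf p) (e \<in> G))"
      using True by (intro pmf_Pi' finite_complete_edges) auto
    also have "\<dots> = (\<Prod>e\<in>?E. if e \<in> G then p else 1 - p)"
      using assms by (intro prod.cong) auto
    also have "\<dots> = gprob ?E (\<lambda>_. p) G"
      using True finite_complete_edges
      by (simp add: gprob_def prod.If_cases Int_absorb1 Diff_eq)
    finally show ?thesis using True by simp
  qed
  finally show ?thesis .
qed

lemma set_pmf_gnp:
  assumes "0 \<le> p" "p \<le> 1" shows "set_pmf (gnp n p) \<subseteq> Pow (complete_edges n)"
  using pmf_gnp[OF assms] by (auto simp: set_pmf_eq split: if_splits)

lemma expectation_gnp:
  fixes f :: "nat set set \<Rightarrow> real"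
  assumes "0 \<le> p" "p \<le> 1"
  shows "measure_pmf.expectation (gnp n p) f = (\<Sum>G\<in>Pow (complete_edges n). gprob (complete_edges n) (\<lambda>_. p) G * f G)"
proof -
  have "measure_pmf.expectation (gnp n p) f = (\<Sum>G\<in>Pow (complete_edges n). f G * pmf (gnp n p) G)"
    using set_pmf_gnp[OF assms] finite_complete_edges by (intro integral_measure_pmf_real) auto
  then show ?thesis using pmf_gnp[OF assms] by (simp add: mult.commute)
qed

lemma prob_gnp:
  assumes "0 \<le> p" "p \<le> 1"
  shows "measure_pmf.prob (gnp n p) A = (\<Sum>G\<in>Pow (complete_edges n) \<inter> A. gprob (complete_edges n) (\<lambda>_. p) G)"
proof -
  have "measure_pmf.prob (gnp n p) A = measure_pmf.prob (gnp n p) (A \<inter> set_pmf (gnp n p))"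
    by (simp add: measure_Int_set_pmf)
  also have "\<dots> = measure_pmf.prob (gnp n p) ((Pow (complete_edges n) \<inter> A) \<inter> set_pmf (gnp n p))"
    using set_pmf_gnp[OF assms] by (intro arg_cong[of _ _ "measure_pmf.prob (gnp n p)"]) auto
  also have "\<dots> = sum (pmf (gnp n p)) (Pow (complete_edges n) \<inter> A)"
    unfolding measure_Int_set_pmf using finite_complete_edges by (intro measure_measure_pmf_finite) auto
  also have "\<dots> = (\<Sum>G\<in>Pow (complete_edges n) \<inter> A. gprob (complete_edges n) (\<lambda>_. p) G)"
    using pmf_gnp[OF assms] by (intro sum.cong) auto
  finally show ?thesis .
qed

lemma card_vtriples: "card (vtriples n) = n choose 3"
  unfolding vtriples_def using n_subsets[of "{..<n}" 3] by simp

lemma expectation_triangle_count: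
  assumes "0 \<le> p" "p \<le> 1"
  shows "measure_pmf.expectation (gnp n p) (\<lambda>G. real (triangle_count n G)) = real (n choose 3) * p ^ 3"
  unfolding expectation_gnp[OF assms] sum_gprob_triangle_count
  by (simp add: card_vtriples card_tri_edges vtriples_def flip: card_vtriples)

text \<open>The exponential moment at parameter \<open>ln (1 - t)\<close>; logarithms are taken
  where it is used. At \<open>t = 1\<close> it is the probability of having no triangle, since
  \<open>0 ^ 0 = 1\<close>.\<close>

definition lmgf :: "real \<Rightarrow> real \<Rightarrow> nat \<Rightarrow> real" where
  "lmgf c t n = measure_pmf.expectation (gnp n (c / sqrt n)) (\<lambda>G. (1 - t) ^ triangle_count n G)"

text \<open>Pulling a factor \<open>1 - p\<close> out of every edge, present or absent, leaves the
  odds as activity.\<close>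

lemma expectation_power_triangle_count:
  assumes "0 \<le> p" "p < 1"
  shows "measure_pmf.expectation (gnp n p) (\<lambda>G. (1 - t) ^ triangle_count n G)
    = (1 - p) ^ card (complete_edges n) * partfun (complete_edges n) (triangles n) t (p / (1 - p))"
proof -
  let ?E = "complete_edges n"
  have "gprob ?E (\<lambda>_. p) G = (1 - p) ^ card ?E * (p / (1 - p)) ^ card G" if "G \<in> Pow ?E" for G
  proof -
    have "finite G" "card G \<le> card ?E" using that finite_complete_edges[of n]
      by (auto intro: finite_subset card_mono)
    then have "card (?E - G) = card ?E - card G" using that by (intro card_Diff_subset) auto
    moreover have "(1 - p) ^ card ?E = (1 - p) ^ card G * (1 - p) ^ (card ?E - card G)"
      using \<open>card G \<le> card ?E\<close> by (simp flip: power_add)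
    ultimately show ?thesis using assms
      by (simp add: gprob_const[OF finite_complete_edges] power_divide)
  qed
  then show ?thesis
    using assms by (simp add: expectation_gnp partfun_def triangle_count_eq sum_distrib_left mult_ac)
qed

text \<open>This is \<open>free_energy\<close> at \<open>\<gamma> = c * x\<close>, times the limit
  1/2 of the number of edges over \<open>sqrt (D n) * n powr (3/2)\<close>. The term
  \<open>- c / 2\<close> comes from the factor \<open>1 - p\<close> of every edge.\<close>

theorem lmgf_limit:
  assumes c: "0 < c" "2 * c\<^sup>2 < exp 1" and t: "0 \<le> t" "t \<le> 1" and x: "0 \<le> x" "x = exp (- (t * c\<^sup>2 * x\<^sup>2))"
  shows "(\<lambda>n. ln (lmgf c t n) / real n powr (3/2)) \<longlonglongrightarrow> c * x / 2 + t * c ^ 3 * x ^ 3 / 3 - c / 2"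
proof -
  define E where "E = complete_edges"
  define D where "D n = n - 2" for n :: nat
  define Z where "Z n = partfun (E n) (triangles n) t" for n
  have Dinf: "filterlim D at_top sequentially" unfolding D_def by (rule filterlim_minus_const_nat_at_top)
  have ev1: "\<forall>\<^sub>F n in sequentially. 0 \<le> c / sqrt (D n) \<and> c / sqrt (D n) \<le> 1"
  proof -
    have "(\<lambda>n::nat. c / sqrt n) \<longlonglongrightarrow> 0" using c by real_asymp
    then have "(\<lambda>n. c / sqrt (D n)) \<longlonglongrightarrow> 0" by (rule filterlim_compose[OF _ Dinf])
    then have "\<forall>\<^sub>F n in sequentially. c / sqrt (D n) < 1" by (intro order_tendstoD(2)) auto
    then show ?thesis by eventually_elim (use c in auto)
  qed
  interpret G: hypergraph_seq E triangles D c t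
  proof
    show "\<forall>\<^sub>F n in sequentially. linear_hypergraph (E n) (triangles n) (D n) (c / sqrt (D n)) t"
      using ev1 by eventually_elim (use t in \<open>auto simp: E_def D_def intro!: linear_hypergraph_triangles\<close>)
    show "\<forall>\<^sub>F n in sequentially. E n \<noteq> {}"
      using eventually_ge_at_top[of 2]
    proof eventually_elim
      case (elim n)
      then have "{0, 1} \<in> E n" by (simp add: E_def complete_edges_def)
      then show ?case by auto
    qed
  qed (use c t Dinf in auto)
  \<comment> \<open>\<open>L n\<close> is the activity at which the marginals were studied,
    \<open>M n\<close> the true odds. They differ by order \<open>1 / n\<close>, which the Lipschitz
    bound turns into an error of order \<open>n\<close> against \<open>n powr (3/2)\<close>.\<close>
  define L where "L n = c / sqrt (D n)" for n
  define M where "M n = (c / sqrt n) / (1 - c / sqrt n)" for n :: nat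
  have cardE: "real (card (E n)) = real n * (real n - 1) / 2" for n by (simp add: E_def real_card_complete_edges)
  have "(c * x) * exp (t * (c * x)\<^sup>2) = c * (x * exp (t * c\<^sup>2 * x\<^sup>2))" by (simp add: power_mult_distrib mult_ac)
  also have "x * exp (t * c\<^sup>2 * x\<^sup>2) = 1" by (subst x(2)) (simp flip: exp_add)
  finally have fe: "(\<lambda>n. sqrt (D n) / card (E n) * ln (Z n (L n))) \<longlonglongrightarrow> c * x + 2 * t * (c * x) ^ 3 / 3"
    using G.free_energy[of "c * x"] c x by (simp add: Z_def L_def)
  have "(\<lambda>n. (real n * (real n - 1) / 2) / (sqrt (real n - 2) * real n powr (3/2))) \<longlonglongrightarrow> 1 / 2" by real_asymp
  moreover have "\<forall>\<^sub>F n in sequentially. (real n * (real n - 1) / 2) / (sqrt (real n - 2) * real n powr (3/2))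
      = card (E n) / (sqrt (D n) * real n powr (3/2))"
    using eventually_ge_at_top[of 2] by eventually_elim (simp add: cardE D_def of_nat_diff)
  ultimately have f2: "(\<lambda>n. card (E n) / (sqrt (D n) * real n powr (3/2))) \<longlonglongrightarrow> 1 / 2"
    by (rule Lim_transform_eventually)
  have "(\<lambda>n. (sqrt (D n) / card (E n) * ln (Z n (L n))) * (card (E n) / (sqrt (D n) * real n powr (3/2))))
      \<longlonglongrightarrow> (c * x + 2 * t * (c * x) ^ 3 / 3) * (1 / 2)"
    by (rule tendsto_mult[OF fe f2])
  moreover have "\<forall>\<^sub>F n in sequentially. (sqrt (D n) / card (E n) * ln (Z n (L n))) * (card (E n) / (sqrt (D n) * real n powr (3/2)))
      = ln (Z n (L n)) / real n powr (3/2)"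
    using eventually_ge_at_top[of 3] by eventually_elim (auto simp: D_def cardE)
  ultimately have lim1: "(\<lambda>n. ln (Z n (L n)) / real n powr (3/2)) \<longlonglongrightarrow> (c * x + 2 * t * (c * x) ^ 3 / 3) * (1 / 2)"
    by (rule Lim_transform_eventually)
  have ev2: "\<forall>\<^sub>F n in sequentially. c / sqrt n < 1" using c by real_asymp
  have ev3: "\<forall>\<^sub>F n in sequentially. M n \<le> 1" unfolding M_def using c by real_asymp
  have lim2: "(\<lambda>n. ln (Z n (M n)) / real n powr (3/2) - ln (Z n (L n)) / real n powr (3/2)) \<longlonglongrightarrow> 0"
  proof (rule Lim_null_comparison)
    show "\<forall>\<^sub>F n in sequentially. norm (ln (Z n (M n)) / real n powr (3/2) - ln (Z n (L n)) / real n powr (3/2))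
       \<le> real n * (real n - 1) / 2 * \<bar>(c / sqrt n) / (1 - c / sqrt n) - c / sqrt (real n - 2)\<bar> / real n powr (3/2)"
      using ev1 ev2 ev3 eventually_ge_at_top[of 2]
    proof eventually_elim
      case (elim n)
      interpret H: linear_hypergraph "E n" "triangles n" "D n" "L n" t
        unfolding E_def D_def L_def using elim t by (intro linear_hypergraph_triangles) (auto simp: D_def)
      have "0 \<le> M n" using elim c by (auto simp: M_def)
      then have "\<bar>ln (Z n (M n)) - ln (Z n (L n))\<bar> \<le> card (E n) * \<bar>M n - L n\<bar>"
        unfolding Z_def using elim H.lam by (intro H.ln_partfun_lipschitz) auto
      moreover have "L n = c / sqrt (real n - 2)" using elim by (simp add: L_def D_def of_nat_diff)
      ultimately have "\<bar>ln (Z n (M n)) - ln (Z n (L n))\<bar> / real n powr (3/2)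
         \<le> real n * (real n - 1) / 2 * \<bar>(c / sqrt n) / (1 - c / sqrt n) - c / sqrt (real n - 2)\<bar> / real n powr (3/2)"
        unfolding cardE M_def by (intro divide_right_mono) auto
      moreover have "norm (a / real n powr (3/2) - b / real n powr (3/2)) = \<bar>a - b\<bar> / real n powr (3/2)" for a b :: real
        by (simp flip: diff_divide_distrib)
      ultimately show ?case by (simp only:)
    qed
    show "(\<lambda>n. real n * (real n - 1) / 2 * \<bar>(c / sqrt n) / (1 - c / sqrt n) - c / sqrt (real n - 2)\<bar> / real n powr (3/2)) \<longlonglongrightarrow> 0"
      using c by real_asymp
  qed
  have lim3: "(\<lambda>n. real n * (real n - 1) / 2 * ln (1 - c / sqrt n) / real n powr (3/2)) \<longlonglongrightarrow> - c / 2"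
    using c by real_asymp
  have "(\<lambda>n. real n * (real n - 1) / 2 * ln (1 - c / sqrt n) / real n powr (3/2)
      + (ln (Z n (L n)) / real n powr (3/2) + (ln (Z n (M n)) / real n powr (3/2) - ln (Z n (L n)) / real n powr (3/2))))
      \<longlonglongrightarrow> - c / 2 + ((c * x + 2 * t * (c * x) ^ 3 / 3) * (1 / 2) + 0)"
    by (intro tendsto_add lim1 lim2 lim3)
  moreover have "\<forall>\<^sub>F n in sequentially. real n * (real n - 1) / 2 * ln (1 - c / sqrt n) / real n powr (3/2)
      + (ln (Z n (L n)) / real n powr (3/2) + (ln (Z n (M n)) / real n powr (3/2) - ln (Z n (L n)) / real n powr (3/2)))
      = ln (lmgf c t n) / real n powr (3/2)"
    using ev2 ev3
  proof eventually_elim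
    case (elim n)
    have "0 \<le> M n" using elim c by (auto simp: M_def)
    then interpret H: linear_hypergraph "E n" "triangles n" "D n" "M n" t
      unfolding E_def D_def using elim t by (intro linear_hypergraph_triangles) auto
    have "Z n (M n) \<ge> 1" using H.pf_ge_1' H.pf_eq_partfun by (simp add: Z_def)
    moreover have "lmgf c t n = (1 - c / sqrt n) ^ card (E n) * Z n (M n)"
      unfolding lmgf_def E_def Z_def M_def using c elim by (intro expectation_power_triangle_count) auto
    moreover have "0 < 1 - c / sqrt n" using elim by simp
    ultimately have "ln (lmgf c t n) = ln ((1 - c / sqrt n) ^ card (E n)) + ln (Z n (M n))"
      by (simp only: ln_mult_pos zero_less_power)
    also have "ln ((1 - c / sqrt n) ^ card (E n)) = real n * (real n - 1) / 2 * ln (1 - c / sqrt n)"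
      using \<open>0 < 1 - c / sqrt n\<close> by (simp only: ln_realpow cardE)
    finally have "ln (lmgf c t n) = real n * (real n - 1) / 2 * ln (1 - c / sqrt n) + ln (Z n (M n))" .
    then show ?case by (simp add: add_divide_distrib)
  qed
  ultimately have "(\<lambda>n. ln (lmgf c t n) / real n powr (3/2)) \<longlonglongrightarrow> - c / 2 + ((c * x + 2 * t * (c * x) ^ 3 / 3) * (1 / 2) + 0)"
    by (rule Lim_transform_eventually)
  then show ?thesis by (simp add: algebra_simps power_mult_distrib add_divide_distrib)
qed

subsection \<open>The rate function for small \<open>c\<close>\<close>

lemma lmgf_eq_sum:
  assumes "0 \<le> c" "c / sqrt n \<le> 1"
  shows "lmgf c t n = (\<Sum>G\<in>Pow (complete_edges n). gprob (complete_edges n) (\<lambda>_. c / sqrt n) G * (1 - t) ^ triangle_count n G)"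
  unfolding lmgf_def using assms by (intro expectation_gnp) auto

lemma lower_tail_prob_eq:
  assumes "0 \<le> p" "p \<le> 1"
  shows "lower_tail_prob \<eta> n p =
    (\<Sum>G\<in>Pow (complete_edges n). gprob (complete_edges n) (\<lambda>_. p) G *
       (if real (triangle_count n G) \<le> \<eta> * (real (n choose 3) * p ^ 3) then 1 else 0))"
proof -
  let ?P = "\<lambda>G. real (triangle_count n G) \<le> \<eta> * (real (n choose 3) * p ^ 3)"
  have "lower_tail_prob \<eta> n p = (\<Sum>G\<in>{G \<in> Pow (complete_edges n). ?P G}. gprob (complete_edges n) (\<lambda>_. p) G)"
    unfolding lower_tail_prob_def expectation_triangle_count[OF assms] prob_gnp[OF assms]
    by (simp add: Int_def)
  also have "\<dots> = (\<Sum>G\<in>Pow (complete_edges n). if ?P G then gprob (complete_edges n) (\<lambda>_. p) G else 0)"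
    using finite_complete_edges by (intro sum.inter_filter) auto
  finally show ?thesis by (simp add: if_distrib cong: if_cong)
qed

lemma lower_tail_prob_pos:
  assumes "0 \<le> p" "p < 1" "0 \<le> \<eta>"
  shows "0 < lower_tail_prob \<eta> n p"
proof -
  let ?f = "\<lambda>G. gprob (complete_edges n) (\<lambda>_. p) G *
       (if real (triangle_count n G) \<le> \<eta> * (real (n choose 3) * p ^ 3) then 1 else 0)"
  have "{T \<in> triangles n. T \<subseteq> {}} = {}"
    using linear_hypergraph.edge_not_in_small[OF linear_hypergraph_triangles[of 0 0 n]] by auto
  then have "triangle_count n {} = 0" unfolding triangle_count_eq by (simp only: card.empty)
  then have "?f {} = (1 - p) ^ card (complete_edges n)"
    using assms by (simp add: gprob_const[OF finite_complete_edges])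
  then have "0 < ?f {}" using assms by simp
  also have "\<dots> \<le> (\<Sum>G\<in>Pow (complete_edges n). ?f G)"
    using assms finite_complete_edges by (intro member_le_sum) (auto intro!: gprob_nonneg)
  finally show ?thesis using assms by (subst lower_tail_prob_eq) auto
qed

lemma chernoff_upper:
  assumes c: "0 \<le> c" "c / sqrt n < 1" and t: "0 \<le> t" "t < 1" and \<eta>: "0 \<le> \<eta>"
  shows "ln (lower_tail_prob \<eta> n (c / sqrt n)) \<le>
     ln (lmgf c t n) - \<eta> * (real (n choose 3) * (c / sqrt n) ^ 3) * ln (1 - t)"
proof -
  define k where "k = \<eta> * (real (n choose 3) * (c / sqrt n) ^ 3)"
  have p: "0 \<le> c / sqrt n" "c / sqrt n \<le> 1" using c by auto
  have pos: "0 < lower_tail_prob \<eta> n (c / sqrt n)" using c \<eta> by (intro lower_tail_prob_pos) auto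
  have "lower_tail_prob \<eta> n (c / sqrt n) \<le> (\<Sum>G\<in>Pow (complete_edges n).
     gprob (complete_edges n) (\<lambda>_. c / sqrt n) G * ((1 - t) ^ triangle_count n G * exp (- k * ln (1 - t))))"
    unfolding lower_tail_prob_eq[OF p] k_def[symmetric]
  proof (intro sum_mono mult_left_mono gprob_nonneg)
    fix G
    have "1 \<le> (1 - t) ^ triangle_count n G * exp (- k * ln (1 - t))" if "real (triangle_count n G) \<le> k"
    proof -
      have "(1 - t) ^ triangle_count n G * exp (- k * ln (1 - t)) = exp ((real (triangle_count n G) - k) * ln (1 - t))"
        using t by (simp add: left_diff_distrib exp_diff exp_minus exp_of_nat_mult divide_inverse)
      moreover have "0 \<le> (real (triangle_count n G) - k) * ln (1 - t)"
        using that t by (intro mult_nonpos_nonpos) auto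
      ultimately show ?thesis by simp
    qed
    then show "(if real (triangle_count n G) \<le> k then 1 else 0) \<le> (1 - t) ^ triangle_count n G * exp (- k * ln (1 - t))"
      using t by auto
  qed (use p in auto)
  also have "\<dots> = lmgf c t n * exp (- k * ln (1 - t))"
    unfolding lmgf_eq_sum[OF c(1) p(2)] sum_distrib_right by (simp add: mult_ac)
  finally have le: "lower_tail_prob \<eta> n (c / sqrt n) \<le> lmgf c t n * exp (- k * ln (1 - t))" .
  then have lp: "0 < lmgf c t n" using pos by (smt (verit) exp_gt_zero zero_less_mult_pos2)
  have "ln (lower_tail_prob \<eta> n (c / sqrt n)) \<le> ln (lmgf c t n * exp (- k * ln (1 - t)))"
    using le pos by (subst ln_le_cancel_iff) auto
  also have "\<dots> = ln (lmgf c t n) - k * ln (1 - t)" using lp by (simp add: ln_mult_pos)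
  finally show ?thesis unfolding k_def .
qed

text \<open>The inequality holds pointwise in the triangle count: counts above the allowed number,
  which is at least \<open>m * N\<close>, are paid for by the weaker tilt \<open>t2\<close>, counts
  up to \<open>a * N\<close> by the stronger tilt \<open>t3\<close>, and the window in between by
  the event itself. It replaces a concentration statement for the tilted measure.\<close>

lemma tilting_inequality:
  fixes a m N z1 z2 z3 :: real
  assumes c: "0 \<le> c" "c / sqrt n < 1" and t: "t2 < t1" "t1 < t3" "t3 < 1" "0 \<le> t2"
    and am: "m * N \<le> \<eta> * (real (n choose 3) * (c / sqrt n) ^ 3)"
  defines "z1 \<equiv> - ln (1 - t1)" and "z2 \<equiv> - ln (1 - t2)" and "z3 \<equiv> - ln (1 - t3)"
  shows "lmgf c t1 n \<le> exp (- (a * N * z1)) * lower_tail_prob \<eta> n (c / sqrt n)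
     + exp (- (m * N * (z1 - z2))) * lmgf c t2 n + exp (a * N * (z3 - z1)) * lmgf c t3 n"
proof -
  define k where "k = \<eta> * (real (n choose 3) * (c / sqrt n) ^ 3)"
  have p: "0 \<le> c / sqrt n" "c / sqrt n \<le> 1" using c by auto
  have z: "z2 < z1" "z1 < z3" "0 \<le> z1" using t by (auto simp: z1_def z2_def z3_def)
  have pw: "(1 - t1) ^ j = exp (- (z1 * real j))" "(1 - t2) ^ j = exp (- (z2 * real j))"
     "(1 - t3) ^ j = exp (- (z3 * real j))" for j
    using t by (auto simp: z1_def z2_def z3_def mult.commute[of "ln _"] exp_of_nat_mult)
  have "(1 - t1) ^ j \<le> exp (- (a * N * z1)) * (if real j \<le> k then 1 else 0)
      + exp (- (m * N * (z1 - z2))) * (1 - t2) ^ j + exp (a * N * (z3 - z1)) * (1 - t3) ^ j" (is "_ \<le> ?A + ?B + ?C") for j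
  proof -
    have nn: "0 \<le> ?A" "0 \<le> ?B" "0 \<le> ?C" using t by auto
    consider "real j > k" | "real j \<le> a * N" | "real j \<le> k" "real j > a * N" by linarith
    then show ?thesis
    proof cases
      case 1
      then have "m * N < real j" using am by (simp add: k_def)
      then have "m * N * (z1 - z2) \<le> real j * (z1 - z2)" using z by (intro mult_right_mono) auto
      then have "(1 - t1) ^ j \<le> ?B" unfolding pw by (simp add: algebra_simps flip: exp_add)
      then show ?thesis using nn by linarith
    next
      case 2
      then have "real j * (z3 - z1) \<le> a * N * (z3 - z1)" using z by (intro mult_right_mono) auto
      then have "(1 - t1) ^ j \<le> ?C" unfolding pw by (simp add: algebra_simps flip: exp_add)
      then show ?thesis using nn by linarith
    next
      case 3
      then have "a * N * z1 \<le> real j * z1" using z by (intro mult_right_mono) auto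
      then have "(1 - t1) ^ j \<le> ?A" using 3 unfolding pw by (simp add: algebra_simps)
      then show ?thesis using nn by linarith
    qed
  qed
  then have "gprob (complete_edges n) (\<lambda>_. c / sqrt n) G * (1 - t1) ^ triangle_count n G
     \<le> gprob (complete_edges n) (\<lambda>_. c / sqrt n) G * (exp (- (a * N * z1)) * (if real (triangle_count n G) \<le> k then 1 else 0)
      + exp (- (m * N * (z1 - z2))) * (1 - t2) ^ triangle_count n G + exp (a * N * (z3 - z1)) * (1 - t3) ^ triangle_count n G)"
    if "G \<in> Pow (complete_edges n)" for G
    using that p by (intro mult_left_mono gprob_nonneg) auto
  then show ?thesis
    unfolding lmgf_eq_sum[OF c(1) p(2)] lower_tail_prob_eq[OF p] k_def[symmetric]
      sum_distrib_left sum.distrib[symmetric]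
    by (intro sum_mono) (simp add: algebra_simps)
qed

lemma expected_triangles_limit:
  assumes c: "0 < c"
  shows "(\<lambda>n. real (n choose 3) * (c / sqrt n) ^ 3 / real n powr (3/2)) \<longlonglongrightarrow> c ^ 3 / 6"
proof (rule Lim_transform_eventually)
  show "(\<lambda>n. real n * (real n - 1) * (real n - 2) / 6 * (c / sqrt n) ^ 3 / real n powr (3/2)) \<longlonglongrightarrow> c ^ 3 / 6"
    using c by real_asymp
  have "real n * (real n - 1) * (real n - 2) / 6 = real (n choose 3)" for n
    by (simp add: binomial_gbinomial gbinomial_prod_rev numeral_3_eq_3 atLeast0_lessThan_Suc mult_ac)
  then show "\<forall>\<^sub>F n in sequentially. real n * (real n - 1) * (real n - 2) / 6 * (c / sqrt n) ^ 3 / real n powr (3/2)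
    = real (n choose 3) * (c / sqrt n) ^ 3 / real n powr (3/2)"
    by simp
qed

text \<open>\<open>gap2\<close> and \<open>gap3\<close> make the two error terms of
  \<open>tilting_inequality\<close> exponentially smaller than its left-hand side, so at least half
  of that is left for the lower-tail event.\<close>

lemma tilting_lower_bound:
  fixes a m \<Lambda>1 \<Lambda>2 \<Lambda>3 \<eta> :: real
  assumes c: "0 < c" and \<eta>: "0 \<le> \<eta>" and t: "t2 < t1" "t1 < t3" "t3 < 1" "0 \<le> t2"
    and lim1: "(\<lambda>n. ln (lmgf c t1 n) / real n powr (3/2)) \<longlonglongrightarrow> \<Lambda>1"
    and lim2: "(\<lambda>n. ln (lmgf c t2 n) / real n powr (3/2)) \<longlonglongrightarrow> \<Lambda>2"
    and lim3: "(\<lambda>n. ln (lmgf c t3 n) / real n powr (3/2)) \<longlonglongrightarrow> \<Lambda>3"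
    and m: "m < \<eta> * c ^ 3 / 6"
  defines "z1 \<equiv> - ln (1 - t1)" and "z2 \<equiv> - ln (1 - t2)" and "z3 \<equiv> - ln (1 - t3)"
  assumes gap2: "\<Lambda>2 + m * z2 < \<Lambda>1 + m * z1" and gap3: "\<Lambda>3 + a * z3 < \<Lambda>1 + a * z1"
    and r: "r < \<Lambda>1 + a * z1"
  shows "\<forall>\<^sub>F n in sequentially. r < ln (lower_tail_prob \<eta> n (c / sqrt n)) / real n powr (3/2)"
proof -
  define N where "N n = real n powr (3/2)" for n :: nat
  have Ntop: "filterlim N at_top sequentially" unfolding N_def by real_asymp
  have Npos: "\<forall>\<^sub>F n in sequentially. 0 < N n" using Ntop by (simp add: filterlim_at_top_dense)
  have ev_c: "\<forall>\<^sub>F n in sequentially. c / sqrt n < 1" using c by real_asymp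
  have binom: "(\<lambda>n. real (n choose 3) * (c / sqrt n) ^ 3 / N n) \<longlonglongrightarrow> c ^ 3 / 6"
    unfolding N_def by (rule expected_triangles_limit[OF c])
  then have "(\<lambda>n. \<eta> * (real (n choose 3) * (c / sqrt n) ^ 3 / N n)) \<longlonglongrightarrow> \<eta> * (c ^ 3 / 6)"
    by (rule tendsto_mult[OF tendsto_const])
  then have "\<forall>\<^sub>F n in sequentially. m < \<eta> * (real (n choose 3) * (c / sqrt n) ^ 3 / N n)"
    using m by (intro order_tendstoD(1)) auto
  with Npos have ev_m: "\<forall>\<^sub>F n in sequentially. m * N n \<le> \<eta> * (real (n choose 3) * (c / sqrt n) ^ 3)"
  proof eventually_elim
    case (elim n)
    then have "m * N n < \<eta> * (real (n choose 3) * (c / sqrt n) ^ 3 / N n) * N n"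
      by (intro mult_strict_right_mono)
    then show ?case using elim by simp
  qed
  have small: "\<forall>\<^sub>F n in sequentially. exp (b * N n) * lmgf c t' n \<le> lmgf c t1 n / 4"
    if lim: "(\<lambda>n. ln (lmgf c t' n) / real n powr (3/2)) \<longlonglongrightarrow> \<Lambda>" and b: "\<Lambda> + b < \<Lambda>1" and t': "t' < 1" "0 \<le> t'" for b \<Lambda> t'
  proof -
    have "(\<lambda>n. ln (lmgf c t' n) / N n + b - ln (lmgf c t1 n) / N n) \<longlonglongrightarrow> \<Lambda> + b - \<Lambda>1"
      using lim lim1 unfolding N_def by (intro tendsto_intros)
    moreover obtain d where d: "\<Lambda> + b - \<Lambda>1 < d" "d < 0" using b dense[of "\<Lambda> + b - \<Lambda>1" 0] by auto
    ultimately have "\<forall>\<^sub>F n in sequentially. ln (lmgf c t' n) / N n + b - ln (lmgf c t1 n) / N n < d"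
      by (intro order_tendstoD(2)) auto
    moreover have "\<forall>\<^sub>F n in sequentially. ln 4 / (- d) \<le> N n" using Ntop by (simp add: filterlim_at_top)
    ultimately show ?thesis using Npos ev_c
    proof eventually_elim
      case (elim n)
      have pos: "0 < lmgf c t n" if "t < 1" "0 \<le> t" for t
      proof -
        have "lmgf c t n = (1 - c / sqrt n) ^ card (complete_edges n) * partfun (complete_edges n) (triangles n) t (c / sqrt n / (1 - c / sqrt n))"
          unfolding lmgf_def using c elim by (intro expectation_power_triangle_count) auto
        moreover have "0 < (1 - t) ^ card {T \<in> triangles n. T \<subseteq> {}}" using that by simp
        then have "0 < partfun (complete_edges n) (triangles n) t (c / sqrt n / (1 - c / sqrt n))"
          unfolding partfun_def using c elim that finite_complete_edges
          by (intro sum_pos2[of _ "{}"]) auto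
        ultimately show ?thesis using elim by simp
      qed
      have "(ln (lmgf c t' n) / N n + b - ln (lmgf c t1 n) / N n) * N n \<le> d * N n"
        using elim by (intro mult_right_mono) auto
      also have "d * N n \<le> - ln 4" using elim d by (simp add: field_simps)
      finally have "ln (lmgf c t' n) + b * N n \<le> ln (lmgf c t1 n) - ln 4"
        using elim by (simp add: algebra_simps)
      then have "exp (ln (lmgf c t' n) + b * N n) \<le> exp (ln (lmgf c t1 n) - ln 4)" by simp
      then show ?case using pos[of t'] pos[of t1] t t' by (simp add: exp_add exp_diff mult.commute)
    qed
  qed
  have s2: "\<forall>\<^sub>F n in sequentially. exp ((- (m * (z1 - z2))) * N n) * lmgf c t2 n \<le> lmgf c t1 n / 4"
    using t gap2 by (intro small[OF lim2]) (auto simp: algebra_simps)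
  have s3: "\<forall>\<^sub>F n in sequentially. exp ((a * (z3 - z1)) * N n) * lmgf c t3 n \<le> lmgf c t1 n / 4"
    using t gap3 by (intro small[OF lim3]) (auto simp: algebra_simps)
  have "(\<lambda>n. ln (lmgf c t1 n) / N n + a * z1 - ln 2 / N n) \<longlonglongrightarrow> \<Lambda>1 + a * z1 - 0"
    using lim1 Ntop unfolding N_def by (intro tendsto_intros tendsto_divide_0[OF tendsto_const] filterlim_at_top_imp_at_infinity) auto
  then have ev_r: "\<forall>\<^sub>F n in sequentially. r < ln (lmgf c t1 n) / N n + a * z1 - ln 2 / N n"
    using r by (intro order_tendstoD(1)) auto
  show ?thesis
    using s2 s3 ev_r ev_m Npos ev_c
  proof eventually_elim
    case (elim n)
    have P: "0 < lower_tail_prob \<eta> n (c / sqrt n)" using c \<eta> elim by (intro lower_tail_prob_pos) auto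
    have "lmgf c t1 n \<le> exp (- (a * N n * z1)) * lower_tail_prob \<eta> n (c / sqrt n)
     + exp (- (m * N n * (z1 - z2))) * lmgf c t2 n + exp (a * N n * (z3 - z1)) * lmgf c t3 n"
      unfolding z1_def z2_def z3_def using c elim t by (intro tilting_inequality) auto
    then have le: "lmgf c t1 n / 2 \<le> exp (- (a * N n * z1)) * lower_tail_prob \<eta> n (c / sqrt n)"
      using elim(1,2) by (simp add: mult_ac)
    have "0 < lmgf c t1 n"
    proof -
      have "0 < (1 - t1) ^ card {T \<in> triangles n. T \<subseteq> {}}" using t by simp
      then have "0 < partfun (complete_edges n) (triangles n) t1 (c / sqrt n / (1 - c / sqrt n))"
        unfolding partfun_def using c elim t finite_complete_edges
        by (intro sum_pos2[of _ "{}"]) auto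
      then show ?thesis unfolding lmgf_def using c elim by (subst expectation_power_triangle_count) auto
    qed
    then have "ln (lmgf c t1 n / 2) \<le> ln (exp (- (a * N n * z1)) * lower_tail_prob \<eta> n (c / sqrt n))"
      using le by (subst ln_le_cancel_iff) (auto intro: P)
    then have "ln (lmgf c t1 n) - ln 2 + a * N n * z1 \<le> ln (lower_tail_prob \<eta> n (c / sqrt n))"
      using P \<open>0 < lmgf c t1 n\<close> by (simp add: ln_mult_pos ln_div)
    then have "(ln (lmgf c t1 n) - ln 2 + a * N n * z1) / N n \<le> ln (lower_tail_prob \<eta> n (c / sqrt n)) / N n"
      using elim by (intro divide_right_mono) auto
    moreover have "(ln (lmgf c t1 n) - ln 2 + a * N n * z1) / N n = ln (lmgf c t1 n) / N n + a * z1 - ln 2 / N n"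
      using elim by (simp add: field_simps)
    ultimately show ?case using elim unfolding N_def by linarith
  qed
qed

text \<open>
  The Legendre transform of the limiting exponential moments, with the tilt eliminated in favour of
  the edge marginal \<open>x\<close>; at \<open>\<eta> = 0\<close> the junk value \<open>ln 0\<close> is multiplied by \<open>\<eta>\<close>.
\<close>

definition rate :: "real \<Rightarrow> real \<Rightarrow> real \<Rightarrow> real" where
  "rate \<eta> c x = c * ((x - 1) / 2 - x * ln x / 3) - \<eta> * c ^ 3 * (ln \<eta> - 3 * ln x) / 6"

lemma phi_eqI:
  assumes "(\<lambda>n. ln (lower_tail_prob \<eta> n (c / sqrt n)) / real n powr (3/2)) \<longlonglongrightarrow> l"
  shows "phi \<eta> c = l"
proof -
  have "(\<lambda>n. ereal (ln (lower_tail_prob \<eta> n (c / sqrt n)) / real n powr (3/2))) \<longlonglongrightarrow> ereal l"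
    using assms by simp
  from lim_imp_Liminf[OF _ this] show ?thesis by (simp add: phi_def)
qed

text \<open>The tilt is chosen so that the prescribed \<open>x\<close> solves the fixed-point
  equation; the last condition on \<open>x\<close> says that this tilt is at most 1.\<close>

lemma lmgf_limit':
  assumes c: "0 < c" "2 * c\<^sup>2 < exp 1" and x: "0 < x" "x \<le> 1" "- ln x \<le> c\<^sup>2 * x\<^sup>2"
  shows "(\<lambda>n. ln (lmgf c (- ln x / (c\<^sup>2 * x\<^sup>2)) n) / real n powr (3/2)) \<longlonglongrightarrow> c * ((x - 1) / 2 - x * ln x / 3)"
proof -
  define t where "t = - ln x / (c\<^sup>2 * x\<^sup>2)"
  have cx: "0 < c\<^sup>2 * x\<^sup>2" using c x by simp
  have t: "0 \<le> t" unfolding t_def by (rule divide_nonneg_pos[OF _ cx]) (use x in simp)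
  have t1: "t \<le> 1" unfolding t_def pos_divide_le_eq[OF cx] using x by simp
  have e: "t * c\<^sup>2 * x\<^sup>2 = - ln x" using c x by (simp add: t_def)
  then have "x = exp (- (t * c\<^sup>2 * x\<^sup>2))" using x by simp
  from lmgf_limit[OF c t t1 _ this] x
  have "(\<lambda>n. ln (lmgf c t n) / real n powr (3/2)) \<longlonglongrightarrow> c * x / 2 + t * c ^ 3 * x ^ 3 / 3 - c / 2" by simp
  moreover have "t * c ^ 3 * x ^ 3 = (t * c\<^sup>2 * x\<^sup>2) * (c * x)" by (simp add: power2_eq_square power3_eq_cube)
  then have "c * x / 2 + t * c ^ 3 * x ^ 3 / 3 - c / 2 = c * ((x - 1) / 2 - x * ln x / 3)"
    unfolding e by (simp add: algebra_simps)
  ultimately show ?thesis by (simp add: t_def)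
qed

text \<open>Here the tilt is \<open>t = 1\<close>, and the full penalty turns the exponential moment
  into the lower-tail probability itself.\<close>

lemma phi_zero:
  assumes c: "0 < c" "2 * c\<^sup>2 < exp 1" and x: "0 < x" "x < 1" "- ln x = c\<^sup>2 * x\<^sup>2"
  shows "phi 0 c = rate 0 c x"
proof (rule phi_eqI)
  have "c\<^sup>2 * x\<^sup>2 \<noteq> 0" using c x by simp
  then have t: "- ln x / (c\<^sup>2 * x\<^sup>2) = 1" using x(3) by simp
  have "(\<lambda>n. ln (lmgf c 1 n) / real n powr (3/2)) \<longlonglongrightarrow> rate 0 c x"
    using lmgf_limit'[OF c, of x] x unfolding t by (simp add: rate_def)
  moreover have "\<forall>\<^sub>F n in sequentially. c / sqrt n < 1" using c by real_asymp
  then have "\<forall>\<^sub>F n in sequentially. ln (lmgf c 1 n) / real n powr (3/2) = ln (lower_tail_prob 0 n (c / sqrt n)) / real n powr (3/2)"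
  proof eventually_elim
    case (elim n)
    have p: "0 \<le> c / sqrt n" "c / sqrt n \<le> 1" using c elim by auto
    have "lmgf c 1 n = lower_tail_prob 0 n (c / sqrt n)"
      using c p unfolding lower_tail_prob_eq[OF p] by (subst lmgf_eq_sum) (auto simp: power_0_left intro!: sum.cong)
    then show ?case by simp
  qed
  ultimately show "(\<lambda>n. ln (lower_tail_prob 0 n (c / sqrt n)) / real n powr (3/2)) \<longlonglongrightarrow> rate 0 c x"
    by (rule Lim_transform_eventually)
qed

text \<open>Chernoff's bound at the tilt with marginal \<open>x\<close> gives the upper half. For
  the lower half the tilt is moved to a marginal \<open>y < x\<close>, where the typical number of
  triangles stays strictly below the allowed one.\<close>

lemma phi_pos:
  assumes c: "0 < c" "2 * c\<^sup>2 < exp 1" and \<eta>: "0 < \<eta>" and x: "0 < x" "x < 1" "c\<^sup>2 * (x ^ 3 - \<eta>) = - x * ln x"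
  shows "phi \<eta> c = rate \<eta> c x"
proof (rule phi_eqI)
  \<comment> \<open>Everything is read as a function of the edge marginal \<open>y\<close>:
    \<open>tt\<close> is the tilt, \<open>L\<close> the limiting logarithmic moment,
    \<open>z\<close> the variable dual to the triangle count, and \<open>M\<close> the typical count
    in units of \<open>n powr (3/2)\<close>.\<close>
  define tt where "tt y = - ln y / (c\<^sup>2 * y\<^sup>2)" for y
  define L where "L y = c * ((y - 1) / 2 - y * ln y / 3)" for y
  define z where "z y = - ln (1 - tt y)" for y
  define M where "M y = (1 - tt y) * c ^ 3 * y ^ 3 / 6" for y
  define lp where "lp n = ln (lower_tail_prob \<eta> n (c / sqrt n)) / real n powr (3/2)" for n
  have xx: "- x * ln x > 0" using x by (simp add: mult_less_0_iff)
  then have "0 < c\<^sup>2 * (x ^ 3 - \<eta>)" using x by simp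
  then have \<eta>x: "\<eta> < x ^ 3" using c by (simp add: zero_less_mult_iff)
  \<comment> \<open>The equation for \<open>x\<close> says precisely that the typical count
    \<open>M x\<close> meets the allowed \<open>\<eta> * c ^ 3 / 6\<close>.\<close>
  have tx: "1 - tt x = \<eta> / x ^ 3"
  proof -
    have "- ln x = c\<^sup>2 * (x ^ 3 - \<eta>) / x" using x by (simp add: field_simps)
    then have "tt x = c\<^sup>2 * (x ^ 3 - \<eta>) / x / (c\<^sup>2 * x\<^sup>2)" unfolding tt_def by (simp only:)
    also have "\<dots> = (x ^ 3 - \<eta>) / x ^ 3" using c(1) x(1) by (simp add: power2_eq_square power3_eq_cube)
    finally have "tt x = (x ^ 3 - \<eta>) / x ^ 3" .
    then show ?thesis using x by (simp add: diff_divide_distrib)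
  qed
  have txr: "0 < tt x" "tt x < 1"
  proof -
    show "0 < tt x" unfolding tt_def using x c by (intro divide_pos_pos) auto
    have "0 < 1 - tt x" unfolding tx using \<eta> x by simp
    then show "tt x < 1" by simp
  qed
  have lim: "(\<lambda>n. ln (lmgf c (tt y) n) / real n powr (3/2)) \<longlonglongrightarrow> L y" if "0 < y" "y \<le> 1" "tt y \<le> 1" for y
  proof -
    have "0 < c\<^sup>2 * y\<^sup>2" using c that by simp
    from that(3)[unfolded tt_def pos_divide_le_eq[OF this]] have "- ln y \<le> c\<^sup>2 * y\<^sup>2" by simp
    then show ?thesis unfolding tt_def L_def by (rule lmgf_limit'[OF c that(1,2)])
  qed
  have rate_eq: "rate \<eta> c x = L x + \<eta> * c ^ 3 / 6 * z x"
  proof -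
    have "z x = - (ln \<eta> - 3 * ln x)" unfolding z_def tx using \<eta> x by (simp add: ln_div ln_realpow)
    then show ?thesis unfolding rate_def L_def by (simp only:) (simp add: field_simps)
  qed
  define N where "N n = real n powr (3/2)" for n :: nat
  have ev_c: "\<forall>\<^sub>F n in sequentially. c / sqrt n < 1" using c by real_asymp
  have binom: "(\<lambda>n. real (n choose 3) * (c / sqrt n) ^ 3 / N n) \<longlonglongrightarrow> c ^ 3 / 6"
    unfolding N_def by (rule expected_triangles_limit[OF c(1)])
  have "(\<lambda>n. ln (lmgf c (tt x) n) / N n + \<eta> * (real (n choose 3) * (c / sqrt n) ^ 3 / N n) * z x) \<longlonglongrightarrow> L x + \<eta> * (c ^ 3 / 6) * z x"
    unfolding N_def using x txr by (intro tendsto_intros lim binom[unfolded N_def]) auto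
  then have up: "(\<lambda>n. ln (lmgf c (tt x) n) / N n + \<eta> * (real (n choose 3) * (c / sqrt n) ^ 3 / N n) * z x) \<longlonglongrightarrow> rate \<eta> c x"
    by (simp add: rate_eq)
  have le: "\<forall>\<^sub>F n in sequentially. lp n \<le> ln (lmgf c (tt x) n) / N n + \<eta> * (real (n choose 3) * (c / sqrt n) ^ 3 / N n) * z x"
    using ev_c eventually_gt_at_top[of 0]
  proof eventually_elim
    case (elim n)
    have "ln (lower_tail_prob \<eta> n (c / sqrt n)) \<le>
       ln (lmgf c (tt x) n) - \<eta> * (real (n choose 3) * (c / sqrt n) ^ 3) * ln (1 - tt x)"
      using c elim txr \<eta> by (intro chernoff_upper) auto
    then have "lp n \<le> (ln (lmgf c (tt x) n) - \<eta> * (real (n choose 3) * (c / sqrt n) ^ 3) * ln (1 - tt x)) / N n"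
      unfolding lp_def N_def by (rule divide_right_mono) simp
    then show ?case by (simp add: z_def diff_divide_distrib)
  qed
  have tt_der: "(tt has_real_derivative - (1 - 2 * ln y) / (c\<^sup>2 * y ^ 3)) (at y)" if "0 < y" for y
    unfolding tt_def[abs_def] using that c
    by (auto intro!: derivative_eq_intros simp: field_simps power2_eq_square power3_eq_cube)
  have tt_anti: "tt y' < tt y" if "0 < y" "y < y'" "y' \<le> 1" for y y'
  proof -
    have A: "\<exists>d. DERIV tt u :> d \<and> d < 0" if "y < u" "u < y'" for u
    proof -
      have "0 < u" "u < 1" using that \<open>0 < y\<close> \<open>y' \<le> 1\<close> by auto
      then have "0 < (1 - 2 * ln u) / (c\<^sup>2 * u ^ 3)" using c
        by (intro divide_pos_pos) (auto intro: order_less_trans[of _ 0] simp: ln_less_zero)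
      then have "- (1 - 2 * ln u) / (c\<^sup>2 * u ^ 3) < 0"
        by (simp only: minus_divide_left[symmetric] neg_less_0_iff_less)
      then show ?thesis using tt_der[OF \<open>0 < u\<close>] by blast
    qed
    have B: "continuous_on {y..y'} tt"
    proof (intro continuous_at_imp_continuous_on ballI)
      fix u assume "u \<in> {y..y'}"
      then have "0 < u" using that by auto
      then show "isCont tt u" by (rule DERIV_isCont[OF tt_der])
    qed
    show ?thesis by (rule DERIV_neg_imp_decreasing_open[OF that(2) A B])
  qed
  have M_mono: "M y < M y'" if "0 < y" "y < y'" "y' \<le> 1" "tt y < 1" for y y'
  proof -
    have "(1 - tt y) * y ^ 3 < (1 - tt y') * y' ^ 3"
      using that tt_anti[of y y'] by (intro mult_strict_mono power_strict_mono) auto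
    then have "(1 - tt y) * y ^ 3 * (c ^ 3 / 6) < (1 - tt y') * y' ^ 3 * (c ^ 3 / 6)"
      using c by (intro mult_strict_right_mono) auto
    then show ?thesis by (simp add: M_def mult_ac)
  qed
  have Mx: "M x = \<eta> * c ^ 3 / 6" using x by (simp add: M_def tx)
  \<comment> \<open>The derivative has the sign of \<open>M y - a\<close>: \<open>L\<close> and
    \<open>z\<close> form a Legendre pair whose critical point is where the typical count equals
    \<open>a\<close>.\<close>
  have J_der: "((\<lambda>y. L y + a * z y) has_real_derivative
     (1 - 2 * ln y) / (c\<^sup>2 * y ^ 3 * (1 - tt y)) * (M y - a)) (at y)" if "0 < y" "tt y < 1" for y a
  proof -
    have zd: "(z has_real_derivative - (1 - 2 * ln y) / (c\<^sup>2 * y ^ 3) / (1 - tt y)) (at y)"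
      unfolding z_def[abs_def] using that
      by (auto intro!: derivative_eq_intros tt_der simp: field_simps)
    have Ld: "(L has_real_derivative c * (1 - 2 * ln y) / 6) (at y)"
      unfolding L_def[abs_def] using that
      by (auto intro!: derivative_eq_intros simp: field_simps)
    have "((\<lambda>y. L y + a * z y) has_real_derivative
       c * (1 - 2 * ln y) / 6 + a * (- (1 - 2 * ln y) / (c\<^sup>2 * y ^ 3) / (1 - tt y))) (at y)"
      by (intro DERIV_add Ld DERIV_cmult zd)
    moreover have "c * (1 - 2 * ln y) / 6 + a * (- (1 - 2 * ln y) / (c\<^sup>2 * y ^ 3) / (1 - tt y))
      = (1 - 2 * ln y) / (c\<^sup>2 * y ^ 3 * (1 - tt y)) * (M y - a)"
      using c that by (simp add: M_def divide_simps power2_eq_square power3_eq_cube) (simp add: algebra_simps)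
    ultimately show ?thesis by simp
  qed
  have lower: "\<forall>\<^sub>F n in sequentially. r < lp n" if r: "r < rate \<eta> c x" for r
  proof -
    have z_cont: "isCont z x" and L_cont: "isCont L x" and tt_cont: "isCont tt x" and M_cont: "isCont M x"
    proof -
      show tc: "isCont tt x" using tt_der[OF x(1)] by (rule DERIV_isCont)
      show "isCont z x" unfolding z_def using tc txr by (intro continuous_intros) auto
      show "isCont L x" unfolding L_def using x by (intro continuous_intros) auto
      show "isCont M x" unfolding M_def using tc by (intro continuous_intros) auto
    qed
    \<comment> \<open>Moving left of \<open>x\<close> leaves room below the allowed count and, by
      continuity, changes the bound arbitrarily little.\<close>
    have "((\<lambda>y. L y + M y * z y) \<longlongrightarrow> L x + M x * z x) (at_left x)"
      using z_cont L_cont M_cont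
      by (intro tendsto_intros) (auto simp: continuous_at intro: filterlim_mono[OF _ order_refl at_le])
    then have "\<forall>\<^sub>F y in at_left x. r < L y + M y * z y"
      using r by (intro order_tendstoD(1)) (auto simp: rate_eq Mx)
    moreover have "\<forall>\<^sub>F y in at_left x. tt y < 1"
      using tt_cont txr by (intro order_tendstoD(2)[of tt "tt x"]) (auto simp: continuous_at intro: filterlim_mono[OF _ order_refl at_le])
    moreover have "\<forall>\<^sub>F y in at_left x. y \<in> {0<..<x}" using x by (intro eventually_at_left_real) auto
    ultimately have "\<forall>\<^sub>F y in at_left x. r < L y + M y * z y \<and> tt y < 1 \<and> y \<in> {0<..<x}"
      by eventually_elim auto
    then obtain y where y: "r < L y + M y * z y" "tt y < 1" "0 < y" "y < x"
      using eventually_happens'[of "at_left x"] by (auto simp: trivial_limit_at_left_real)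
    have ty: "0 < tt y" using tt_anti[of y x] y x txr by auto
    have My: "M y < \<eta> * c ^ 3 / 6" using M_mono[of y x] y x Mx by simp
    have zy: "0 < z y" unfolding z_def using y ty by simp
    \<comment> \<open>The window for the count is \<open>a < M y < m\<close>, with \<open>m\<close>
      still below the allowed count and \<open>a\<close> close enough to \<open>M y\<close> to reach
      the target \<open>r\<close>.\<close>
    obtain m where m: "M y < m" "m < \<eta> * c ^ 3 / 6" using dense[OF My] by auto
    obtain a where a: "(r - L y) / z y < a" "a < M y"
      using dense[of "(r - L y) / z y" "M y"] y zy by (auto simp: divide_less_eq algebra_simps)
    have pos: "0 < (1 - 2 * ln y) / (c\<^sup>2 * y ^ 3 * (1 - tt y))"
      using y x c by (intro divide_pos_pos mult_pos_pos) (auto intro: order_less_trans[of _ 0])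
    \<comment> \<open>By the sign of the derivative, the objective with \<open>m\<close> falls to
      the right of \<open>y\<close> and the one with \<open>a\<close> falls to the left. These are
      the two gaps that \<open>tilting_lower_bound\<close> asks for, at the tilts of
      \<open>y + h\<close> and \<open>y - h\<close>.\<close>
    have "\<exists>d>0. \<forall>h>0. h < d \<longrightarrow> L (y + h) + m * z (y + h) < L y + m * z y"
      by (rule DERIV_neg_dec_right[OF J_der[OF y(3,2), of m] mult_pos_neg[OF pos]]) (use m in simp)
    then obtain d2 where d2: "d2 > 0" "\<And>h. 0 < h \<Longrightarrow> h < d2 \<Longrightarrow> L (y + h) + m * z (y + h) < L y + m * z y" by auto
    have "\<exists>d>0. \<forall>h>0. h < d \<longrightarrow> L (y - h) + a * z (y - h) < L y + a * z y"
      by (rule DERIV_pos_inc_left[OF J_der[OF y(3,2), of a] mult_pos_pos[OF pos]]) (use a in simp)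
    then obtain d3 where d3: "d3 > 0" "\<And>h. 0 < h \<Longrightarrow> h < d3 \<Longrightarrow> L (y - h) + a * z (y - h) < L y + a * z y" by auto
    have "isCont tt y" using tt_der[OF y(3)] by (rule DERIV_isCont)
    then have "(tt \<longlongrightarrow> tt y) (at y)" by (simp add: continuous_at)
    then have "\<forall>\<^sub>F u in at y. tt u < 1" using y by (intro order_tendstoD(2)) auto
    then obtain d4 where d4: "d4 > 0" "\<And>u. u \<noteq> y \<Longrightarrow> \<bar>u - y\<bar> < d4 \<Longrightarrow> tt u < 1"
      unfolding eventually_at by (auto simp: dist_real_def)
    define h where "h = Min {d2 / 2, d3 / 2, d4 / 2, (x - y) / 2, y / 2}"
    have h: "0 < h" "h < d2" "h < d3" "h < d4" "h < x - y" "h < y"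
    proof -
      have "h \<le> d2 / 2" "h \<le> d3 / 2" "h \<le> d4 / 2" "h \<le> (x - y) / 2" "h \<le> y / 2"
        unfolding h_def by (rule Min_le; simp)+
      moreover show "0 < h" using d2(1) d3(1) d4(1) y(3,4) by (simp add: h_def)
      ultimately show "h < d2" "h < d3" "h < d4" "h < x - y" "h < y"
        using d2(1) d3(1) d4(1) y(3,4) by simp_all
    qed
    have t3: "tt (y - h) < 1" using d4(2)[of "y - h"] h by auto
    have t2: "tt (y + h) < tt y" "0 < tt (y + h)"
      using tt_anti[of y "y + h"] tt_anti[of "y + h" x] y h x txr by auto
    have t3': "tt y < tt (y - h)" using tt_anti[of "y - h" y] y h x by auto
    have "r < L y + a * z y" using a(1) zy by (simp add: divide_less_eq algebra_simps)
    have lims: "(\<lambda>n. ln (lmgf c (tt y) n) / real n powr (3/2)) \<longlonglongrightarrow> L y"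
      "(\<lambda>n. ln (lmgf c (tt (y + h)) n) / real n powr (3/2)) \<longlonglongrightarrow> L (y + h)"
      "(\<lambda>n. ln (lmgf c (tt (y - h)) n) / real n powr (3/2)) \<longlonglongrightarrow> L (y - h)"
      using y x h t2 t3 by (auto intro!: lim)
    have "0 \<le> \<eta>" "0 \<le> tt (y + h)" using \<eta> t2 by auto
    then show ?thesis unfolding lp_def
      by (rule tilting_lower_bound[OF c(1) _ t2(1) t3' t3 _ lims m(2) d2(2)[OF h(1,2), unfolded z_def]
            d3(2)[OF h(1,3), unfolded z_def] \<open>r < L y + a * z y\<close>[unfolded z_def]])
  qed
  show "(\<lambda>n. ln (lower_tail_prob \<eta> n (c / sqrt n)) / real n powr (3/2)) \<longlonglongrightarrow> rate \<eta> c x"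
    unfolding lp_def[symmetric]
  proof (rule order_tendstoI)
    fix r assume "rate \<eta> c x < r"
    from order_tendstoD(2)[OF up this] le show "\<forall>\<^sub>F n in sequentially. lp n < r"
      by eventually_elim simp
  qed (rule lower)
qed

lemma phi_eq_rate:
  assumes "0 < c" "2 * c\<^sup>2 < exp 1" "0 \<le> \<eta>" "0 < x" "x < 1" "c\<^sup>2 * (x ^ 3 - \<eta>) = - x * ln x"
  shows "phi \<eta> c = rate \<eta> c x"
proof (cases "\<eta> = 0")
  case True
  then have "x * (- ln x) = x * (c\<^sup>2 * x\<^sup>2)" using assms(6) by (simp add: power2_eq_square power3_eq_cube mult_ac)
  then have "- ln x = c\<^sup>2 * x\<^sup>2" using assms(4) by (simp only: mult_cancel_left) simp
  then show ?thesis using phi_zero[of c x] True assms by simp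
next
  case False
  then show ?thesis using phi_pos assms by simp
qed

subsection \<open>Analytic continuation\<close>

text \<open>Real analyticity as restriction of a holomorphic germ: in this form sums, products and
  composites are immediate, and isolated zeros come from complex analysis.\<close>

definition complex_ext :: "(real \<Rightarrow> real) \<Rightarrow> real \<Rightarrow> bool" where
  "complex_ext f x \<longleftrightarrow> (\<exists>g. g analytic_on {complex_of_real x} \<and>
     (\<forall>\<^sub>F y in nhds x. complex_of_real (f y) = g (complex_of_real y)))"

lemma complex_extI:
  assumes "g analytic_on {complex_of_real x}" "\<forall>\<^sub>F y in nhds x. complex_of_real (f y) = g (complex_of_real y)"
  shows "complex_ext f x"
  using assms unfolding complex_ext_def by blast

text \<open>The same coefficients, read in the complex numbers, have the same radius of
  convergence.\<close>

lemma real_analytic_imp_complex_ext: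
  assumes "real_analytic_at f x" shows "complex_ext f x"
proof -
  obtain F where F: "(\<lambda>h. f (x + h)) has_fps_expansion F" using assms by (auto simp: real_analytic_at_def)
  define G where "G = Abs_fps (\<lambda>n. complex_of_real (fps_nth F n))"
  have r: "fps_conv_radius G = fps_conv_radius F"
    unfolding fps_conv_radius_def G_def by (intro conv_radius_cong) auto
  have pos: "0 < fps_conv_radius F" using F by (simp add: has_fps_expansion_def)
  have ev: "eval_fps G (complex_of_real z) = complex_of_real (eval_fps F z)"
    if "ereal (norm z) < fps_conv_radius F" for z
  proof -
    have "(\<lambda>n. complex_of_real (fps_nth F n * z ^ n)) sums complex_of_real (eval_fps F z)"
      unfolding eval_fps_def using summable_fps[OF that] by (intro sums_of_real summable_sums)
    then show ?thesis unfolding eval_fps_def G_def by (simp add: sums_iff)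
  qed
  have an: "(\<lambda>w. eval_fps G (w - complex_of_real x)) analytic_on {complex_of_real x}"
    by (rule analytic_on_compose[of "\<lambda>w. w - complex_of_real x" _ "eval_fps G", unfolded o_def])
      (use r pos in \<open>auto intro!: analytic_on_diff analytic_on_eval_fps simp: zero_ereal_def\<close>)
  have "\<forall>\<^sub>F h in nhds 0. eval_fps F h = f (x + h)" using F by (simp add: has_fps_expansion_def)
  moreover have "\<forall>\<^sub>F h in nhds (0 :: real). ereal (norm h) < fps_conv_radius F"
  proof -
    have "((\<lambda>h :: real. ereal (norm h)) \<longlongrightarrow> ereal (norm (0 :: real))) (nhds 0)"
      by (intro tendsto_intros filterlim_ident)
    then show ?thesis by (rule order_tendstoD(2)) (use pos in \<open>simp add: zero_ereal_def\<close>)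
  qed
  ultimately have "\<forall>\<^sub>F h in nhds 0. complex_of_real (f (x + h)) = eval_fps G (complex_of_real (x + h) - complex_of_real x)"
    by eventually_elim (simp add: ev)
  then have "\<forall>\<^sub>F y in nhds x. complex_of_real (f y) = eval_fps G (complex_of_real y - complex_of_real x)"
    by (simp add: nhds_to_0[of x] eventually_filtermap add.commute)
  with an show ?thesis by (rule complex_extI)
qed

lemma complex_ext_cong:
  assumes "complex_ext f x" "\<forall>\<^sub>F y in nhds x. f y = g y" shows "complex_ext g x"
proof -
  obtain h where h: "h analytic_on {complex_of_real x}" "\<forall>\<^sub>F y in nhds x. complex_of_real (f y) = h (complex_of_real y)"
    using assms(1) by (auto simp: complex_ext_def)
  from h(2) assms(2) have "\<forall>\<^sub>F y in nhds x. complex_of_real (g y) = h (complex_of_real y)"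
    by eventually_elim simp
  with h(1) show ?thesis by (rule complex_extI)
qed

lemma complex_ext_const: "complex_ext (\<lambda>_. k) x"
  by (rule complex_extI[of "\<lambda>_. complex_of_real k"]) auto

lemma complex_ext_ident: "complex_ext (\<lambda>y. y) x"
  by (rule complex_extI[of "\<lambda>z. z"]) auto

lemma complex_ext_add:
  assumes "complex_ext f x" "complex_ext g x" shows "complex_ext (\<lambda>y. f y + g y) x"
proof -
  obtain F G where F: "F analytic_on {complex_of_real x}" "\<forall>\<^sub>F y in nhds x. complex_of_real (f y) = F (complex_of_real y)"
    and G: "G analytic_on {complex_of_real x}" "\<forall>\<^sub>F y in nhds x. complex_of_real (g y) = G (complex_of_real y)"
    using assms unfolding complex_ext_def by blast
  from F(2) G(2) have "\<forall>\<^sub>F y in nhds x. complex_of_real (f y + g y) = F (complex_of_real y) + G (complex_of_real y)"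
    by eventually_elim simp
  with analytic_on_add[OF F(1) G(1)] show ?thesis by (rule complex_extI)
qed

lemma complex_ext_mult:
  assumes "complex_ext f x" "complex_ext g x" shows "complex_ext (\<lambda>y. f y * g y) x"
proof -
  obtain F G where F: "F analytic_on {complex_of_real x}" "\<forall>\<^sub>F y in nhds x. complex_of_real (f y) = F (complex_of_real y)"
    and G: "G analytic_on {complex_of_real x}" "\<forall>\<^sub>F y in nhds x. complex_of_real (g y) = G (complex_of_real y)"
    using assms unfolding complex_ext_def by blast
  from F(2) G(2) have "\<forall>\<^sub>F y in nhds x. complex_of_real (f y * g y) = F (complex_of_real y) * G (complex_of_real y)"
    by eventually_elim simp
  with analytic_on_mult[OF F(1) G(1)] show ?thesis by (rule complex_extI)
qed

lemma complex_ext_diff: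
  assumes "complex_ext f x" "complex_ext g x" shows "complex_ext (\<lambda>y. f y - g y) x"
  using complex_ext_add[OF assms(1) complex_ext_mult[OF complex_ext_const[of "- 1"] assms(2)]] by simp

lemma complex_ext_power:
  assumes "complex_ext f x" shows "complex_ext (\<lambda>y. f y ^ n) x"
  by (induction n) (auto intro: complex_ext_const complex_ext_mult assms)

lemma complex_ext_isCont:
  assumes "complex_ext f x" shows "isCont f x"
proof -
  obtain F where F: "F analytic_on {complex_of_real x}" "\<forall>\<^sub>F y in nhds x. complex_of_real (f y) = F (complex_of_real y)"
    using assms unfolding complex_ext_def by blast
  have "isCont F (complex_of_real x)" using F(1) by (simp add: analytic_at_imp_isCont)
  then have "isCont (\<lambda>y. F (complex_of_real y)) x"
    by (rule isCont_o2[OF isCont_of_real[OF continuous_ident]])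
  then have "isCont (\<lambda>y. Re (F (complex_of_real y))) x" by (rule continuous_Re)
  moreover have "\<forall>\<^sub>F y in nhds x. f y = Re (F (complex_of_real y))"
    using F(2) by eventually_elim (metis Re_complex_of_real)
  then have "isCont f x = isCont (\<lambda>y. Re (F (complex_of_real y))) x" by (rule isCont_cong)
  ultimately show ?thesis by simp
qed

lemma complex_ext_compose:
  assumes h: "complex_ext h x" and f: "complex_ext f (h x)" shows "complex_ext (\<lambda>y. f (h y)) x"
proof -
  obtain F where F: "F analytic_on {complex_of_real (h x)}" "\<forall>\<^sub>F y in nhds (h x). complex_of_real (f y) = F (complex_of_real y)"
    using f unfolding complex_ext_def by blast
  obtain H where H: "H analytic_on {complex_of_real x}" "\<forall>\<^sub>F y in nhds x. complex_of_real (h y) = H (complex_of_real y)"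
    using h unfolding complex_ext_def by blast
  have Hx: "H (complex_of_real x) = complex_of_real (h x)" using eventually_nhds_x_imp_x[OF H(2)] by simp
  have "(F \<circ> H) analytic_on {complex_of_real x}"
    by (rule analytic_on_compose[OF H(1)]) (use F(1) Hx in simp)
  moreover have "filterlim h (nhds (h x)) (nhds x)"
    using complex_ext_isCont[OF h] by (simp add: continuous_at tendsto_at_iff_tendsto_nhds)
  from eventually_compose_filterlim[OF F(2) this] H(2)
  have "\<forall>\<^sub>F y in nhds x. complex_of_real (f (h y)) = (F \<circ> H) (complex_of_real y)"
    by eventually_elim simp
  ultimately show ?thesis by (rule complex_extI)
qed

lemma complex_ext_ln:
  assumes "0 < x" shows "complex_ext ln x"
proof (rule complex_extI)
  show "Ln analytic_on {complex_of_real x}"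
    using analytic_on_ln[of "\<lambda>z. z" "{complex_of_real x}"] assms by simp
  show "\<forall>\<^sub>F y in nhds x. complex_of_real (ln y) = Ln (complex_of_real y)"
  proof -
    have "\<forall>\<^sub>F y in nhds x. y \<in> {0<..}" using assms by (intro eventually_nhds_in_open) auto
    then show ?thesis by eventually_elim (simp add: Ln_of_real)
  qed
qed

lemma complex_ext_sqrt:
  assumes "0 < x" shows "complex_ext sqrt x"
proof (rule complex_extI)
  show "csqrt analytic_on {complex_of_real x}"
    by (rule analytic_on_subset[OF analytic_on_csqrt]) (use assms in auto)
  show "\<forall>\<^sub>F y in nhds x. complex_of_real (sqrt y) = csqrt (complex_of_real y)"
  proof -
    have "\<forall>\<^sub>F y in nhds x. y \<in> {0<..}" using assms by (intro eventually_nhds_in_open) auto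
    then show ?thesis by eventually_elim (simp add: csqrt_of_real)
  qed
qed

lemma complex_ext_inverse:
  fixes x :: real
  assumes "x \<noteq> 0" shows "complex_ext inverse x"
proof (rule complex_extI)
  show "inverse analytic_on {complex_of_real x}"
    using analytic_on_inverse[of "\<lambda>z. z" "{complex_of_real x}"] assms by simp
qed simp

lemma complex_ext_divide:
  assumes "complex_ext f x" "complex_ext g x" "g x \<noteq> 0" shows "complex_ext (\<lambda>y. f y / g y) x"
  unfolding divide_inverse
  by (intro complex_ext_mult complex_ext_compose[of g x inverse] complex_ext_inverse assms)

lemmas complex_ext_intros = complex_ext_const complex_ext_ident complex_ext_add complex_ext_mult
  complex_ext_diff complex_ext_power complex_ext_divide

text \<open>The holomorphic extension either vanishes on a disc or has isolated zeros there; either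
  alternative restricts to the real line.\<close>

lemma complex_ext_isolated_zeros:
  assumes "complex_ext d x"
  shows "(\<forall>\<^sub>F y in nhds x. d y = 0) \<or> (\<forall>\<^sub>F y in at x. d y \<noteq> 0)"
proof -
  obtain g where g: "g analytic_on {complex_of_real x}" "\<forall>\<^sub>F y in nhds x. complex_of_real (d y) = g (complex_of_real y)"
    using assms unfolding complex_ext_def by blast
  obtain r where r: "r > 0" "g holomorphic_on ball (complex_of_real x) r"
    using g(1) by (auto simp: analytic_on_def)
  show ?thesis
  proof (cases "\<exists>\<beta>\<in>ball (complex_of_real x) r. g \<beta> \<noteq> 0")
    case True
    then obtain \<beta> where \<beta>: "\<beta> \<in> ball (complex_of_real x) r" "g \<beta> \<noteq> 0" by auto
    have "\<forall>\<^sub>F w in at (complex_of_real x). g w \<noteq> 0 \<and> w \<in> ball (complex_of_real x) r"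
      by (rule non_zero_neighbour_alt[OF r(2) _ _ _ \<beta>]) (use r in auto)
    moreover have "filterlim complex_of_real (at (complex_of_real x)) (at x)"
      by (auto simp: filterlim_at eventually_at_filter intro!: tendsto_intros)
    ultimately have "\<forall>\<^sub>F y in at x. g (complex_of_real y) \<noteq> 0 \<and> complex_of_real y \<in> ball (complex_of_real x) r"
      by (rule eventually_compose_filterlim)
    moreover have "\<forall>\<^sub>F y in at x. complex_of_real (d y) = g (complex_of_real y)"
      using g(2) by (auto simp: eventually_at_filter elim: eventually_mono)
    ultimately have "\<forall>\<^sub>F y in at x. d y \<noteq> 0" by eventually_elim auto
    then show ?thesis ..
  next
    case False
    have "\<forall>\<^sub>F y in nhds x. y \<in> ball x r" using r by (intro eventually_nhds_in_open) auto
    with g(2) have "\<forall>\<^sub>F y in nhds x. d y = 0"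
    proof eventually_elim
      case (elim y)
      then have "complex_of_real y \<in> ball (complex_of_real x) r"
        by (simp add: dist_norm flip: of_real_diff)
      then show ?case using False elim by simp
    qed
    then show ?thesis ..
  qed
qed

text \<open>The points near which \<open>d\<close> vanishes identically and those near which it has
  no other zero form two disjoint open sets covering the interval, which is connected.\<close>

lemma complex_ext_identity:
  assumes d: "\<And>x. a < x \<Longrightarrow> x < b \<Longrightarrow> complex_ext d x"
    and x0: "a < x0" "x0 < b" "\<forall>\<^sub>F y in nhds x0. d y = 0" and x: "a < x" "x < b"
  shows "d x = 0"
proof -
  define U where "U = {y \<in> {a<..<b}. \<forall>\<^sub>F z in nhds y. d z = 0}"
  define V where "V = {y \<in> {a<..<b}. \<forall>\<^sub>F z in at y. d z \<noteq> 0}"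
  have "open U" unfolding open_subopen[of U]
  proof
    fix y assume y: "y \<in> U"
    then obtain S where S: "open S" "y \<in> S" "\<forall>z\<in>S. d z = 0" by (auto simp: U_def eventually_nhds)
    have "\<forall>\<^sub>F z in nhds w. d z = 0" if "w \<in> S" for w using S that by (auto simp: eventually_nhds)
    then have "S \<inter> {a<..<b} \<subseteq> U" by (auto simp: U_def)
    moreover have "open (S \<inter> {a<..<b})" using S by (intro open_Int) auto
    moreover have "y \<in> S \<inter> {a<..<b}" using y S by (auto simp: U_def)
    ultimately show "\<exists>T. open T \<and> y \<in> T \<and> T \<subseteq> U" by blast
  qed
  moreover have "open V" unfolding open_subopen[of V]
  proof
    fix y assume y: "y \<in> V"
    then obtain S where S: "open S" "y \<in> S" "\<And>z. z \<in> S \<Longrightarrow> z \<noteq> y \<Longrightarrow> d z \<noteq> 0"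
      by (auto simp: V_def eventually_at_topological)
    have "S \<inter> {a<..<b} \<subseteq> V"
    proof
      fix w assume w: "w \<in> S \<inter> {a<..<b}"
      have "\<forall>\<^sub>F z in at w. d z \<noteq> 0"
      proof (cases "w = y")
        case True then show ?thesis using y by (simp add: V_def)
      next
        case False
        have "\<forall>\<^sub>F z in nhds w. z \<in> S - {y}" using S w False by (intro eventually_nhds_in_open open_delete) auto
        then have "\<forall>\<^sub>F z in nhds w. d z \<noteq> 0" by eventually_elim (use S(3) in auto)
        then show ?thesis by (auto simp: eventually_at_filter elim: eventually_mono)
      qed
      then show "w \<in> V" using w by (auto simp: V_def)
    qed
    moreover have "open (S \<inter> {a<..<b})" using S by (intro open_Int) auto
    moreover have "y \<in> S \<inter> {a<..<b}" using y S by (auto simp: V_def)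
    ultimately show "\<exists>T. open T \<and> y \<in> T \<and> T \<subseteq> V" by blast
  qed
  moreover have "{a<..<b} \<subseteq> U \<union> V"
  proof
    fix y assume "y \<in> {a<..<b}"
    then show "y \<in> U \<union> V" using complex_ext_isolated_zeros[OF d, of y] by (auto simp: U_def V_def)
  qed
  moreover have "U \<inter> V \<inter> {a<..<b} = {}"
  proof -
    have False if "y \<in> U" "y \<in> V" for y
    proof -
      have "\<forall>\<^sub>F z in at y. d z = 0" using that by (auto simp: U_def eventually_at_filter elim: eventually_mono)
      moreover have "\<forall>\<^sub>F z in at y. d z \<noteq> 0" using that by (auto simp: V_def)
      ultimately have "\<forall>\<^sub>F z in at y. False" by eventually_elim auto
      then show False by simp
    qed
    then show ?thesis by blast
  qed
  moreover have "x0 \<in> U" using x0 by (auto simp: U_def)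
  ultimately have "V \<inter> {a<..<b} = {}"
    using connectedD[OF connected_Ioo[of a b], of U V] x0 by auto
  moreover have "x \<in> {a<..<b}" using x by simp
  ultimately have "x \<in> U" using \<open>{a<..<b} \<subseteq> U \<union> V\<close> by blast
  then show ?thesis using eventually_nhds_x_imp_x by (auto simp: U_def)
qed

text \<open>
  The value of \<open>c\<close> at which the optimal tilt for the lower tail at level \<open>\<eta>\<close> has edge marginal \<open>x\<close>.
\<close>

definition act :: "real \<Rightarrow> real \<Rightarrow> real" where
  "act \<eta> x = sqrt (- x * ln x / (x ^ 3 - \<eta>))"

lemma
  assumes "0 < x" "x < 1" "\<eta> < x ^ 3"
  shows act_pos: "0 < act \<eta> x" and act_eq: "(act \<eta> x)\<^sup>2 * (x ^ 3 - \<eta>) = - x * ln x"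
    and complex_ext_act: "complex_ext (act \<eta>) x"
proof -
  have p: "0 < - x * ln x / (x ^ 3 - \<eta>)" using assms by (intro divide_pos_pos) (auto simp: mult_less_0_iff)
  then show "0 < act \<eta> x" unfolding act_def by simp
  show "(act \<eta> x)\<^sup>2 * (x ^ 3 - \<eta>) = - x * ln x" unfolding act_def using p assms by simp
  have "complex_ext (\<lambda>y. (- 1) * y * ln y / (y ^ 3 - \<eta>)) x"
    using assms by (intro complex_ext_intros complex_ext_ln) auto
  then have "complex_ext (\<lambda>y. sqrt ((- 1) * y * ln y / (y ^ 3 - \<eta>))) x"
    using p by (intro complex_ext_compose[of _ x sqrt] complex_ext_sqrt) auto
  then show "complex_ext (act \<eta>) x" by (simp add: act_def[abs_def])
qed

text \<open>Close to \<open>x = 1\<close> the value \<open>act \<eta> x\<close> is small and the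
  formula is known. Both sides are analytic in \<open>x\<close> along the curve, and working in
  \<open>x\<close> avoids inverting \<open>act\<close>. The parameter \<open>a\<close> cuts the
  curve off according to how far analyticity of \<open>phi\<close> is assumed.\<close>

theorem analytic_continuation_phi:
  assumes \<eta>: "0 \<le> \<eta>" "0 \<le> a" "a < 1" "\<eta> \<le> a ^ 3"
    and an: "\<And>y. a < y \<Longrightarrow> y < 1 \<Longrightarrow> 2 * (act \<eta> y)\<^sup>2 < exp 1 \<or> real_analytic_at (phi \<eta>) (act \<eta> y)"
    and x: "a < x" "x < 1"
  shows "phi \<eta> (act \<eta> x) = rate \<eta> (act \<eta> x) x"
proof -
  have cube: "\<eta> < y ^ 3" if "a < y" for y
    using \<eta> that by (intro order_le_less_trans[OF \<eta>(4)] power_strict_mono) auto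
  have near: "\<forall>\<^sub>F y in nhds z. phi \<eta> (act \<eta> y) - rate \<eta> (act \<eta> y) y = 0"
    if z: "a < z" "z < 1" "2 * (act \<eta> z)\<^sup>2 < exp 1" for z
  proof -
    have c: "isCont (act \<eta>) z" using z \<eta> cube by (intro complex_ext_isCont complex_ext_act) auto
    then have "(act \<eta> \<longlongrightarrow> act \<eta> z) (nhds z)" by (simp add: continuous_at tendsto_at_iff_tendsto_nhds)
    then have "((\<lambda>y. 2 * (act \<eta> y)\<^sup>2) \<longlongrightarrow> 2 * (act \<eta> z)\<^sup>2) (nhds z)" by (intro tendsto_intros)
    then have "\<forall>\<^sub>F y in nhds z. 2 * (act \<eta> y)\<^sup>2 < exp 1" using z by (intro order_tendstoD(2)) auto
    moreover have "\<forall>\<^sub>F y in nhds z. y \<in> {a<..<1}" using z by (intro eventually_nhds_in_open) auto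
    ultimately show ?thesis
    proof eventually_elim
      case (elim y)
      then have y: "0 < y" "y < 1" "\<eta> < y ^ 3" using \<eta> cube by auto
      show ?case using phi_eq_rate[OF act_pos[OF y] elim(1) \<eta>(1) y(1,2) act_eq[OF y]] by simp
    qed
  qed
  have ext_rate: "complex_ext (\<lambda>y. rate \<eta> (act \<eta> y) y) z" if "a < z" "z < 1" for z
    unfolding rate_def using that \<eta> cube
    by (intro complex_ext_intros complex_ext_ln complex_ext_act) auto
  have ext: "complex_ext (\<lambda>y. phi \<eta> (act \<eta> y) - rate \<eta> (act \<eta> y) y) z" if z: "a < z" "z < 1" for z
  proof (cases "2 * (act \<eta> z)\<^sup>2 < exp 1")
    case True
    from near[OF z True] have "\<forall>\<^sub>F y in nhds z. 0 = phi \<eta> (act \<eta> y) - rate \<eta> (act \<eta> y) y"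
      by eventually_elim simp
    with complex_ext_const[of 0] show ?thesis by (rule complex_ext_cong)
  next
    case False
    then have "real_analytic_at (phi \<eta>) (act \<eta> z)" using an z by auto
    then have "complex_ext (\<lambda>y. phi \<eta> (act \<eta> y)) z"
      by (intro complex_ext_compose[OF complex_ext_act real_analytic_imp_complex_ext]) (use z \<eta> cube in auto)
    then show ?thesis using ext_rate[OF z] by (rule complex_ext_diff)
  qed
  \<comment> \<open>\<open>act \<eta> 1 = 0\<close> because \<open>ln 1 = 0\<close>, so the
    small-\<open>c\<close> regime is entered close to 1.\<close>
  have "((\<lambda>y. 2 * (act \<eta> y)\<^sup>2) \<longlongrightarrow> 2 * (act \<eta> 1)\<^sup>2) (at_left 1)"
  proof -
    have "\<eta> < 1" using cube[of 1] \<eta> by simp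
    then have "isCont (\<lambda>y. 2 * (act \<eta> y)\<^sup>2) 1" unfolding act_def by (intro continuous_intros) auto
    then show ?thesis by (auto simp: continuous_at intro: filterlim_mono[OF _ order_refl at_le])
  qed
  then have "\<forall>\<^sub>F y in at_left 1. 2 * (act \<eta> y)\<^sup>2 < exp 1" by (rule order_tendstoD(2)) (simp add: act_def)
  moreover have "\<forall>\<^sub>F y in at_left 1. y \<in> {a<..<1}" using \<eta> by (intro eventually_at_left_real)
  ultimately have "\<forall>\<^sub>F y in at_left 1. 2 * (act \<eta> y)\<^sup>2 < exp 1 \<and> y \<in> {a<..<1}" by eventually_elim auto
  then obtain x0 where x0: "2 * (act \<eta> x0)\<^sup>2 < exp 1" "a < x0" "x0 < 1"
    using eventually_happens'[of "at_left (1 :: real)"] by (auto simp: trivial_limit_at_left_real)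
  have "phi \<eta> (act \<eta> x) - rate \<eta> (act \<eta> x) x = 0"
    by (rule complex_ext_identity[of a 1, OF ext x0(2,3) near[OF x0(2,3,1)] x])
  then show ?thesis by simp
qed

subsection \<open>Two-block lower bounds\<close>

definition inside :: "nat \<Rightarrow> nat set \<Rightarrow> bool" where
  "inside m e \<longleftrightarrow> e \<subseteq> {..<m} \<or> e \<inter> {..<m} = {}"

definition inner_edges :: "nat \<Rightarrow> nat set set" where
  "inner_edges n = {e \<in> complete_edges n. inside (n div 2) e}"

definition mono_triples :: "nat \<Rightarrow> nat set set" where
  "mono_triples n = {T \<in> vtriples n. inside (n div 2) T}"

lemma card_inside:
  assumes "m \<le> n" "k > 0"
  shows "card {e. e \<subseteq> {..<n} \<and> card e = k \<and> inside m e} = (m choose k) + ((n - m) choose k)"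
proof -
  have "{e. e \<subseteq> {..<n} \<and> card e = k \<and> inside m e} = {e. e \<subseteq> {..<m} \<and> card e = k} \<union> {e. e \<subseteq> {m..<n} \<and> card e = k}"
    using assms by (force simp: inside_def)
  moreover have "{e. e \<subseteq> {..<m} \<and> card e = k} \<inter> {e. e \<subseteq> {m..<n} \<and> card e = k} = {}"
  proof -
    have False if "e \<subseteq> {..<m}" "e \<subseteq> {m..<n}" "card e = k" for e
    proof -
      have "e = {}" using that by force
      then show False using that assms by simp
    qed
    then show ?thesis by blast
  qed
  moreover have "finite {e. e \<subseteq> A \<and> card e = k}" if "finite A" for A :: "nat set"
    using that by (rule finite_subset[rotated, OF finite_Pow_iff[THEN iffD2]]) auto
  ultimately show ?thesis using n_subsets[of "{..<m}" k] n_subsets[of "{m..<n}" k]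
    by (simp add: card_Un_disjoint)
qed

lemma card_inner_edges: "card (inner_edges n) = (n div 2 choose 2) + ((n - n div 2) choose 2)"
proof -
  have "inner_edges n = {e. e \<subseteq> {..<n} \<and> card e = 2 \<and> inside (n div 2) e}"
    by (auto simp: inner_edges_def complete_edges_def)
  then show ?thesis using card_inside[of "n div 2" n 2] by simp
qed

lemma card_mono_triples: "card (mono_triples n) = (n div 2 choose 3) + ((n - n div 2) choose 3)"
proof -
  have "mono_triples n = {e. e \<subseteq> {..<n} \<and> card e = 3 \<and> inside (n div 2) e}"
    by (auto simp: mono_triples_def vtriples_def)
  then show ?thesis using card_inside[of "n div 2" n 3] by simp
qed

lemma choose_limits:
  assumes "(\<lambda>n. real (m n) / real n) \<longlonglongrightarrow> l"
  shows "(\<lambda>n. real (m n choose 2) / real n ^ 2) \<longlonglongrightarrow> l ^ 2 / 2"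
    and "(\<lambda>n. real (m n choose 3) / real n ^ 3) \<longlonglongrightarrow> l ^ 3 / 6"
proof -
  have c2: "real (k choose 2) = real k * (real k - 1) / 2" for k
    by (simp add: binomial_gbinomial gbinomial_prod_rev numeral_2_eq_2 atLeast0_lessThan_Suc mult_ac)
  have c3: "real (k choose 3) = real k * (real k - 1) * (real k - 2) / 6" for k
    by (simp add: binomial_gbinomial gbinomial_prod_rev numeral_3_eq_3 atLeast0_lessThan_Suc mult_ac)
  have i: "(\<lambda>n. k / real n) \<longlonglongrightarrow> 0" for k :: real by real_asymp
  have "(\<lambda>n. (real (m n) / real n) * (real (m n) / real n - 1 / real n) / 2) \<longlonglongrightarrow> l * (l - 0) / 2"
    by (intro tendsto_intros assms i) auto
  moreover have "(real (m n) / real n) * (real (m n) / real n - 1 / real n) / 2 = real (m n choose 2) / real n ^ 2" for n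
    unfolding c2 by (cases "n = 0") (simp_all add: field_simps power2_eq_square)
  ultimately show "(\<lambda>n. real (m n choose 2) / real n ^ 2) \<longlonglongrightarrow> l ^ 2 / 2" by (simp add: power2_eq_square)
  have "(\<lambda>n. (real (m n) / real n) * (real (m n) / real n - 1 / real n) * (real (m n) / real n - 2 / real n) / 6)
    \<longlonglongrightarrow> l * (l - 0) * (l - 0) / 6"
    by (intro tendsto_intros assms i) auto
  moreover have "(real (m n) / real n) * (real (m n) / real n - 1 / real n) * (real (m n) / real n - 2 / real n) / 6
     = real (m n choose 3) / real n ^ 3" for n
    unfolding c3 by (cases "n = 0") (simp_all add: field_simps power3_eq_cube)
  ultimately show "(\<lambda>n. real (m n choose 3) / real n ^ 3) \<longlonglongrightarrow> l ^ 3 / 6" by (simp add: power3_eq_cube)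
qed

lemma half_limits:
  "(\<lambda>n. real (n div 2) / real n) \<longlonglongrightarrow> 1 / 2" "(\<lambda>n. real (n - n div 2) / real n) \<longlonglongrightarrow> 1 / 2"
  "(\<lambda>n. real n / real n) \<longlonglongrightarrow> 1"
proof -
  have b: "real n / 2 - 1 / 2 \<le> real (n div 2)" "real (n div 2) \<le> real n / 2" for n
  proof -
    have "n \<le> 2 * (n div 2) + 1" "2 * (n div 2) \<le> n" by presburger+
    then have "real n \<le> real (2 * (n div 2) + 1)" "real (2 * (n div 2)) \<le> real n" by (simp_all only: of_nat_le_iff)
    then show "real n / 2 - 1 / 2 \<le> real (n div 2)" "real (n div 2) \<le> real n / 2" by simp_all
  qed
  show one: "(\<lambda>n. real n / real n) \<longlonglongrightarrow> 1" by real_asymp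
  show h: "(\<lambda>n. real (n div 2) / real n) \<longlonglongrightarrow> 1 / 2"
  proof (rule tendsto_sandwich)
    show "(\<lambda>n. (real n / 2 - 1 / 2) / real n) \<longlonglongrightarrow> 1 / 2" "(\<lambda>n. (real n / 2) / real n) \<longlonglongrightarrow> 1 / 2" by real_asymp+
  qed (use b in \<open>auto intro!: always_eventually divide_right_mono\<close>)
  have "(\<lambda>n. real n / real n - real (n div 2) / real n) \<longlonglongrightarrow> 1 - 1 / 2" by (intro tendsto_intros one h)
  moreover have "real n / real n - real (n div 2) / real n = real (n - n div 2) / real n" for n
    by (simp only: of_nat_diff[OF div_le_dividend] diff_divide_distrib)
  ultimately show "(\<lambda>n. real (n - n div 2) / real n) \<longlonglongrightarrow> 1 / 2" by simp
qed

text \<open>Edges split evenly into inner and crossing ones, while a quarter of all triples lie in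
  one block. These proportions produce the density
  \<open>a * (a\<^sup>2 + 3 * b\<^sup>2) / 4\<close>.\<close>

lemma count_limits:
  "(\<lambda>n. real (card (inner_edges n)) / real n ^ 2) \<longlonglongrightarrow> 1 / 4"
  "(\<lambda>n. real (card (complete_edges n - inner_edges n)) / real n ^ 2) \<longlonglongrightarrow> 1 / 4"
  "(\<lambda>n. real (card (mono_triples n)) / real n ^ 3) \<longlonglongrightarrow> 1 / 24"
  "(\<lambda>n. real (card (vtriples n - mono_triples n)) / real n ^ 3) \<longlonglongrightarrow> 1 / 8"
  "(\<lambda>n. real (n choose 3) / real n ^ 3) \<longlonglongrightarrow> 1 / 6"
proof -
  note l1 = choose_limits[OF half_limits(1)] and l2 = choose_limits[OF half_limits(2)]
    and l3 = choose_limits[OF half_limits(3)]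
  show i: "(\<lambda>n. real (card (inner_edges n)) / real n ^ 2) \<longlonglongrightarrow> 1 / 4"
    using tendsto_add[OF l1(1) l2(1)] by (simp add: card_inner_edges add_divide_distrib power2_eq_square)
  show m: "(\<lambda>n. real (card (mono_triples n)) / real n ^ 3) \<longlonglongrightarrow> 1 / 24"
    using tendsto_add[OF l1(2) l2(2)] by (simp add: card_mono_triples add_divide_distrib power3_eq_cube)
  show "(\<lambda>n. real (n choose 3) / real n ^ 3) \<longlonglongrightarrow> 1 / 6" using l3(2) by simp
  have "real (card (complete_edges n - inner_edges n)) = real (n choose 2) - real (card (inner_edges n))" for n
  proof -
    have "inner_edges n \<subseteq> complete_edges n" by (auto simp: inner_edges_def)
    then have "card (complete_edges n - inner_edges n) = card (complete_edges n) - card (inner_edges n)"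
      "card (inner_edges n) \<le> card (complete_edges n)"
      using finite_complete_edges by (auto intro: card_Diff_subset card_mono finite_subset)
    then show ?thesis by (simp add: card_complete_edges)
  qed
  then show "(\<lambda>n. real (card (complete_edges n - inner_edges n)) / real n ^ 2) \<longlonglongrightarrow> 1 / 4"
    using tendsto_diff[OF l3(1) i] by (simp add: diff_divide_distrib)
  have "real (card (vtriples n - mono_triples n)) = real (n choose 3) - real (card (mono_triples n))" for n
  proof -
    have "mono_triples n \<subseteq> vtriples n" by (auto simp: mono_triples_def)
    then have "card (vtriples n - mono_triples n) = card (vtriples n) - card (mono_triples n)"
      "card (mono_triples n) \<le> card (vtriples n)"
      using finite_vtriples by (auto intro: card_Diff_subset card_mono finite_subset)
    then show ?thesis by (simp add: card_vtriples)
  qed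
  then show "(\<lambda>n. real (card (vtriples n - mono_triples n)) / real n ^ 3) \<longlonglongrightarrow> 1 / 8"
    using tendsto_diff[OF l3(2) m] by (simp add: diff_divide_distrib)
qed

text \<open>A triple split between the blocks has exactly one edge inside a block and two
  across.\<close>

lemma prod_tri_edges:
  assumes "T \<in> vtriples n"
  shows "(\<Prod>e\<in>tri_edges T. if inside m e then \<alpha> else \<beta>) = (if inside m T then \<alpha> ^ 3 else \<alpha> * \<beta>\<^sup>2 :: real)"
proof -
  obtain u v w where T: "T = {u, v, w}" "u \<noteq> v" "v \<noteq> w" "u \<noteq> w"
    using assms unfolding vtriples_def card_3_iff by auto
  have "tri_edges T = {{u, v}, {v, w}, {u, w}}"
  proof (intro equalityI subsetI)
    fix e assume "e \<in> tri_edges T"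
    then obtain x y where "e = {x, y}" "x \<noteq> y" "x \<in> T" "y \<in> T"
      unfolding tri_edges_def card_2_iff by auto
    then show "e \<in> {{u, v}, {v, w}, {u, w}}" unfolding T by auto
  qed (use T in \<open>auto simp: tri_edges_def\<close>)
  moreover have "{u, v} \<noteq> {v, w}" "{u, v} \<noteq> {u, w}" "{v, w} \<noteq> {u, w}" using T by (auto simp: doubleton_eq_iff)
  ultimately have "(\<Prod>e\<in>tri_edges T. if inside m e then \<alpha> else \<beta>)
     = (if inside m {u, v} then \<alpha> else \<beta>) * (if inside m {v, w} then \<alpha> else \<beta>) * (if inside m {u, w} then \<alpha> else \<beta>)"
    by (simp add: mult_ac)
  also have "\<dots> = (if inside m T then \<alpha> ^ 3 else \<alpha> * \<beta>\<^sup>2)"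
    unfolding T inside_def by (auto simp: power2_eq_square power3_eq_cube)
  finally show ?thesis .
qed

text \<open>\<open>real_of_ereal\<close> sends infinite values to 0, so the lower limit is also
  bounded above, by 0, before converting.\<close>

lemma phi_geI:
  assumes c: "0 < c" and \<eta>: "0 \<le> \<eta>"
    and ev: "\<And>r. r < K \<Longrightarrow> \<forall>\<^sub>F n in sequentially. r < ln (lower_tail_prob \<eta> n (c / sqrt n)) / real n powr (3/2)"
  shows "K \<le> phi \<eta> c"
proof -
  define s where "s n = ln (lower_tail_prob \<eta> n (c / sqrt n)) / real n powr (3/2)" for n
  \<comment> \<open>Probability 0 is included, where \<open>ln 0 = 0\<close>.\<close>
  have ln0: "ln x \<le> 0" if "0 \<le> x" "x \<le> 1" for x :: real using that by (cases "x = 0") auto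
  have "s n \<le> 0" for n
    unfolding s_def lower_tail_prob_def by (intro divide_nonpos_nonneg ln0) auto
  then have up: "liminf (\<lambda>n. ereal (s n)) \<le> 0"
    by (intro Liminf_le) (auto simp: zero_ereal_def)
  have low: "ereal K \<le> liminf (\<lambda>n. ereal (s n))"
    unfolding le_Liminf_iff
  proof (intro allI impI)
    fix y assume "y < ereal K"
    then show "\<forall>\<^sub>F n in sequentially. y < ereal (s n)" using ev by (cases y) (auto simp: s_def)
  qed
  from up low show ?thesis unfolding phi_def s_def[symmetric]
    by (cases "liminf (\<lambda>n. ereal (s n))") auto
qed

text \<open>To first order as \<open>p\<close> tends to 0, the relative entropy of
  Bernoulli(\<open>u * p\<close>) with respect to Bernoulli(\<open>p\<close>) is \<open>p\<close>
  times this. It is the \<open>h\<close> of Zhao's variational problem.\<close>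

definition entropy_cost :: "real \<Rightarrow> real" where
  "entropy_cost u = u * ln u - u + 1"

text \<open>
  The factor contributed by one edge to the exponential moment of the log-likelihood ratio when the
  edge probability is changed from \<open>p\<close> to \<open>\<alpha> p\<close>.
\<close>

definition edge_moment :: "real \<Rightarrow> real \<Rightarrow> real \<Rightarrow> real" where
  "edge_moment \<theta> \<alpha> p = \<alpha> * p * exp (\<theta> * ln \<alpha>) + (1 - \<alpha> * p) * exp (\<theta> * ln ((1 - \<alpha> * p) / (1 - p)))"

text \<open>Change to the product measure with edge probabilities \<open>\<alpha> e * p\<close>.
  Under it Markov's inequality controls the event of too many triangles and a Chernoff bound the
  event that the log-likelihood ratio exceeds \<open>L\<close>; off both events the change of
  measure costs at most a factor \<open>exp (- L)\<close>.\<close>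

lemma tilted_inequality:
  fixes \<pi> :: "nat set \<Rightarrow> real"
  assumes p: "0 < p" "p < 1" and \<pi>: "\<And>e. e \<in> complete_edges n \<Longrightarrow> 0 < \<alpha> e \<and> \<alpha> e * p < 1" and \<theta>: "0 \<le> \<theta>"
    and k: "0 < k" "k = \<eta> * (real (n choose 3) * p ^ 3)"
  shows "exp (- L) * (1 - (\<Sum>T\<in>vtriples n. \<Prod>e\<in>tri_edges T. \<alpha> e * p) / k
      - exp (- \<theta> * L) * (\<Prod>e\<in>complete_edges n. edge_moment \<theta> (\<alpha> e) p)) \<le> lower_tail_prob \<eta> n p"
proof -
  let ?E = "complete_edges n"
  define \<nu> where "\<nu> = gprob ?E (\<lambda>e. \<alpha> e * p)"
  define l where "l G = (\<Sum>e\<in>G. ln (\<alpha> e)) + (\<Sum>e\<in>?E - G. ln ((1 - \<alpha> e * p) / (1 - p)))" for G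
  have P: "gprob ?E (\<lambda>_. p) G = \<nu> G * exp (- l G)" if "G \<subseteq> ?E" for G
  proof -
    have fin: "finite G" "finite (?E - G)" using that finite_complete_edges by (auto intro: finite_subset)
    have "(\<Prod>e\<in>G. \<alpha> e * p) * exp (- (\<Sum>e\<in>G. ln (\<alpha> e))) = (\<Prod>e\<in>G. \<alpha> e * p * exp (- ln (\<alpha> e)))"
      using fin by (simp add: prod.distrib exp_sum flip: sum_negf)
    also have "\<dots> = (\<Prod>e\<in>G. p)"
    proof (rule prod.cong[OF refl])
      fix e assume "e \<in> G"
      then have "0 < \<alpha> e" using that \<pi> by auto
      then show "\<alpha> e * p * exp (- ln (\<alpha> e)) = p" by (simp add: exp_minus)
    qed
    finally have 1: "(\<Prod>e\<in>G. \<alpha> e * p) * exp (- (\<Sum>e\<in>G. ln (\<alpha> e))) = (\<Prod>e\<in>G. p)" .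
    have "(\<Prod>e\<in>?E - G. 1 - \<alpha> e * p) * exp (- (\<Sum>e\<in>?E - G. ln ((1 - \<alpha> e * p) / (1 - p))))
       = (\<Prod>e\<in>?E - G. (1 - \<alpha> e * p) * exp (- ln ((1 - \<alpha> e * p) / (1 - p))))"
      using fin by (simp add: prod.distrib exp_sum flip: sum_negf)
    also have "\<dots> = (\<Prod>e\<in>?E - G. 1 - p)"
    proof (rule prod.cong[OF refl])
      fix e assume "e \<in> ?E - G"
      then have pos: "0 < 1 - \<alpha> e * p" using \<pi>[of e] by simp
      then have "0 < (1 - \<alpha> e * p) / (1 - p)" using p by (intro divide_pos_pos) auto
      then have "exp (- ln ((1 - \<alpha> e * p) / (1 - p))) = (1 - p) / (1 - \<alpha> e * p)"
        by (simp only: exp_minus exp_ln inverse_divide)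
      then show "(1 - \<alpha> e * p) * exp (- ln ((1 - \<alpha> e * p) / (1 - p))) = 1 - p"
        using pos by simp
    qed
    finally have 2: "(\<Prod>e\<in>?E - G. 1 - \<alpha> e * p) * exp (- (\<Sum>e\<in>?E - G. ln ((1 - \<alpha> e * p) / (1 - p)))) = (\<Prod>e\<in>?E - G. 1 - p)" .
    have "exp (- l G) = exp (- (\<Sum>e\<in>G. ln (\<alpha> e))) * exp (- (\<Sum>e\<in>?E - G. ln ((1 - \<alpha> e * p) / (1 - p))))"
      unfolding l_def by (simp flip: exp_add)
    then have "\<nu> G * exp (- l G) = ((\<Prod>e\<in>G. \<alpha> e * p) * exp (- (\<Sum>e\<in>G. ln (\<alpha> e)))) *
       ((\<Prod>e\<in>?E - G. 1 - \<alpha> e * p) * exp (- (\<Sum>e\<in>?E - G. ln ((1 - \<alpha> e * p) / (1 - p)))))"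
      by (simp only: \<nu>_def gprob_def mult_ac)
    then show ?thesis unfolding 1 2 gprob_def by simp
  qed
  have \<nu>0: "0 \<le> \<nu> G" if "G \<subseteq> ?E" for G
    unfolding \<nu>_def using that \<pi> p by (intro gprob_nonneg) (auto intro: less_imp_le)
  have "(\<Sum>G\<in>Pow ?E. \<nu> G * exp (\<theta> * l G)) = (\<Sum>G\<in>Pow ?E. \<nu> G *
      ((\<Prod>e\<in>G. exp (\<theta> * ln (\<alpha> e))) * (\<Prod>e\<in>?E - G. exp (\<theta> * ln ((1 - \<alpha> e * p) / (1 - p))))))"
  proof (rule sum.cong[OF refl])
    fix G assume "G \<in> Pow ?E"
    then have "finite G" "finite (?E - G)" using finite_complete_edges by (auto intro: finite_subset)
    then show "\<nu> G * exp (\<theta> * l G) = \<nu> G *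
      ((\<Prod>e\<in>G. exp (\<theta> * ln (\<alpha> e))) * (\<Prod>e\<in>?E - G. exp (\<theta> * ln ((1 - \<alpha> e * p) / (1 - p)))))"
      by (simp add: l_def distrib_left exp_add exp_sum sum_distrib_left)
  qed
  also have "\<dots> = (\<Prod>e\<in>?E. edge_moment \<theta> (\<alpha> e) p)"
    unfolding \<nu>_def sum_gprob_prod[OF finite_complete_edges] edge_moment_def ..
  finally have mom: "(\<Sum>G\<in>Pow ?E. \<nu> G * exp (\<theta> * l G)) = (\<Prod>e\<in>?E. edge_moment \<theta> (\<alpha> e) p)" .
  have "exp (- L) * (1 - (\<Sum>T\<in>vtriples n. \<Prod>e\<in>tri_edges T. \<alpha> e * p) / k
      - exp (- \<theta> * L) * (\<Prod>e\<in>?E. edge_moment \<theta> (\<alpha> e) p))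
    = (\<Sum>G\<in>Pow ?E. exp (- L) * (\<nu> G * (1 - real (triangle_count n G) / k - exp (- \<theta> * L) * exp (\<theta> * l G))))"
  proof -
    have one: "(\<Sum>G\<in>Pow ?E. \<nu> G) = 1" unfolding \<nu>_def by (rule sum_gprob[OF finite_complete_edges])
    have "(\<Sum>G\<in>Pow ?E. exp (- L) * (\<nu> G * (1 - real (triangle_count n G) / k - exp (- \<theta> * L) * exp (\<theta> * l G))))
      = exp (- L) * ((\<Sum>G\<in>Pow ?E. \<nu> G) - (\<Sum>G\<in>Pow ?E. \<nu> G * real (triangle_count n G)) / k
        - exp (- \<theta> * L) * (\<Sum>G\<in>Pow ?E. \<nu> G * exp (\<theta> * l G)))"
      by (simp add: right_diff_distrib sum_subtractf sum_distrib_left sum_divide_distrib mult_ac)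
    then show ?thesis unfolding one mom unfolding \<nu>_def sum_gprob_triangle_count by simp
  qed
  also have "\<dots> \<le> (\<Sum>G\<in>Pow ?E. gprob ?E (\<lambda>_. p) G * (if real (triangle_count n G) \<le> k then 1 else 0))"
  proof (rule sum_mono)
    fix G assume "G \<in> Pow ?E"
    then have G: "G \<subseteq> ?E" by simp
    define X where "X = 1 - real (triangle_count n G) / k - exp (- \<theta> * L) * exp (\<theta> * l G)"
    have nn: "0 \<le> real (triangle_count n G) / k" "0 \<le> exp (- \<theta> * L) * exp (\<theta> * l G)" using k(1) by auto
    then have X1: "X \<le> 1" unfolding X_def by linarith
    have "exp (- L) * (\<nu> G * X) \<le> \<nu> G * exp (- l G) * (if real (triangle_count n G) \<le> k then 1 else 0)"
    proof (cases "real (triangle_count n G) \<le> k \<and> l G \<le> L")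
      case True
      have "exp (- L) * (\<nu> G * X) \<le> exp (- L) * (\<nu> G * 1)"
        using X1 \<nu>0[OF G] by (intro mult_left_mono) auto
      also have "\<dots> \<le> exp (- l G) * (\<nu> G * 1)"
        using True \<nu>0[OF G] by (intro mult_right_mono) auto
      finally have "exp (- L) * (\<nu> G * X) \<le> exp (- l G) * (\<nu> G * 1)" .
      then show ?thesis using True by (simp add: mult_ac)
    next
      case False
      \<comment> \<open>Either failure makes one of the two subtracted terms at least 1.\<close>
      have "X \<le> 0"
      proof (cases "real (triangle_count n G) \<le> k")
        case True
        then have "\<theta> * L \<le> \<theta> * l G" using False \<theta> by (intro mult_left_mono) auto
        then have "1 \<le> exp (- \<theta> * L) * exp (\<theta> * l G)" by (simp flip: exp_add)
        then show ?thesis using nn(1) unfolding X_def by linarith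
      next
        case f: False
        then have "1 \<le> real (triangle_count n G) / k" using k by simp
        then show ?thesis using nn(2) unfolding X_def by linarith
      qed
      then have "exp (- L) * (\<nu> G * X) \<le> 0" using \<nu>0[OF G] by (intro mult_nonneg_nonpos) auto
      also have "0 \<le> \<nu> G * exp (- l G) * (if real (triangle_count n G) \<le> k then 1 else 0)"
        using \<nu>0[OF G] by simp
      finally show ?thesis .
    qed
    then show "exp (- L) * (\<nu> G * (1 - real (triangle_count n G) / k - exp (- \<theta> * L) * exp (\<theta> * l G)))
       \<le> gprob ?E (\<lambda>_. p) G * (if real (triangle_count n G) \<le> k then 1 else 0)"
      unfolding X_def P[OF G] .
  qed
  also have "\<dots> = lower_tail_prob \<eta> n p"
    using p by (subst lower_tail_prob_eq) (auto simp: k)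
  finally show ?thesis .
qed

text \<open>The moment equals 1 at \<open>p = 0\<close>. The derivative found here has in turn the
  \<open>\<theta>\<close>-derivative \<open>entropy_cost \<alpha>\<close> at
  \<open>\<theta> = 0\<close>, which is how the entropy enters the bound.\<close>

lemma edge_moment_has_derivative:
  assumes "0 < \<alpha>"
  shows "(edge_moment \<theta> \<alpha> has_real_derivative \<alpha> * exp (\<theta> * ln \<alpha>) - \<alpha> - \<theta> * (\<alpha> - 1)) (at 0)"
  unfolding edge_moment_def[abs_def]
  by (auto intro!: derivative_eq_intros simp: algebra_simps)

lemma edge_moment_limit:
  assumes "0 < \<alpha>" "0 < c"
  shows "(\<lambda>n. sqrt n * (edge_moment \<theta> \<alpha> (c / sqrt n) - 1)) \<longlonglongrightarrow> c * (\<alpha> * exp (\<theta> * ln \<alpha>) - \<alpha> - \<theta> * (\<alpha> - 1))"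
proof -
  have "(\<lambda>h. (edge_moment \<theta> \<alpha> (0 + h) - edge_moment \<theta> \<alpha> 0) / h) \<midarrow>0\<rightarrow> \<alpha> * exp (\<theta> * ln \<alpha>) - \<alpha> - \<theta> * (\<alpha> - 1)"
    using edge_moment_has_derivative[OF assms(1), of \<theta>] by (simp only: DERIV_def)
  moreover have "filterlim (\<lambda>n. c / sqrt (real n)) (at 0) sequentially"
    using assms(2) by real_asymp
  ultimately have "(\<lambda>n. (edge_moment \<theta> \<alpha> (0 + c / sqrt n) - edge_moment \<theta> \<alpha> 0) / (c / sqrt n)) \<longlonglongrightarrow> \<alpha> * exp (\<theta> * ln \<alpha>) - \<alpha> - \<theta> * (\<alpha> - 1)"
    by (rule filterlim_compose)
  then have "(\<lambda>n. c * ((edge_moment \<theta> \<alpha> (0 + c / sqrt n) - edge_moment \<theta> \<alpha> 0) / (c / sqrt n))) \<longlonglongrightarrow> c * (\<alpha> * exp (\<theta> * ln \<alpha>) - \<alpha> - \<theta> * (\<alpha> - 1))"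
    by (intro tendsto_intros)
  moreover have "edge_moment \<theta> \<alpha> 0 = 1" by (simp add: edge_moment_def)
  ultimately show ?thesis using assms(2) by (simp add: mult.commute)
qed

text \<open>There are about \<open>n\<^sup>2 / 4\<close> edges of either kind, so the log-likelihood
  ratio is typically \<open>c * (entropy_cost a + entropy_cost b) / 4\<close> in units of
  \<open>n powr (3/2)\<close>. Strictness of the density assumption leaves a probability bounded
  away from 0, which the exponential scale does not see.\<close>

theorem two_block_lower_bound:
  assumes c: "0 < c" and a: "0 < a" and b: "0 < b" and \<eta>: "a * (a\<^sup>2 + 3 * b\<^sup>2) / 4 < \<eta>"
  shows "- c * (entropy_cost a + entropy_cost b) / 4 \<le> phi \<eta> c"
proof (rule phi_geI)
  have \<eta>0: "0 < \<eta>" using a by (intro order_less_trans[OF _ \<eta>]) (simp add: add_pos_nonneg)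
  then show "0 \<le> \<eta>" by simp
  fix r assume r: "r < - c * (entropy_cost a + entropy_cost b) / 4"
  then have "c * (entropy_cost a + entropy_cost b) / 4 < - r" by (simp add: field_simps)
  then obtain \<Lambda> where \<Lambda>: "c * (entropy_cost a + entropy_cost b) / 4 < \<Lambda>" "\<Lambda> < - r" using dense by blast
  define \<kappa> where "\<kappa> \<theta> \<alpha> = \<alpha> * exp (\<theta> * ln \<alpha>) - \<alpha> - \<theta> * (\<alpha> - 1)" for \<theta> \<alpha> :: real
  \<comment> \<open>The exponent of the Chernoff bound: it vanishes at 0 with negative slope, so
    some small positive \<open>\<theta>\<close> makes it negative.\<close>
  define J where "J \<theta> = c / 4 * (\<kappa> \<theta> a + \<kappa> \<theta> b) - \<Lambda> * \<theta>" for \<theta>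
  have "(J has_real_derivative c * (entropy_cost a + entropy_cost b) / 4 - \<Lambda>) (at 0)"
    unfolding J_def[abs_def] \<kappa>_def entropy_cost_def
    by (auto intro!: derivative_eq_intros simp: algebra_simps)
  from DERIV_neg_dec_right[OF this] \<Lambda>(1) obtain d where d: "d > 0" "\<forall>h>0. h < d \<longrightarrow> J (0 + h) < J 0" by auto
  define \<theta> where "\<theta> = d / 2"
  have \<theta>: "0 < \<theta>" using d by (simp add: \<theta>_def)
  have "J (0 + \<theta>) < J 0" using d by (simp add: \<theta>_def)
  then have J\<theta>: "c / 4 * (\<kappa> \<theta> a + \<kappa> \<theta> b) < \<Lambda> * \<theta>" by (simp add: J_def \<kappa>_def)
  define p where "p n = c / sqrt (real n)" for n :: nat
  define N where "N n = real n powr (3/2)" for n :: nat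
  define \<alpha> where "\<alpha> n e = (if inside (n div 2) e then a else b)" for n and e :: "nat set"
  define k where "k n = \<eta> * (real (n choose 3) * p n ^ 3)" for n
  define S where "S n = (\<Sum>T\<in>vtriples n. \<Prod>e\<in>tri_edges T. \<alpha> n e * p n)" for n
  define q where "q n = real (card (inner_edges n)) / real n ^ 2 * (sqrt n * (edge_moment \<theta> a (p n) - 1))
     + real (card (complete_edges n - inner_edges n)) / real n ^ 2 * (sqrt n * (edge_moment \<theta> b (p n) - 1))" for n
  have Ntop: "filterlim N at_top sequentially" unfolding N_def by real_asymp
  have q_lim: "q \<longlonglongrightarrow> 1 / 4 * (c * \<kappa> \<theta> a) + 1 / 4 * (c * \<kappa> \<theta> b)"
    unfolding q_def[abs_def] p_def \<kappa>_def
    by (intro tendsto_intros count_limits edge_moment_limit a b c)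
  have S_eq: "S n = (a ^ 3 * real (card (mono_triples n)) + a * b\<^sup>2 * real (card (vtriples n - mono_triples n))) * p n ^ 3" for n
  proof -
    have "S n = (\<Sum>T\<in>vtriples n. (if inside (n div 2) T then a ^ 3 else a * b\<^sup>2) * p n ^ 3)"
      unfolding S_def
    proof (rule sum.cong[OF refl])
      fix T assume T: "T \<in> vtriples n"
      have "(\<Prod>e\<in>tri_edges T. \<alpha> n e * p n) = (\<Prod>e\<in>tri_edges T. \<alpha> n e) * p n ^ 3"
        using T card_tri_edges by (simp add: prod.distrib vtriples_def)
      then show "(\<Prod>e\<in>tri_edges T. \<alpha> n e * p n) = (if inside (n div 2) T then a ^ 3 else a * b\<^sup>2) * p n ^ 3"
        unfolding \<alpha>_def prod_tri_edges[OF T] .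
    qed
    also have "\<dots> = (\<Sum>T\<in>vtriples n. if inside (n div 2) T then a ^ 3 else a * b\<^sup>2) * p n ^ 3"
      by (simp add: sum_distrib_right)
    also have "(\<Sum>T\<in>vtriples n. if inside (n div 2) T then a ^ 3 else a * b\<^sup>2)
       = a ^ 3 * real (card (mono_triples n)) + a * b\<^sup>2 * real (card (vtriples n - mono_triples n))"
    proof -
      have "vtriples n \<inter> {T. inside (n div 2) T} = mono_triples n"
        "vtriples n \<inter> - {T. inside (n div 2) T} = vtriples n - mono_triples n" by (auto simp: mono_triples_def)
      then show ?thesis using finite_vtriples by (simp add: sum.If_cases mult.commute)
    qed
    finally show ?thesis .
  qed
  have ev_p: "\<forall>\<^sub>F n in sequentially. 0 < p n \<and> p n < 1 \<and> a * p n < 1 \<and> b * p n < 1"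
  proof -
    have "\<forall>\<^sub>F n in sequentially. 0 < p n" "\<forall>\<^sub>F n in sequentially. p n < 1"
      "\<forall>\<^sub>F n in sequentially. a * p n < 1" "\<forall>\<^sub>F n in sequentially. b * p n < 1"
      unfolding p_def using c a b by real_asymp+
    then show ?thesis by eventually_elim auto
  qed
  \<comment> \<open>The limit of the Markov quotient of expected to allowed triangles.\<close>
  define \<rho> where "\<rho> = (a ^ 3 / 24 + a * b\<^sup>2 / 8) / (\<eta> / 6)"
  have "a ^ 3 / 24 + a * b\<^sup>2 / 8 = a * (a\<^sup>2 + 3 * b\<^sup>2) / 4 / 6"
    by (simp add: field_simps power2_eq_square power3_eq_cube)
  then have "\<rho> = a * (a\<^sup>2 + 3 * b\<^sup>2) / 4 / 6 / (\<eta> / 6)" unfolding \<rho>_def by (simp only:)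
  then have "\<rho> = a * (a\<^sup>2 + 3 * b\<^sup>2) / 4 / \<eta>" by simp
  then have \<rho>1: "\<rho> < 1" using \<eta> \<eta>0 by simp
  have "(\<lambda>n. (a ^ 3 * (real (card (mono_triples n)) / real n ^ 3) + a * b\<^sup>2 * (real (card (vtriples n - mono_triples n)) / real n ^ 3))
      / (\<eta> * (real (n choose 3) / real n ^ 3))) \<longlonglongrightarrow> (a ^ 3 * (1 / 24) + a * b\<^sup>2 * (1 / 8)) / (\<eta> * (1 / 6))"
    using \<eta>0 by (intro tendsto_intros count_limits) auto
  moreover have "\<forall>\<^sub>F n in sequentially. (a ^ 3 * (real (card (mono_triples n)) / real n ^ 3) + a * b\<^sup>2 * (real (card (vtriples n - mono_triples n)) / real n ^ 3))
      / (\<eta> * (real (n choose 3) / real n ^ 3)) = S n / k n"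
    using ev_p eventually_gt_at_top[of 0]
  proof eventually_elim
    case (elim n)
    have "(a ^ 3 * (real (card (mono_triples n)) / real n ^ 3) + a * b\<^sup>2 * (real (card (vtriples n - mono_triples n)) / real n ^ 3))
      = (a ^ 3 * real (card (mono_triples n)) + a * b\<^sup>2 * real (card (vtriples n - mono_triples n))) / real n ^ 3"
      by (simp add: add_divide_distrib)
    moreover have "\<eta> * (real (n choose 3) / real n ^ 3) = \<eta> * real (n choose 3) / real n ^ 3" by simp
    ultimately show ?case using elim unfolding S_eq k_def by simp
  qed
  ultimately have S_lim: "(\<lambda>n. S n / k n) \<longlonglongrightarrow> \<rho>"
    unfolding \<rho>_def by (rule Lim_transform_eventually[THEN tendsto_eq_rhs]) simp
  define G where "G n = exp (- \<theta> * (\<Lambda> * N n)) * (\<Prod>e\<in>complete_edges n. edge_moment \<theta> (\<alpha> n e) (p n))" for n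
  have G_lim: "G \<longlonglongrightarrow> 0"
  proof (rule tendsto_sandwich)
    show "(\<lambda>n. 0) \<longlonglongrightarrow> (0 :: real)" by simp
    have nn: "0 \<le> edge_moment \<theta> (\<alpha> n e) (p n)" if "0 < p n" "p n < 1" "a * p n < 1" "b * p n < 1" for n e
      unfolding edge_moment_def \<alpha>_def using that a b by auto
    show "\<forall>\<^sub>F n in sequentially. 0 \<le> G n"
      using ev_p by eventually_elim (auto simp: G_def intro!: mult_nonneg_nonneg prod_nonneg nn)
    show "\<forall>\<^sub>F n in sequentially. G n \<le> exp ((q n - \<Lambda> * \<theta>) * N n)"
      using ev_p eventually_gt_at_top[of 0]
    proof eventually_elim
      case (elim n)
      \<comment> \<open>The bound \<open>y \<le> exp (y - 1)\<close> turns the product over edges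
        into the exponential of a sum.\<close>
      have "(\<Prod>e\<in>complete_edges n. edge_moment \<theta> (\<alpha> n e) (p n)) \<le> (\<Prod>e\<in>complete_edges n. exp (edge_moment \<theta> (\<alpha> n e) (p n) - 1))"
      proof (rule prod_mono)
        fix e assume "e \<in> complete_edges n"
        show "0 \<le> edge_moment \<theta> (\<alpha> n e) (p n) \<and> edge_moment \<theta> (\<alpha> n e) (p n) \<le> exp (edge_moment \<theta> (\<alpha> n e) (p n) - 1)"
          using nn[of n e] elim exp_ge_add_one_self[of "edge_moment \<theta> (\<alpha> n e) (p n) - 1"] by simp
      qed
      also have "\<dots> = exp (\<Sum>e\<in>complete_edges n. edge_moment \<theta> (\<alpha> n e) (p n) - 1)"
        using finite_complete_edges by (simp add: exp_sum)
      also have "(\<Sum>e\<in>complete_edges n. edge_moment \<theta> (\<alpha> n e) (p n) - 1)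
         = (\<Sum>e\<in>complete_edges n. if inside (n div 2) e then edge_moment \<theta> a (p n) - 1 else edge_moment \<theta> b (p n) - 1)"
        by (intro sum.cong) (auto simp: \<alpha>_def)
      also have "\<dots> = real (card (inner_edges n)) * (edge_moment \<theta> a (p n) - 1)
          + real (card (complete_edges n - inner_edges n)) * (edge_moment \<theta> b (p n) - 1)"
      proof -
        have "complete_edges n \<inter> {e. inside (n div 2) e} = inner_edges n"
          "complete_edges n \<inter> - {e. inside (n div 2) e} = complete_edges n - inner_edges n" by (auto simp: inner_edges_def)
        then show ?thesis using finite_complete_edges by (simp add: sum.If_cases)
      qed
      also have "\<dots> = q n * N n"
      proof -
        have "N n * sqrt n = real n ^ 2"
        proof -
          have "sqrt n = real n powr (1/2)" by (simp add: powr_half_sqrt)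
          then show ?thesis using elim unfolding N_def by (simp flip: powr_add powr_numeral)
        qed
        then have "sqrt n * N n / real n ^ 2 = 1" using elim by (simp add: mult.commute)
        then have "x / real n ^ 2 * (sqrt n * y) * N n = x * y" for x y :: real
          by (metis (no_types, opaque_lifting) mult.assoc mult.commute mult_1 times_divide_eq_left)
        then show ?thesis by (simp add: q_def distrib_right)
      qed
      finally have "(\<Prod>e\<in>complete_edges n. edge_moment \<theta> (\<alpha> n e) (p n)) \<le> exp (q n * N n)" .
      then have "G n \<le> exp (- \<theta> * (\<Lambda> * N n)) * exp (q n * N n)" unfolding G_def by (intro mult_left_mono) auto
      also have "\<dots> = exp ((q n - \<Lambda> * \<theta>) * N n)" by (simp add: algebra_simps flip: exp_add)
      finally show ?case .
    qed
    have "(\<lambda>n. q n - \<Lambda> * \<theta>) \<longlonglongrightarrow> 1 / 4 * (c * \<kappa> \<theta> a) + 1 / 4 * (c * \<kappa> \<theta> b) - \<Lambda> * \<theta>"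
      by (intro tendsto_intros q_lim)
    moreover have "1 / 4 * (c * \<kappa> \<theta> a) + 1 / 4 * (c * \<kappa> \<theta> b) - \<Lambda> * \<theta> < 0" using J\<theta> by (simp add: algebra_simps)
    ultimately have "filterlim (\<lambda>n. (q n - \<Lambda> * \<theta>) * N n) at_bot sequentially"
      using Ntop by (intro filterlim_tendsto_neg_mult_at_bot) auto
    then show "(\<lambda>n. exp ((q n - \<Lambda> * \<theta>) * N n)) \<longlonglongrightarrow> 0"
      by (rule filterlim_compose[OF exp_at_bot])
  qed
  have "(\<lambda>n. 1 - S n / k n - G n) \<longlonglongrightarrow> 1 - \<rho> - 0" by (intro tendsto_intros S_lim G_lim)
  then have ev_br: "\<forall>\<^sub>F n in sequentially. (1 - \<rho>) / 2 < 1 - S n / k n - G n"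
    using \<rho>1 by (intro order_tendstoD(1)) auto
  have "(\<lambda>n. - \<Lambda> + ln ((1 - \<rho>) / 2) / N n) \<longlonglongrightarrow> - \<Lambda> + 0"
    using Ntop by (intro tendsto_intros tendsto_divide_0[OF tendsto_const] filterlim_at_top_imp_at_infinity)
  then have ev_r: "\<forall>\<^sub>F n in sequentially. r < - \<Lambda> + ln ((1 - \<rho>) / 2) / N n"
    using \<Lambda>(2) by (intro order_tendstoD(1)) auto
  show "\<forall>\<^sub>F n in sequentially. r < ln (lower_tail_prob \<eta> n (c / sqrt n)) / real n powr (3/2)"
    using ev_br ev_r ev_p eventually_ge_at_top[of 3]
  proof eventually_elim
    case (elim n)
    have kp: "0 < k n" unfolding k_def using elim \<eta>0 by simp
    have Np: "0 < N n" unfolding N_def using elim by simp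
    have "exp (- (\<Lambda> * N n)) * ((1 - \<rho>) / 2) \<le> exp (- (\<Lambda> * N n)) * (1 - S n / k n - G n)"
      using elim by (intro mult_left_mono) auto
    also have "\<dots> \<le> lower_tail_prob \<eta> n (p n)"
      unfolding S_def G_def
      by (rule tilted_inequality) (use elim a b \<theta> kp in \<open>auto simp: \<alpha>_def k_def\<close>)
    finally have le: "exp (- (\<Lambda> * N n)) * ((1 - \<rho>) / 2) \<le> lower_tail_prob \<eta> n (p n)" .
    moreover have pos: "0 < exp (- (\<Lambda> * N n)) * ((1 - \<rho>) / 2)" using \<rho>1 by simp
    ultimately have "ln (exp (- (\<Lambda> * N n)) * ((1 - \<rho>) / 2)) \<le> ln (lower_tail_prob \<eta> n (p n))"
      by (subst ln_le_cancel_iff) auto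
    moreover have "ln (exp (- (\<Lambda> * N n)) * ((1 - \<rho>) / 2)) = - (\<Lambda> * N n) + ln ((1 - \<rho>) / 2)"
      using \<rho>1 by (subst ln_mult_pos) auto
    ultimately have "(- (\<Lambda> * N n) + ln ((1 - \<rho>) / 2)) / N n \<le> ln (lower_tail_prob \<eta> n (p n)) / N n"
      using Np by (intro divide_right_mono) auto
    moreover have "(- (\<Lambda> * N n) + ln ((1 - \<rho>) / 2)) / N n = - \<Lambda> + ln ((1 - \<rho>) / 2) / N n"
      using Np by (simp add: field_simps)
    ultimately show ?case using elim unfolding N_def p_def by linarith
  qed
qed (rule c)

text \<open>The analogue of the two-block bound for \<open>a = 0\<close> and \<open>b = 1\<close>:
  two of any three vertices share a block, so it is enough that the roughly
  \<open>n\<^sup>2 / 4\<close> inner edges are absent.\<close>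

theorem bipartite_lower_bound:
  assumes c: "0 < c"
  shows "- c / 4 \<le> phi 0 c"
proof (rule phi_geI[OF c])
  fix r assume r: "r < - c / 4"
  have "(\<lambda>n. real (card (inner_edges n)) / real n ^ 2 * (sqrt n * ln (1 - c / sqrt n))) \<longlonglongrightarrow> 1 / 4 * (- c)"
  proof (rule tendsto_mult[OF count_limits(1)])
    show "(\<lambda>n. sqrt (real n) * ln (1 - c / sqrt (real n))) \<longlonglongrightarrow> - c" using c by real_asymp
  qed
  then have ev: "\<forall>\<^sub>F n in sequentially. r < real (card (inner_edges n)) / real n ^ 2 * (sqrt n * ln (1 - c / sqrt n))"
    using r by (intro order_tendstoD(1)) auto
  have "\<forall>\<^sub>F n in sequentially. c / sqrt n < 1" using c by real_asymp
  with ev eventually_gt_at_top[of 0] show "\<forall>\<^sub>F n in sequentially. r < ln (lower_tail_prob 0 n (c / sqrt n)) / real n powr (3/2)"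
  proof eventually_elim
    case (elim n)
    define p where "p = c / sqrt n"
    have p: "0 \<le> p" "p \<le> 1" "p < 1" using elim c by (auto simp: p_def)
    let ?E = "complete_edges n"
    have sub: "inner_edges n \<subseteq> ?E" by (auto simp: inner_edges_def)
    \<comment> \<open>Avoiding the inner edges is written as a product of zeros and ones, so that
      its probability factorises by \<open>sum_gprob_prod\<close>.\<close>
    have le: "(\<Prod>e\<in>G. if e \<in> inner_edges n then 0 else 1) \<le> (if real (triangle_count n G) \<le> 0 then 1 else 0 :: real)"
      if "G \<in> Pow ?E" for G
    proof (cases "G \<inter> inner_edges n = {}")
      case True
      have "{T \<in> triangles n. T \<subseteq> G} = {}"
      proof -
        have False if T: "T \<in> vtriples n" "tri_edges T \<subseteq> G" for T
        proof -
          obtain u v w where uvw: "T = {u, v, w}" "u \<noteq> v" "v \<noteq> w" "u \<noteq> w"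
            using T unfolding vtriples_def card_3_iff by auto
          have "{u, v} \<in> tri_edges T" "{v, w} \<in> tri_edges T" "{u, w} \<in> tri_edges T"
            using uvw by (auto simp: tri_edges_def)
          moreover have "inside (n div 2) {u, v} \<or> inside (n div 2) {v, w} \<or> inside (n div 2) {u, w}"
            by (auto simp: inside_def)
          ultimately have "\<exists>e\<in>tri_edges T. inside (n div 2) e" by blast
          then show False using T(2) \<open>G \<in> Pow ?E\<close> True by (auto simp: inner_edges_def)
        qed
        then show ?thesis by (auto simp: triangles_def)
      qed
      then have "triangle_count n G = 0" unfolding triangle_count_eq by (simp only: card.empty)
      moreover have "(\<Prod>e\<in>G. if e \<in> inner_edges n then 0 else 1) = (1 :: real)"
        using True by (intro prod.neutral) auto
      ultimately show ?thesis by simp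
    next
      case False
      moreover have "finite G" using that finite_complete_edges by (auto intro: finite_subset)
      ultimately have "(\<Prod>e\<in>G. if e \<in> inner_edges n then 0 else 1) = (0 :: real)"
        by (intro prod_zero) auto
      then show ?thesis by simp
    qed
    have "(1 - p) ^ card (inner_edges n) = (\<Prod>e\<in>inner_edges n. 1 - p)" by simp
    also have "\<dots> = (\<Prod>e\<in>?E. p * (if e \<in> inner_edges n then 0 else 1) + (1 - p) * 1)"
      using finite_complete_edges sub by (intro prod.mono_neutral_cong_left) auto
    also have "\<dots> = (\<Sum>G\<in>Pow ?E. gprob ?E (\<lambda>_. p) G * ((\<Prod>e\<in>G. if e \<in> inner_edges n then 0 else 1) * (\<Prod>e\<in>?E - G. 1)))"
      by (rule sum_gprob_prod[OF finite_complete_edges, symmetric])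
    also have "\<dots> \<le> lower_tail_prob 0 n p"
      unfolding lower_tail_prob_eq[OF p(1,2)]
      using le p by (intro sum_mono mult_left_mono gprob_nonneg) auto
    finally have "(1 - p) ^ card (inner_edges n) \<le> lower_tail_prob 0 n p" .
    moreover have "0 < (1 - p) ^ card (inner_edges n)" using p by simp
    ultimately have "ln ((1 - p) ^ card (inner_edges n)) \<le> ln (lower_tail_prob 0 n p)"
      by (subst ln_le_cancel_iff) auto
    then have "real (card (inner_edges n)) * ln (1 - p) / real n powr (3/2) \<le> ln (lower_tail_prob 0 n p) / real n powr (3/2)"
      by (intro divide_right_mono) (auto simp: ln_realpow)
    moreover have "real n powr (3/2) * sqrt n = real n ^ 2"
    proof -
      have "sqrt n = real n powr (1/2)" by (simp add: powr_half_sqrt)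
      then show ?thesis using elim by (simp flip: powr_add powr_numeral)
    qed
    then have "real (card (inner_edges n)) / real n ^ 2 * (sqrt n * ln (1 - p)) = real (card (inner_edges n)) * ln (1 - p) / real n powr (3/2)"
      using elim by (simp add: field_simps)
    ultimately show ?case using elim unfolding p_def by linarith
  qed
qed simp

subsection \<open>Bounds for Zhao's threshold\<close>

lemma exp_minus_quadratic_sign:
  fixes z :: real
  shows "0 \<le> z \<Longrightarrow> 1 + z + z\<^sup>2 / 2 \<le> exp z" and "z \<le> 0 \<Longrightarrow> exp z \<le> 1 + z + z\<^sup>2 / 2"
proof -
  define g where "g z = exp z - (1 + z + z\<^sup>2 / 2)" for z :: real
  have mono: "g x \<le> g y" if "x \<le> y" for x y
  proof (rule DERIV_nonneg_imp_nondecreasing[OF that])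
    fix u
    have "(g has_real_derivative exp u - (1 + u)) (at u)"
      unfolding g_def[abs_def] by (auto intro!: derivative_eq_intros)
    then show "\<exists>d. (g has_real_derivative d) (at u) \<and> 0 \<le> d" using exp_ge_add_one_self[of u] by auto
  qed
  have "g 0 = 0" by (simp add: g_def)
  then show "0 \<le> z \<Longrightarrow> 1 + z + z\<^sup>2 / 2 \<le> exp z" "z \<le> 0 \<Longrightarrow> exp z \<le> 1 + z + z\<^sup>2 / 2"
    using mono[of 0 z] mono[of z 0] by (auto simp: g_def)
qed

text \<open>The derivative of the difference is the quadratic Taylor remainder, which has the sign
  of its argument, so the minimum is at 0. Negative \<open>z\<close> is included, as the numerical
  bounds need.\<close>

lemma exp_ge_cubic:
  fixes z :: real
  shows "1 + z + z\<^sup>2 / 2 + z ^ 3 / 6 \<le> exp z"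
proof -
  define g where "g z = exp z - (1 + z + z\<^sup>2 / 2 + z ^ 3 / 6)" for z :: real
  have der: "(g has_real_derivative exp u - (1 + u + u\<^sup>2 / 2)) (at u)" for u
    unfolding g_def[abs_def] by (auto intro!: derivative_eq_intros simp: power2_eq_square)
  have "g 0 \<le> g z"
  proof (cases "0 \<le> z")
    case True
    show ?thesis
    proof (rule DERIV_nonneg_imp_nondecreasing[OF True])
      fix u :: real assume "0 \<le> u"
      then show "\<exists>d. (g has_real_derivative d) (at u) \<and> 0 \<le> d"
        using der[of u] exp_minus_quadratic_sign(1)[of u] by auto
    qed
  next
    case False
    then have "z \<le> 0" by simp
    then show ?thesis
    proof (rule DERIV_nonpos_imp_nonincreasing)
      fix u :: real assume "u \<le> 0"
      then show "\<exists>d. (g has_real_derivative d) (at u) \<and> d \<le> 0"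
        using der[of u] exp_minus_quadratic_sign(2)[of u] by auto
    qed
  qed
  then show ?thesis by (simp add: g_def)
qed

text \<open>Splitting \<open>z\<close> into \<open>m\<close> equal parts makes the cubic Taylor
  polynomial accurate; \<open>r\<close> is a convenient decimal not above its value.\<close>

lemma exp_lower_power:
  fixes z r b :: real
  assumes "0 \<le> r" "r \<le> 1 + z / real m + (z / real m)\<^sup>2 / 2 + (z / real m) ^ 3 / 6" "b \<le> r ^ m" "0 < m"
  shows "b \<le> exp z"
proof -
  have "b \<le> r ^ m" by fact
  also have "\<dots> \<le> exp (z / real m) ^ m"
    using assms(1,2) exp_ge_cubic[of "z / real m"] by (intro power_mono) auto
  also have "\<dots> = exp z" using assms(4) by (simp add: exp_divide_power_eq)
  finally show ?thesis .
qed

text \<open>The difference has derivative \<open>(v - 1) ^ 3 / v\<close>, hence its minimum at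
  1.\<close>

lemma ln_upper_cubic:
  fixes u :: real
  assumes "0 < u"
  shows "ln u \<le> (u - 1) - (u - 1)\<^sup>2 / 2 + (u - 1) ^ 3 / 3"
proof -
  define g where "g u = (u - 1) - (u - 1)\<^sup>2 / 2 + (u - 1) ^ 3 / 3 - ln u" for u :: real
  have der: "(g has_real_derivative (v - 1) ^ 3 / v) (at v)" if "0 < v" for v
  proof -
    have "(g has_real_derivative 1 - (v - 1) + (v - 1)\<^sup>2 - 1 / v) (at v)"
      unfolding g_def[abs_def] using that by (auto intro!: derivative_eq_intros simp: field_simps)
    moreover have "1 - (v - 1) + (v - 1)\<^sup>2 - 1 / v = (v - 1) ^ 3 / v"
      using that by (simp add: field_simps power2_eq_square power3_eq_cube)
    ultimately show ?thesis by simp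
  qed
  have "g 1 \<le> g u"
  proof (cases "1 \<le> u")
    case True
    show ?thesis
    proof (rule DERIV_nonneg_imp_nondecreasing[OF True])
      fix v :: real assume "1 \<le> v"
      then show "\<exists>d. (g has_real_derivative d) (at v) \<and> 0 \<le> d" using der[of v] by auto
    qed
  next
    case False
    then have "u \<le> 1" by simp
    then show ?thesis
    proof (rule DERIV_nonpos_imp_nonincreasing)
      fix v :: real assume v: "u \<le> v" "v \<le> 1"
      then have "(v - 1) ^ 3 / v \<le> 0" using assms
        by (intro divide_nonpos_pos) (auto simp: power_le_zero_eq)
      then show "\<exists>d. (g has_real_derivative d) (at v) \<and> d \<le> 0" using der[of v] v assms by auto
    qed
  qed
  then show ?thesis by (simp add: g_def)
qed

lemma ln_le_of_exp_ge: "0 < x \<Longrightarrow> x \<le> exp b \<Longrightarrow> ln x \<le> (b :: real)"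
  by (metis ln_exp ln_le_cancel_iff exp_gt_zero)

text \<open>The first three anchor bounds for \<open>ln y\<close> at 0.15, 0.27 and 0.43, and the
  fourth bounds \<open>ln 0.75\<close>. The next four place \<open>zhao_threshold\<close> between
  0.209 and 0.21; the last two serve the case \<eta> = 0.\<close>

lemma exp_bounds:
  "(0.15 :: real) \<le> exp (- 1.89)" "(0.27 :: real) \<le> exp (- 1.3092)" "(0.43 :: real) \<le> exp (- 0.843)"
  "(0.75 :: real) \<le> exp (- 0.2876)" "(4.762 :: real) \<le> exp 1.5609" "(0.019683 :: real) \<le> exp (- 3.92)"
  "(4.0767 :: real) \<le> exp 1.406" "(0.209 :: real) \<le> exp (- 1.565)"
  "(3.76918 :: real) \<le> exp 1.32688" "(0.265296 :: real) \<le> exp (- 1.3269)"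
proof -
  show "(0.15 :: real) \<le> exp (- 1.89)"
    by (rule exp_lower_power[where r = "0.8885" and m = 16]) (simp_all add: power2_eq_square power3_eq_cube power_divide)
  show "(0.27 :: real) \<le> exp (- 1.3092)"
    by (rule exp_lower_power[where r = "0.959913" and m = 32]) (simp_all add: power2_eq_square power3_eq_cube power_divide)
  show "(0.43 :: real) \<le> exp (- 0.843)"
    by (rule exp_lower_power[where r = "0.94867" and m = 16]) (simp_all add: power2_eq_square power3_eq_cube power_divide)
  show "(0.75 :: real) \<le> exp (- 0.2876)"
    by (rule exp_lower_power[where r = "0.964688" and m = 8]) (simp_all add: power2_eq_square power3_eq_cube power_divide)
  show "(4.762 :: real) \<le> exp 1.5609"
    by (rule exp_lower_power[where r = "1.049987" and m = 32]) (simp_all add: power2_eq_square power3_eq_cube power_divide)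
  show "(0.019683 :: real) \<le> exp (- 3.92)"
    by (rule exp_lower_power[where r = "0.884696" and m = 32]) (simp_all add: power2_eq_square power3_eq_cube power_divide)
  show "(4.0767 :: real) \<le> exp 1.406"
    by (rule exp_lower_power[where r = "1.09184" and m = 16]) (simp_all add: power2_eq_square power3_eq_cube power_divide)
  show "(0.209 :: real) \<le> exp (- 1.565)"
    by (rule exp_lower_power[where r = "0.95227" and m = 32]) (simp_all add: power2_eq_square power3_eq_cube power_divide)
  show "(3.76918 :: real) \<le> exp 1.32688"
    by (rule exp_lower_power[where r = "1.04233655" and m = 32]) (simp_all add: power2_eq_square power3_eq_cube power_divide)
  show "(0.265296 :: real) \<le> exp (- 1.3269)"
    by (rule exp_lower_power[where r = "0.95938219" and m = 32]) (simp_all add: power2_eq_square power3_eq_cube power_divide)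
qed

text \<open>Both sides and their first derivatives agree at 0, and the second derivative of the
  difference is \<open>2 * u\<^sup>2 / ((1 + u) * (1 - u))\<close>.\<close>

lemma symmetric_entropy_ge_square:
  fixes r :: real
  assumes "0 \<le> r" "r < 1"
  shows "r\<^sup>2 \<le> (1 - r) * ln (1 - r) + (1 + r) * ln (1 + r)"
proof -
  define g where "g r = ln (1 + r) - ln (1 - r) - 2 * r" for r :: real
  have g: "0 \<le> g v" if "0 \<le> v" "v < 1" for v
  proof -
    have "g 0 \<le> g v"
    proof (rule DERIV_nonneg_imp_nondecreasing[OF that(1)])
      fix u :: real assume u: "0 \<le> u" "u \<le> v"
      then have u1: "u < 1" using that by simp
      have "(g has_real_derivative 1 / (1 + u) + 1 / (1 - u) - 2) (at u)"
        unfolding g_def[abs_def] using u u1 by (auto intro!: derivative_eq_intros)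
      moreover have "1 / (1 + u) + 1 / (1 - u) - 2 = 2 * u\<^sup>2 / ((1 + u) * (1 - u))"
        using u u1 by (simp add: divide_simps) (simp add: algebra_simps power2_eq_square)
      moreover have "0 \<le> 2 * u\<^sup>2 / ((1 + u) * (1 - u))" using u u1 by simp
      ultimately show "\<exists>d. (g has_real_derivative d) (at u) \<and> 0 \<le> d" by auto
    qed
    then show ?thesis by (simp add: g_def)
  qed
  define f where "f r = (1 - r) * ln (1 - r) + (1 + r) * ln (1 + r) - r\<^sup>2" for r :: real
  have "f 0 \<le> f r"
  proof (rule DERIV_nonneg_imp_nondecreasing[OF assms(1)])
    fix u :: real assume u: "0 \<le> u" "u \<le> r"
    then have u1: "u < 1" using assms by simp
    have "(f has_real_derivative - ln (1 - u) + (1 - u) * (- 1 / (1 - u)) + (ln (1 + u) + (1 + u) * (1 / (1 + u))) - 2 * u) (at u)"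
      unfolding f_def[abs_def] using u u1 by (auto intro!: derivative_eq_intros)
    then have "(f has_real_derivative g u) (at u)" using u u1 by (simp add: g_def)
    then show "\<exists>d. (f has_real_derivative d) (at u) \<and> 0 \<le> d" using g[OF u(1) u1] by auto
  qed
  then show ?thesis by (simp add: f_def)
qed

text \<open>
  With \<open>s = 1 / w\<close> this inequality, divided by \<open>w\<close>, bounds the exponent of \<^const>\<open>zhao_fun\<close>;
  \<open>2.5609\<close> slightly exceeds \<open>1 - ln 0.21\<close>.
\<close>

lemma two_block_gap_large:
  fixes x w :: real
  assumes x: "0 < x" "x < 1" and w: "0 < w" "w ^ 3 = x * (x\<^sup>2 + 3) / 4" and big: "0.125 \<le> x"
  shows "2.5609 * (1 + x - 2 * w) \<le> x * ln x - (1 + x) * ln w"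
proof -
  \<comment> \<open>Scaled to have average 1, the two block values are \<open>1 - r\<close> inside
    and \<open>1 + r\<close> across; \<open>v\<close> is the constant graphon of equal triangle
    density, whence \<open>v ^ 3 = 1 - r ^ 3\<close>.\<close>
  define r where "r = (1 - x) / (1 + x)"
  define v where "v = 2 * w / (1 + x)"
  have r: "0 < r" "r < 1" using x by (auto simp: r_def)
  have r78: "r \<le> 0.78" unfolding r_def using x big by (simp add: field_simps)
  have e: "1 - r = 2 * x / (1 + x)" "1 + r = 2 / (1 + x)" using x by (auto simp: r_def field_simps)
  have v0: "0 < v" using x w by (simp add: v_def)
  have v3: "v ^ 3 = 1 - r ^ 3"
  proof -
    have "v ^ 3 = 8 * w ^ 3 / (1 + x) ^ 3" by (simp add: v_def power_divide power_mult_distrib)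
    also have "\<dots> = 2 * x * (x\<^sup>2 + 3) / (1 + x) ^ 3" unfolding w(2) by simp
    also have "\<dots> = ((1 + x) ^ 3 - (1 - x) ^ 3) / (1 + x) ^ 3"
      by (simp add: power2_eq_square power3_eq_cube algebra_simps)
    also have "\<dots> = 1 - (1 - x) ^ 3 / (1 + x) ^ 3" using x by (simp add: diff_divide_distrib)
    also have "(1 - x) ^ 3 / (1 + x) ^ 3 = r ^ 3" unfolding r_def by (rule power_divide[symmetric])
    finally show ?thesis .
  qed
  have r3: "r ^ 3 \<le> 0.78 ^ 3" using r r78 by (intro power_mono) auto
  have vl: "0.8 \<le> v"
  proof (rule ccontr)
    assume "\<not> 0.8 \<le> v"
    then have "v ^ 3 < 0.8 ^ 3" using v0 by (intro power_strict_mono) auto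
    then show False using v3 r3 by (simp add: power3_eq_cube)
  qed
  have v1: "v \<le> 1"
  proof (rule ccontr)
    assume "\<not> v \<le> 1"
    then have "1 ^ 3 < v ^ 3" by (intro power_strict_mono) auto
    moreover have "0 < r ^ 3" using r by simp
    ultimately show False using v3 by simp
  qed
  \<comment> \<open>With \<open>0.8 \<le> v\<close> the second factor is at least 2.44, so
    \<open>1 - v\<close> is at most \<open>0.78 / 2.44 = 39 / 122\<close> times
    \<open>r\<^sup>2\<close>. The bound 0.78 comes from \<open>0.125 \<le> x\<close>, and
    \<open>1.5609 * 39 / 122\<close> is just below 1/2.\<close>
  have "(1 - v) * (1 + v + v\<^sup>2) = r ^ 3" using v3 by (simp add: algebra_simps power2_eq_square power3_eq_cube)
  moreover have "0.8\<^sup>2 \<le> v\<^sup>2" using vl by (intro power_mono) auto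
  then have "(1 - v) * 2.44 \<le> (1 - v) * (1 + v + v\<^sup>2)" using vl v1 by (intro mult_left_mono) (auto simp: power2_eq_square)
  ultimately have "(1 - v) * 2.44 \<le> r ^ 3" by simp
  also have "r ^ 3 = r\<^sup>2 * r" by (simp add: power2_eq_square power3_eq_cube)
  also have "\<dots> \<le> r\<^sup>2 * 0.78" using r78 by (intro mult_left_mono) auto
  finally have "1 - v \<le> 39 / 122 * r\<^sup>2" by simp
  then have "1.5609 * (1 - v) \<le> 1.5609 * (39 / 122 * r\<^sup>2)" by (intro mult_left_mono) auto
  also have "\<dots> = (1.5609 * 39 / 122) * r\<^sup>2" by simp
  also have "\<dots> \<le> (1 / 2) * r\<^sup>2" by (intro mult_right_mono) auto
  finally have a: "1.5609 * (1 - v) \<le> r\<^sup>2 / 2" by simp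
  have "ln v \<le> v - 1" using v0 by (rule ln_le_minus_one)
  then have b: "2.5609 * (1 - v) \<le> r\<^sup>2 / 2 - ln v" using a by simp
  have c: "r\<^sup>2 / 2 \<le> ((1 - r) * ln (1 - r) + (1 + r) * ln (1 + r)) / 2"
    using symmetric_entropy_ge_square[of r] r by simp
  have "2.5609 * (1 - v) \<le> ((1 - r) * ln (1 - r) + (1 + r) * ln (1 + r)) / 2 - ln v"
    by (rule order_trans[OF b diff_right_mono[OF c]])
  then have "2.5609 * (1 - v) * (1 + x) \<le> (((1 - r) * ln (1 - r) + (1 + r) * ln (1 + r)) / 2 - ln v) * (1 + x)"
    by (rule mult_right_mono) (use x in simp)
  also have "\<dots> = x * ln (1 - r) + ln (1 + r) - (1 + x) * ln v"
  proof -
    have f: "(1 - r) * (1 + x) = 2 * x" "(1 + r) * (1 + x) = 2" unfolding e using x by (simp_all add: field_simps)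
    have "(((1 - r) * a + (1 + r) * b) / 2 - l) * (1 + x) = ((1 - r) * (1 + x) * a + (1 + r) * (1 + x) * b) / 2 - (1 + x) * l" for a b l
      by (simp add: algebra_simps add_divide_distrib diff_divide_distrib)
    then show ?thesis unfolding f by simp
  qed
  also have "ln (1 - r) = ln 2 + ln x - ln (1 + x)" unfolding e using x by (simp add: ln_div ln_mult_pos)
  also have "ln (1 + r) = ln 2 - ln (1 + x)" unfolding e using x by (simp add: ln_div)
  also have "ln v = ln 2 + ln w - ln (1 + x)" unfolding v_def using x w by (simp add: ln_div ln_mult_pos)
  finally have "2.5609 * (1 - v) * (1 + x) \<le> x * ln x - (1 + x) * ln w" by (simp add: algebra_simps)
  moreover have "(1 - v) * (1 + x) = 1 + x - 2 * w" using x by (simp add: v_def field_simps)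
  ultimately show ?thesis by (simp only: mult.assoc)
qed

text \<open>In this range the gap comes close to 0, so \<open>ln y\<close> is replaced by its cubic
  upper bound at 0.27 and not by a tangent. After a linear function that is positive on the range is
  split off, a nonnegative multiple of a square remains.\<close>

lemma polynomial_bound_middle:
  fixes y :: real
  assumes "0.15 \<le> y" "y \<le> 0.37"
  shows "0 \<le> (1 - 2 * y ^ 3) * (1.3092 - (y / 0.27 - 1) + (y / 0.27 - 1)\<^sup>2 / 2 - (y / 0.27 - 1) ^ 3 / 3)
     + 0.0958 + 0.0958 * y ^ 3 - 0.13 * y ^ 6 + 2.5609 * (1.8171 * y - 1 - y ^ 3)"
proof -
  \<comment> \<open>Quotient of the polynomial by \<open>(y - 0.272)\<^sup>2\<close>, the double zero being close to its minimum.\<close>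
  define q where "q = 879054681790031 / 96108398437500 - 102588877931527 / 5125781250000 * y
     + 56312527907 / 7688671875 * y\<^sup>2 - 4206799829 / 184528125 * y ^ 3 + 199232363 / 5904900 * y ^ 4"
  have "y ^ 3 \<le> 0.37 ^ 3" using assms by (intro power_mono) auto
  then have "y ^ 3 \<le> 50653 / 1000000" by (simp add: power_divide)
  moreover have "y \<le> 37 / 100" using assms by simp
  moreover have "0 \<le> y\<^sup>2" "0 \<le> y ^ 4" by simp_all
  ultimately have q0: "0 \<le> q" unfolding q_def by linarith
  have "(1 - 2 * y ^ 3) * (1.3092 - (y / 0.27 - 1) + (y / 0.27 - 1)\<^sup>2 / 2 - (y / 0.27 - 1) ^ 3 / 3)
     + 0.0958 + 0.0958 * y ^ 3 - 0.13 * y ^ 6 + 2.5609 * (1.8171 * y - 1 - y ^ 3)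
    = 94573033621279877 / 240270996093750000000 - 4885577035527139 / 3844335937500000000 * (y - 0.272)
     + (y - 0.272)\<^sup>2 * q"
    unfolding q_def by (simp add: field_simps eval_nat_numeral)
  moreover have "0 \<le> 94573033621279877 / 240270996093750000000 - 4885577035527139 / 3844335937500000000 * (y - 0.272)"
    using assms by simp
  ultimately show ?thesis using q0 by simp
qed

text \<open>For small \<open>x\<close> the cube root \<open>y\<close> is the natural variable:
  \<open>w\<close> is close to \<open>root 3 0.75 * y\<close>, and what remains is an inequality in
  \<open>y\<close> and \<open>ln y\<close>. Equality nearly holds around \<open>y = 0.272\<close>,
  which dictates the precision of all constants.\<close>

lemma two_block_gap_small:
  fixes x w :: real
  assumes x: "0 < x" and w: "0 < w" "w ^ 3 = x * (x\<^sup>2 + 3) / 4" and small: "x \<le> 0.125"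
  shows "2.5609 * (1 + x - 2 * w) \<le> x * ln x - (1 + x) * ln w"
proof -
  define y where "y = root 3 x"
  have y: "0 < y" and xy: "x = y ^ 3" using x by (auto simp: y_def)
  have y5: "y \<le> 0.5"
  proof (rule ccontr)
    assume "\<not> y \<le> 0.5"
    then have "0.5 ^ 3 < y ^ 3" by (intro power_strict_mono) auto
    then show False using small xy by (simp add: power3_eq_cube)
  qed
  \<comment> \<open>0.90855 is just below the cube root of 0.75; its double is the coefficient
    1.8171.\<close>
  have w_low: "0.90855 * y \<le> w"
  proof (rule ccontr)
    assume "\<not> 0.90855 * y \<le> w"
    then have "w ^ 3 < (0.90855 * y) ^ 3" using w by (intro power_strict_mono) auto
    also have "\<dots> \<le> 0.75 * x" unfolding xy power_mult_distrib using y
      by (intro mult_right_mono) (auto simp: power3_eq_cube)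
    also have "\<dots> \<le> w ^ 3" unfolding w(2) using x by (simp add: algebra_simps power2_eq_square)
    finally show False by simp
  qed
  have ln34: "ln (0.75 :: real) \<le> - 0.2876" by (rule ln_le_of_exp_ge) (use exp_bounds in auto)
  have w34: "w ^ 3 = x * (0.75 * (1 + x\<^sup>2 / 3))" unfolding w(2) by (simp add: field_simps)
  have x3: "0 < 1 + x\<^sup>2 / 3" by (simp add: add_pos_nonneg)
  have "3 * ln w = ln (w ^ 3)" using w by (simp add: ln_realpow)
  also have "\<dots> = ln x + ln (0.75 * (1 + x\<^sup>2 / 3))" unfolding w34 using x x3 by (intro ln_mult_pos) simp_all
  also have "ln (0.75 * (1 + x\<^sup>2 / 3)) = ln 0.75 + ln (1 + x\<^sup>2 / 3)" using x3 by (intro ln_mult_pos) simp_all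
  also have "ln (1 + x\<^sup>2 / 3) \<le> x\<^sup>2 / 3" by (rule ln_add_one_self_le_self) simp
  also have "ln x = 3 * ln y" unfolding xy using y by (simp add: ln_realpow)
  finally have "3 * ln w \<le> 3 * ln y - 0.2876 + x\<^sup>2 / 3" using ln34 by simp
  then have lnw: "(1 + x) * ln w \<le> (1 + x) * (ln y - 0.2876 / 3 + x\<^sup>2 / 9)" using x by (intro mult_left_mono) auto
  have lnx: "x * ln x = 3 * x * ln y" unfolding xy using y by (simp add: ln_realpow)
  \<comment> \<open>1.17 bounds \<open>1 + x\<close> and gives the round coefficient 0.13; below,
    0.0958 is rounded down from \<open>0.2876 / 3\<close>.\<close>
  have "(1 + x) * (x\<^sup>2 / 9) \<le> 1.17 * (x\<^sup>2 / 9)" using small by (intro mult_right_mono) auto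
  also have "\<dots> = 0.13 * x\<^sup>2" by simp
  finally have A: "(1 + x) * (x\<^sup>2 / 9) \<le> 0.13 * x\<^sup>2" .
  have B: "(1 + x) * 0.0958 \<le> (1 + x) * (0.2876 / 3)" using x by (intro mult_left_mono) auto
  have "0.0958 + 0.0958 * x - 0.13 * x\<^sup>2 = (1 + x) * 0.0958 - 0.13 * x\<^sup>2" by (simp add: distrib_right)
  also have "\<dots> \<le> (1 + x) * (0.2876 / 3) - (1 + x) * (x\<^sup>2 / 9)" by (rule diff_mono[OF B A])
  also have "\<dots> = (1 + x) * (0.2876 / 3 - x\<^sup>2 / 9)" by (rule right_diff_distrib[symmetric])
  finally have AB: "0.0958 + 0.0958 * x - 0.13 * x\<^sup>2 \<le> (1 + x) * (0.2876 / 3 - x\<^sup>2 / 9)" .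
  define u where "u = (1 + x) * (0.2876 / 3 - x\<^sup>2 / 9)"
  have lnw': "(1 + x) * ln w \<le> (1 + x) * ln y - u"
  proof -
    have "(1 + x) * (ln y - 0.2876 / 3 + x\<^sup>2 / 9) = (1 + x) * ln y - u" by (simp add: u_def algebra_simps)
    then show ?thesis using lnw by simp
  qed
  have "2.5609 * 2 * (0.90855 * y) \<le> 2.5609 * 2 * w" using w_low by (intro mult_left_mono) auto
  then have t: "2.5609 * (1 + x - 2 * w) \<le> 2.5609 * (1 + x) - 2.5609 * 2 * (0.90855 * y)"
    by (simp add: right_diff_distrib)
  define K where "K = 0.0958 + 0.0958 * x - 0.13 * x\<^sup>2"
  have "(1 + x) * ln w \<le> (1 + x) * ln y - K"
    by (rule order_trans[OF lnw' diff_left_mono]) (use AB in \<open>simp add: K_def u_def\<close>)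
  from diff_mono[OF diff_mono[OF order_refl this] t, of "x * ln x"]
  have "x * ln x - (1 + x) * ln w - 2.5609 * (1 + x - 2 * w)
     \<ge> 3 * x * ln y - ((1 + x) * ln y - K) - (2.5609 * (1 + x) - 2.5609 * 2 * (0.90855 * y))"
    unfolding lnx .
  also have "3 * x * ln y - ((1 + x) * ln y - K) - (2.5609 * (1 + x) - 2.5609 * 2 * (0.90855 * y))
     = (1 - 2 * x) * (- ln y) + 0.0958 + 0.0958 * x - 0.13 * x\<^sup>2 + 2.5609 * (1.8171 * y - 1 - x)"
    by (simp add: K_def algebra_simps)
  finally have main: "(1 - 2 * x) * (- ln y) + 0.0958 + 0.0958 * x - 0.13 * x\<^sup>2 + 2.5609 * (1.8171 * y - 1 - x)
     \<le> x * ln x - (1 + x) * ln w - 2.5609 * (1 + x - 2 * w)" .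
  have x6: "x\<^sup>2 = y ^ 6" by (simp add: xy flip: power_mult)
  have lny: "ln y \<le> L + ln (y / y0)" if "0 < y0" "y0 \<le> exp L" for L y0
  proof -
    have "ln y = ln y0 + ln (y / y0)" using that y by (simp add: ln_div)
    then show ?thesis using ln_le_of_exp_ge[OF that] by simp
  qed
  have final: ?thesis
    if "ln y \<le> M" "0 \<le> (1 - 2 * x) * (- M) + 0.0958 + 0.0958 * x - 0.13 * x\<^sup>2 + 2.5609 * (1.8171 * y - 1 - x)" for M
  proof -
    have "(1 - 2 * x) * (- M) \<le> (1 - 2 * x) * (- ln y)" using that(1) small by (intro mult_left_mono) auto
    then have "(1 - 2 * x) * (- M) + 0.0958 + 0.0958 * x - 0.13 * x\<^sup>2 + 2.5609 * (1.8171 * y - 1 - x)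
       \<le> (1 - 2 * x) * (- ln y) + 0.0958 + 0.0958 * x - 0.13 * x\<^sup>2 + 2.5609 * (1.8171 * y - 1 - x)"
      by (intro add_right_mono diff_right_mono)
    from order_trans[OF that(2) this] have "0 \<le> (1 - 2 * x) * (- ln y) + 0.0958 + 0.0958 * x - 0.13 * x\<^sup>2 + 2.5609 * (1.8171 * y - 1 - x)" .
    from order_trans[OF this main] show ?thesis by simp
  qed
  \<comment> \<open>The cubic bound for \<open>ln y\<close> is spent where the gap is smallest; on
    either side the tangents at 0.15 and 0.43 leave enough room.\<close>
  consider "y \<le> 0.15" | "0.15 \<le> y" "y \<le> 0.37" | "0.37 \<le> y" by linarith
  then show ?thesis
  proof cases
    case 1
    have "ln y \<le> - 1.89 + (y / 0.15 - 1)"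
      using lny[of "0.15" "- 1.89"] exp_bounds(1) ln_le_minus_one[of "y / 0.15"] y by simp
    moreover have "x \<le> 0.15 ^ 3" unfolding xy using 1 y by (intro power_mono) auto
    then have xs: "x \<le> 0.004" by (simp add: power3_eq_cube)
    have lin: "0 \<le> 2.89 - y / 0.15 - 5.78 * x + 2 / 0.15 * p + 0.0958 + 0.0958 * x - 0.13 * q + 2.5609 * (1.8171 * y - 1 - x)"
      if "0 \<le> p" "q \<le> x" for p q
      using that 1 xs by (simp add: field_simps)
    have eq: "(1 - 2 * x) * (- (- 1.89 + (y / 0.15 - 1))) = 2.89 - y / 0.15 - 5.78 * x + 2 / 0.15 * (x * y)"
      by (simp add: field_simps)
    have "x * x \<le> 1 * x" using x xs by (intro mult_right_mono) auto
    then have "0 \<le> (1 - 2 * x) * (- (- 1.89 + (y / 0.15 - 1))) + 0.0958 + 0.0958 * x - 0.13 * x\<^sup>2 + 2.5609 * (1.8171 * y - 1 - x)"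
      unfolding eq by (intro lin) (use x y in \<open>auto simp: power2_eq_square\<close>)
    ultimately show ?thesis by (rule final)
  next
    case 2
    have "ln y \<le> - 1.3092 + ((y / 0.27 - 1) - (y / 0.27 - 1)\<^sup>2 / 2 + (y / 0.27 - 1) ^ 3 / 3)"
      using lny[of "0.27" "- 1.3092"] exp_bounds(2) ln_upper_cubic[of "y / 0.27"] y by simp
    moreover have "0 \<le> (1 - 2 * x) * (- (- 1.3092 + ((y / 0.27 - 1) - (y / 0.27 - 1)\<^sup>2 / 2 + (y / 0.27 - 1) ^ 3 / 3)))
       + 0.0958 + 0.0958 * x - 0.13 * x\<^sup>2 + 2.5609 * (1.8171 * y - 1 - x)"
      using polynomial_bound_middle[OF 2] unfolding x6 xy by (simp add: algebra_simps)
    ultimately show ?thesis by (rule final)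
  next
    case 3
    have "ln y \<le> - 0.843 + (y / 0.43 - 1)"
      using lny[of "0.43" "- 0.843"] exp_bounds(3) ln_le_minus_one[of "y / 0.43"] y by simp
    moreover have "0 \<le> (1 - 2 * x) * (- (- 0.843 + (y / 0.43 - 1))) + 0.0958 + 0.0958 * x - 0.13 * x\<^sup>2 + 2.5609 * (1.8171 * y - 1 - x)"
    proof -
      have "x\<^sup>2 \<le> 0.125\<^sup>2" using x small by (intro power_mono) auto
      then have x2: "x\<^sup>2 \<le> 0.016" by (simp add: power2_eq_square)
      have "y\<^sup>2 \<le> 0.5\<^sup>2" using y y5 by (intro power_mono) auto
      then have A: "0 \<le> (y - 0.37) * (0.5 - y) * (2.6916371 + 2.10483 * y - 4.651 * y\<^sup>2)"
        using 3 y5 by (intro mult_nonneg_nonneg) (auto simp: power2_eq_square)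
      \<comment> \<open>The coefficients of the quartic are those of the target, rounded down. The
        linear function interpolates it at 0.37 and 0.5, so the difference is divisible by
        \<open>(y - 0.37) * (0.5 - y)\<close>.\<close>
      have id: "- 0.6242 + 2.3278 * y - 6.1512 * y ^ 3 + 4.651 * y ^ 4
         = (375469273 / 1000000000 * y - 252494273 / 2000000000) + (y - 0.37) * (0.5 - y) * (2.6916371 + 2.10483 * y - 4.651 * y\<^sup>2)"
        by (simp add: field_simps eval_nat_numeral)
      have B: "0 \<le> 375469273 / 1000000000 * y - 252494273 / 2000000000" using 3 by simp
      have "0 \<le> - 0.6242 + 2.3278 * y - 6.1512 * y ^ 3 + 4.651 * y ^ 4"
        unfolding id by (rule add_nonneg_nonneg[OF B A])
      moreover have "y ^ 4 = x * y" by (simp add: xy eval_nat_numeral)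
      ultimately have pre: "0 \<le> - 0.6242 + 2.3278 * y - 6.1512 * x + 4.651 * (x * y)" by (simp only: xy)
      have lin: "0 \<le> 1.843 - y / 0.43 - 3.686 * x + 2 / 0.43 * p + 0.0958 + 0.0958 * x - 0.13 * q + 2.5609 * (1.8171 * y - 1 - x)"
        if "0 \<le> - 0.6242 + 2.3278 * y - 6.1512 * x + 4.651 * p" "0 \<le> p" "q \<le> 0.016" for p q
        using that x y by (simp add: field_simps)
      have eq: "(1 - 2 * x) * (- (- 0.843 + (y / 0.43 - 1))) = 1.843 - y / 0.43 - 3.686 * x + 2 / 0.43 * (x * y)"
        by (simp add: field_simps)
      show ?thesis unfolding eq by (rule lin[OF pre _ x2]) (use x y in simp)
    qed
    ultimately show ?thesis by (rule final)
  qed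
qed

section \<open>Bounds for \<open>zhao_fun\<close> and its supremum\<close>

lemma zhao_fun_expand:
  assumes x: "0 < x" "x < 1"
  obtains s where "0 < s" "s ^ 3 = 4 / (x * (x\<^sup>2 + 3))" "2 < s + s * x"
    "zhao_fun x = exp (1 - (s * x * ln (s * x) + s * ln s) / (s + s * x - 2))"
proof -
  define s where "s = (4 / (x * (x\<^sup>2 + 3))) powr (1/3)"
  have p: "0 < x * (x\<^sup>2 + 3)" using x by (intro mult_pos_pos add_nonneg_pos) auto
  define q where "q = 4 / (x * (x\<^sup>2 + 3))"
  have q: "0 < q" unfolding q_def using p by (rule divide_pos_pos[rotated]) simp
  have sq: "s = q powr (1/3)" by (simp add: s_def q_def)
  have s: "0 < s" unfolding sq using q by simp
  have "s ^ 3 = s powr 3" using s by (simp add: powr_numeral)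
  also have "\<dots> = 4 / (x * (x\<^sup>2 + 3))" unfolding sq powr_powr using q by (simp add: q_def)
  finally have s3: "s ^ 3 = 4 / (x * (x\<^sup>2 + 3))" .
  \<comment> \<open>The blocks have a larger mean than the constant graphon of equal density because
    \<open>(1 + x) ^ 3\<close> exceeds \<open>2 * (x * (x\<^sup>2 + 3))\<close> by
    \<open>(1 - x) ^ 3\<close>. This makes the denominator in \<open>zhao_fun\<close>
    positive.\<close>
  have "2 < s * (1 + x)"
  proof (rule ccontr)
    assume "\<not> 2 < s * (1 + x)"
    then have "(s * (1 + x)) ^ 3 \<le> 2 ^ 3" using s x by (intro power_mono) auto
    then have "4 / (x * (x\<^sup>2 + 3)) * (1 + x) ^ 3 \<le> 8" by (simp add: power_mult_distrib s3)
    then have "(1 + x) ^ 3 \<le> 2 * (x * (x\<^sup>2 + 3))" using p by (simp add: field_simps)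
    moreover have "(1 + x) ^ 3 - 2 * (x * (x\<^sup>2 + 3)) = (1 - x) ^ 3"
      by (simp add: power2_eq_square power3_eq_cube algebra_simps)
    moreover have "0 < (1 - x) ^ 3" using x by simp
    ultimately show False by simp
  qed
  then show ?thesis using that[of s] s s3 by (simp add: zhao_fun_def s_def Let_def distrib_left)
qed

lemma zhao_numerator:
  fixes s x :: real
  assumes "0 < s" "0 < x"
  shows "s * x * ln (s * x) + s * ln s = s * (x * ln x - (1 + x) * ln (1 / s))"
  using assms by (simp add: ln_mult_pos ln_div algebra_simps)

lemma inverse_cube:
  fixes s x :: real
  assumes "s ^ 3 = 4 / (x * (x\<^sup>2 + 3))" shows "(1 / s) ^ 3 = x * (x\<^sup>2 + 3) / 4"
  using assms by (simp add: power_one_over)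

lemma zhao_fun_upper:
  assumes x: "0 < x" "x < 1" shows "zhao_fun x \<le> 1 / 4.762"
proof -
  obtain s where s: "0 < s" "s ^ 3 = 4 / (x * (x\<^sup>2 + 3))" "2 < s + s * x"
    "zhao_fun x = exp (1 - (s * x * ln (s * x) + s * ln s) / (s + s * x - 2))"
    using zhao_fun_expand[OF x] by metis
  have w: "0 < 1 / s" using s by simp
  have "2.5609 * (1 + x - 2 * (1 / s)) \<le> x * ln x - (1 + x) * ln (1 / s)"
    using two_block_gap_large[OF x w inverse_cube[OF s(2)]] two_block_gap_small[OF x(1) w inverse_cube[OF s(2)]]
    by (cases "0.125 \<le> x") auto
  then have "s * (2.5609 * (1 + x - 2 * (1 / s))) \<le> s * (x * ln x - (1 + x) * ln (1 / s))"
    using s by (intro mult_left_mono) auto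
  also have "s * (2.5609 * (1 + x - 2 * (1 / s))) = 2.5609 * (s + s * x - 2)"
    using s by (simp add: field_simps)
  finally have "2.5609 * (s + s * x - 2) \<le> s * x * ln (s * x) + s * ln s"
    unfolding zhao_numerator[OF s(1) x(1)] .
  moreover have "0 < s + s * x - 2" using s(3) by simp
  moreover define A where "A = (s * x * ln (s * x) + s * ln s) / (s + s * x - 2)"
  ultimately have "2.5609 \<le> A" by (simp only: pos_le_divide_eq)
  then have "1 - A \<le> - 1.5609" by simp
  then have "zhao_fun x \<le> exp (- 1.5609)" unfolding s(4) A_def by (subst exp_le_cancel_iff)
  also have "\<dots> = 1 / exp 1.5609" by (simp add: exp_minus inverse_eq_divide)
  also have "\<dots> \<le> 1 / 4.762" using exp_bounds(5) by (intro divide_left_mono) auto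
  finally show ?thesis .
qed

text \<open>The point is \<open>0.27 ^ 3\<close>, close to the maximiser 0.02006. The exponent is
  estimated through \<open>w = 1 / s\<close>, which lies between 0.2453 and 0.24533.\<close>

lemma zhao_fun_lower: "0.209 \<le> zhao_fun 0.019683"
proof -
  define x :: real where "x = 0.019683"
  have x: "0 < x" "x < 1" by (simp_all add: x_def)
  obtain s where s: "0 < s" "s ^ 3 = 4 / (x * (x\<^sup>2 + 3))" "2 < s + s * x"
    "zhao_fun x = exp (1 - (s * x * ln (s * x) + s * ln s) / (s + s * x - 2))"
    using zhao_fun_expand[OF x] by metis
  define w where "w = 1 / s"
  have w: "0 < w" "w ^ 3 = x * (x\<^sup>2 + 3) / 4" using s inverse_cube[OF s(2)] by (auto simp: w_def)
  have w1: "0.2453 \<le> w"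
  proof (rule ccontr)
    assume "\<not> 0.2453 \<le> w"
    then have "w ^ 3 < 0.2453 ^ 3" using w by (intro power_strict_mono) auto
    then show False unfolding w(2) x_def by (simp add: power2_eq_square power3_eq_cube)
  qed
  have w2: "w \<le> 0.24533"
  proof (rule ccontr)
    assume "\<not> w \<le> 0.24533"
    then have "0.24533 ^ 3 < w ^ 3" by (intro power_strict_mono) auto
    then show False unfolding w(2) x_def by (simp add: power2_eq_square power3_eq_cube)
  qed
  have "exp (- 1.406 :: real) = 1 / exp 1.406" by (simp add: exp_minus inverse_eq_divide)
  also have "\<dots> \<le> 1 / 4.0767" using exp_bounds(7) by (intro divide_left_mono) auto
  also have "\<dots> \<le> w" using w1 by simp
  finally have "ln (exp (- 1.406)) \<le> ln w" using w(1) by (subst ln_le_cancel_iff) auto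
  then have lw: "- 1.406 \<le> ln w" by simp
  have lx: "ln x \<le> - 3.92" by (rule ln_le_of_exp_ge) (use exp_bounds(6) in \<open>auto simp: x_def\<close>)
  have "x * ln x \<le> x * (- 3.92)" using lx x by (intro mult_left_mono) auto
  moreover have "(1 + x) * (- 1.406) \<le> (1 + x) * ln w" using lw x by (intro mult_left_mono) auto
  ultimately have "x * ln x - (1 + x) * ln w \<le> x * (- 3.92) - (1 + x) * (- 1.406)" by simp
  also have "\<dots> \<le> 2.565 * (1 + x - 2 * w)" using w2 by (simp add: x_def)
  finally have "s * (x * ln x - (1 + x) * ln w) \<le> s * (2.565 * (1 + x - 2 * w))"
    using s by (intro mult_left_mono) auto
  also have "\<dots> = 2.565 * (s + s * x - 2)" using s by (simp add: w_def field_simps)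
  finally have "s * x * ln (s * x) + s * ln s \<le> 2.565 * (s + s * x - 2)"
    unfolding zhao_numerator[OF s(1) x(1)] w_def .
  moreover have "0 < s + s * x - 2" using s(3) by simp
  moreover define A where "A = (s * x * ln (s * x) + s * ln s) / (s + s * x - 2)"
  ultimately have "A \<le> 2.565" by (simp only: pos_divide_le_eq)
  then have "- 1.565 \<le> 1 - A" by simp
  then have "exp (- 1.565) \<le> zhao_fun x" unfolding s(4) A_def by (subst exp_le_cancel_iff)
  from order_trans[OF exp_bounds(8) this] show ?thesis unfolding x_def .
qed

lemma bdd_above_zhao: "bdd_above (zhao_fun ` {0<..<1})"
  using zhao_fun_upper by (intro bdd_aboveI[of _ "1 / 4.762"]) auto

lemma zhao_threshold_bounds: "0.209 \<le> zhao_threshold" "zhao_threshold < 0.21"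
proof -
  have "zhao_fun 0.019683 \<le> zhao_threshold"
    unfolding zhao_threshold_def by (intro cSUP_upper bdd_above_zhao) auto
  from order_trans[OF zhao_fun_lower this] show "0.209 \<le> zhao_threshold" .
  have "zhao_threshold \<le> 1 / 4.762"
    unfolding zhao_threshold_def using zhao_fun_upper by (intro cSUP_least) auto
  then show "zhao_threshold < 0.21" by (rule order_le_less_trans) simp
qed

subsection \<open>Non-analyticity\<close>

text \<open>As \<open>x\<close> decreases to \<open>q\<close>, \<open>act \<eta> x\<close> tends to
  infinity, so this is the slope at infinity of the continued formula. Substituting
  \<open>act_eq\<close> produces the difference quotient of \<open>ln\<close> between
  \<open>\<eta>\<close> and \<open>x ^ 3\<close>, which tends to \<open>1 / \<eta>\<close>.\<close>

lemma rate_limit: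
  assumes q: "0 < q" "q < 1" and \<eta>: "\<eta> = q ^ 3"
  shows "((\<lambda>x. rate \<eta> (act \<eta> x) x / act \<eta> x) \<longlongrightarrow> - entropy_cost q / 2) (at_right q)"
proof -
  have \<eta>0: "0 < \<eta>" using q \<eta> by simp
  have "((\<lambda>u. (ln u - ln \<eta>) / (u - \<eta>)) \<longlongrightarrow> 1 / \<eta>) (at \<eta>)"
    using DERIV_ln_divide[OF \<eta>0] by (simp only: has_field_derivative_iff)
  moreover have "filterlim (\<lambda>x. x ^ 3) (at \<eta>) (at_right q)"
  proof -
    have "((\<lambda>x. x ^ 3) \<longlongrightarrow> q ^ 3) (at_right q)" by (intro tendsto_intros)
    moreover have "\<forall>\<^sub>F x in at_right q. x ^ 3 \<noteq> q ^ 3"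
      using eventually_at_right_less[of q]
    proof eventually_elim
      case (elim x)
      then have "q ^ 3 < x ^ 3" using q by (intro power_strict_mono) auto
      then show ?case by simp
    qed
    ultimately show ?thesis unfolding \<eta> filterlim_at by auto
  qed
  ultimately have slope: "((\<lambda>x. (ln (x ^ 3) - ln \<eta>) / (x ^ 3 - \<eta>)) \<longlongrightarrow> 1 / \<eta>) (at_right q)"
    by (rule filterlim_compose)
  define S where "S x = (ln (x ^ 3) - ln \<eta>) / (x ^ 3 - \<eta>)" for x
  have "(S \<longlongrightarrow> 1 / \<eta>) (at_right q)" using slope by (simp only: S_def[abs_def])
  then have lim: "((\<lambda>x. (x - 1) / 2 - x * ln x / 3 - \<eta> * (x * ln x) * S x / 6)
      \<longlongrightarrow> (q - 1) / 2 - q * ln q / 3 - \<eta> * (q * ln q) * (1 / \<eta>) / 6) (at_right q)"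
    using q(1) by (intro tendsto_intros) auto
  have limit: "(q - 1) / 2 - q * ln q / 3 - \<eta> * (q * ln q) * (1 / \<eta>) / 6 = - entropy_cost q / 2"
    using \<eta>0 by (simp add: entropy_cost_def field_simps)
  have ev: "\<forall>\<^sub>F x in at_right q. (x - 1) / 2 - x * ln x / 3 - \<eta> * (x * ln x) * S x / 6
      = rate \<eta> (act \<eta> x) x / act \<eta> x"
    using eventually_at_right_real[OF q(2)]
  proof eventually_elim
    case (elim x)
    then have x: "0 < x" "x < 1" "\<eta> < x ^ 3"
      using q power_strict_mono[of q x 3] unfolding \<eta> by auto
    define c where "c = act \<eta> x"
    have c: "0 < c" "c\<^sup>2 * (x ^ 3 - \<eta>) = - x * ln x" using act_pos[OF x] act_eq[OF x] by (auto simp: c_def)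
    have d: "x ^ 3 - \<eta> \<noteq> 0" using x by simp
    have c2: "c\<^sup>2 = - x * ln x / (x ^ 3 - \<eta>)" by (simp only: nonzero_eq_divide_eq[OF d] c(2))
    have "rate \<eta> c x / c = (x - 1) / 2 - x * ln x / 3 - \<eta> * c\<^sup>2 * (ln \<eta> - 3 * ln x) / 6"
      using c(1) by (simp add: rate_def diff_divide_distrib power2_eq_square power3_eq_cube)
    also have "\<eta> * c\<^sup>2 * (ln \<eta> - 3 * ln x) / 6 = \<eta> * (x * ln x) * S x / 6"
    proof -
      have "ln (x ^ 3) = 3 * ln x" using x by (simp add: ln_realpow)
      moreover have "\<eta> * (- x * ln x / (x ^ 3 - \<eta>)) * - M / 6 = \<eta> * (x * ln x) * (M / (x ^ 3 - \<eta>)) / 6" for M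
        by simp
      from this[of "3 * ln x - ln \<eta>"]
      have "\<eta> * (- x * ln x / (x ^ 3 - \<eta>)) * (ln \<eta> - 3 * ln x) / 6
          = \<eta> * (x * ln x) * ((3 * ln x - ln \<eta>) / (x ^ 3 - \<eta>)) / 6" by (simp only: minus_diff_eq)
      ultimately show ?thesis unfolding c2 S_def by (simp only:)
    qed
    finally show ?case by (simp add: c_def)
  qed
  show ?thesis by (rule Lim_transform_eventually[OF lim[unfolded limit] ev])
qed

text \<open>For \<eta> = 0 the formula is \<open>c\<close> times a function of \<open>x\<close>
  alone. With \<open>u = - ln x\<close> it equals \<open>- c / 4\<close> when
  \<open>2 + 4 * u / 3 = exp u\<close>, which happens just below \<open>u = 1.32688\<close>.\<close>

lemma nonanalytic_zero: "\<exists>c. 1 / sqrt (exp 1) \<le> c \<and> c < 4.342 \<and> \<not> real_analytic_at (phi 0) c"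
proof (rule ccontr)
  assume "\<not> ?thesis"
  then have an: "\<And>c. 1 / sqrt (exp 1) \<le> c \<Longrightarrow> c < 4.342 \<Longrightarrow> real_analytic_at (phi 0) c" by blast
  \<comment> \<open>\<open>x\<close> lies just past the crossing and the cut-off \<open>x1\<close>
    slightly further, so that \<open>x\<close> is interior while \<open>act 0\<close> stays below
    4.342 on the whole range.\<close>
  define x1 :: real where "x1 = exp (- 1.3269)"
  define x :: real where "x = exp (- 1.32688)"
  have xx: "x1 < x" "x < 1" "0 < x1" by (simp_all add: x1_def x_def)
  have "2 * (act 0 y)\<^sup>2 < exp 1 \<or> real_analytic_at (phi 0) (act 0 y)" if y: "x1 < y" "y < 1" for y
  proof (cases "2 * (act 0 y)\<^sup>2 < exp 1")
    case False
    have y0: "0 < y" "y < 1" "0 < y ^ 3" using y xx by auto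
    have pos: "0 < act 0 y" by (rule act_pos[OF y0])
    have "(act 0 y)\<^sup>2 * y ^ 3 = - y * ln y" using act_eq[OF y0] by simp
    then have "y * ((act 0 y)\<^sup>2 * y\<^sup>2) = y * (- ln y)" by (simp add: power2_eq_square power3_eq_cube mult_ac)
    then have sq: "(act 0 y)\<^sup>2 * y\<^sup>2 = - ln y" using y0 by (simp only: mult_cancel_left) simp
    have "ln x1 < ln y" using y xx by (subst ln_less_cancel_iff) auto
    then have "- ln y < 1.3269" by (simp add: x1_def)
    moreover have "0.265296 \<le> y" using exp_bounds(10) y unfolding x1_def by linarith
    then have "0.265296\<^sup>2 \<le> y\<^sup>2" by (intro power_mono) auto
    then have "(act 0 y)\<^sup>2 * 0.265296\<^sup>2 \<le> (act 0 y)\<^sup>2 * y\<^sup>2" by (intro mult_left_mono) auto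
    ultimately have "(act 0 y)\<^sup>2 * 0.265296\<^sup>2 < 1.3269" using sq by linarith
    then have "(act 0 y)\<^sup>2 < 1.3269 / 0.265296\<^sup>2" by (simp add: pos_less_divide_eq)
    also have "\<dots> < 4.342\<^sup>2" by (simp add: power_divide power2_eq_square)
    finally have up: "act 0 y < 4.342" by (rule power2_less_imp_less) simp
    \<comment> \<open>Outside the small-\<open>c\<close> regime \<open>act 0 y\<close> is at least
      \<open>sqrt (exp 1 / 2)\<close>, which exceeds \<open>1 / sqrt (exp 1)\<close>.\<close>
    have "(2 :: real) \<le> exp 1" using exp_ge_add_one_self[of 1] by simp
    then have "2 * 1 \<le> exp 1 * (exp 1 :: real)" by (intro mult_mono) auto
    then have "1 / exp 1 \<le> exp 1 / (2 :: real)" by (simp add: field_simps)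
    also have "\<dots> \<le> (act 0 y)\<^sup>2" using False by simp
    finally have "(1 / sqrt (exp 1))\<^sup>2 \<le> (act 0 y)\<^sup>2" by (simp add: power_divide)
    then have "1 / sqrt (exp 1) \<le> act 0 y" by (rule power2_le_imp_le) (use pos in simp)
    then show ?thesis using an up by blast
  qed simp
  then have "phi 0 (act 0 x) = rate 0 (act 0 x) x"
    by (rule analytic_continuation_phi[of 0 x1, rotated 4]) (use xx in auto)
  moreover have c: "0 < act 0 x" using xx by (intro act_pos) auto
  ultimately have "- act 0 x / 4 \<le> act 0 x * ((x - 1) / 2 - x * ln x / 3)"
    using bipartite_lower_bound[OF c] by (simp add: rate_def)
  then have "act 0 x * (- 1 / 4) \<le> act 0 x * ((x - 1) / 2 - x * ln x / 3)" by simp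
  then have "- 1 / 4 \<le> (x - 1) / 2 - x * ln x / 3" using c by (simp only: mult_le_cancel_left_pos)
  moreover have "ln x = - 1.32688" by (simp add: x_def)
  ultimately have "- 1 / 4 \<le> (x - 1) / 2 - x * (- 1.32688) / 3" by (simp only:)
  then have "1 \<le> x * (2 + 4 * 1.32688 / 3)" by (simp add: field_simps)
  then have "exp 1.32688 * 1 \<le> exp 1.32688 * (x * (2 + 4 * 1.32688 / 3))" by (intro mult_left_mono) auto
  also have "\<dots> = 2 + 4 * 1.32688 / 3" by (simp add: x_def exp_minus)
  finally have "exp 1.32688 \<le> (2 + 4 * 1.32688 / 3 :: real)" by simp
  \<comment> \<open>The margin is thin: \<open>2 + 4 * 1.32688 / 3\<close> is 3.769173..., just
    below 3.76918.\<close>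
  from order_trans[OF exp_bounds(9) this] show False by simp
qed

text \<open>Zhao's two-block graphon undercuts the constant \<open>q\<close> strictly, which leaves
  room to scale its values by some \<open>r < 1\<close> and so meet the strict density condition of
  \<open>two_block_lower_bound\<close>. The resulting bound is linear in \<open>c\<close> with a
  slope above the limiting slope in \<open>rate_limit\<close>, so it wins for marginals close to
  \<open>q\<close>.\<close>

lemma nonanalytic_pos:
  assumes \<eta>: "0 < \<eta>" "\<eta> < eta_l"
  shows "\<exists>c>0. \<not> real_analytic_at (phi \<eta>) c"
proof (rule ccontr)
  assume "\<not> ?thesis"
  then have an: "\<And>c. 0 < c \<Longrightarrow> real_analytic_at (phi \<eta>) c" by blast
  define q where "q = root 3 \<eta>"
  have q: "0 < q" "q ^ 3 = \<eta>" using \<eta> by (auto simp: q_def)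
  have qz: "q < zhao_threshold"
  proof (rule power_less_imp_less_base[of _ 3])
    show "q ^ 3 < zhao_threshold ^ 3" using \<eta> q by (simp add: eta_l_def)
    show "0 \<le> zhao_threshold" using zhao_threshold_bounds(1) by (rule order_trans[rotated]) simp
  qed
  have q1: "q < 1" using order_less_trans[OF qz zhao_threshold_bounds(2)] by (rule order_less_trans) simp
  have "\<exists>x\<in>{0<..<1}. q < zhao_fun x"
    using qz unfolding zhao_threshold_def
    by (subst (asm) less_cSUP_iff) (auto intro: bdd_above_zhao)
  then obtain x where x: "0 < x" "x < 1" "q < zhao_fun x" by auto
  obtain s where s: "0 < s" "s ^ 3 = 4 / (x * (x\<^sup>2 + 3))" "2 < s + s * x"
    "zhao_fun x = exp (1 - (s * x * ln (s * x) + s * ln s) / (s + s * x - 2))"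
    using zhao_fun_expand[OF x(1,2)] by metis
  define a where "a = q * (s * x)"
  define b where "b = q * s"
  have ab: "0 < a" "0 < b" using q s x by (simp_all add: a_def b_def)
  have dens: "a * (a\<^sup>2 + 3 * b\<^sup>2) / 4 = \<eta>"
  proof -
    have "a * (a\<^sup>2 + 3 * b\<^sup>2) / 4 = q ^ 3 * (s ^ 3 * (x * (x\<^sup>2 + 3) / 4))"
      by (simp add: a_def b_def power2_eq_square power3_eq_cube algebra_simps)
    also have "s ^ 3 * (x * (x\<^sup>2 + 3) / 4) = 1"
    proof -
      define p where "p = x * (x\<^sup>2 + 3)"
      have "0 < p" unfolding p_def using x by (intro mult_pos_pos add_nonneg_pos) auto
      then show ?thesis unfolding s(2) p_def[symmetric] by simp
    qed
    finally show ?thesis using q by simp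
  qed
  \<comment> \<open>This is \<open>q < zhao_fun x\<close> after taking logarithms and clearing the
    positive denominator.\<close>
  have beat: "entropy_cost a + entropy_cost b < 2 * entropy_cost q"
  proof -
    define A where "A = s * x * ln (s * x) + s * ln s"
    have "ln q < ln (zhao_fun x)" using x q s by (subst ln_less_cancel_iff) auto
    then have "A / (s + s * x - 2) < 1 - ln q" by (simp add: s(4) A_def)
    moreover have "0 < s + s * x - 2" using s(3) by simp
    ultimately have "A < (1 - ln q) * (s + s * x - 2)" by (simp only: pos_divide_less_eq)
    then have "q * A < q * ((1 - ln q) * (s + s * x - 2))" using q by (intro mult_strict_left_mono) auto
    moreover have "entropy_cost a + entropy_cost b = q * A - q * ((1 - ln q) * (s + s * x)) + 2"
    proof -
      have "ln a = ln q + ln (s * x)" "ln b = ln q + ln s"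
        unfolding a_def b_def using q s x by (simp_all add: ln_mult_pos)
      then show ?thesis unfolding entropy_cost_def A_def by (simp add: a_def b_def algebra_simps)
    qed
    moreover have "2 * entropy_cost q = q * ((1 - ln q) * (s + s * x - 2)) - q * ((1 - ln q) * (s + s * x)) + 2"
      by (simp add: entropy_cost_def algebra_simps)
    ultimately show ?thesis by linarith
  qed
  have "((\<lambda>r. entropy_cost (r * a) + entropy_cost (r * b)) \<longlongrightarrow> entropy_cost (1 * a) + entropy_cost (1 * b)) (at_left 1)"
    unfolding entropy_cost_def using ab by (intro tendsto_intros) auto
  then have "\<forall>\<^sub>F r in at_left 1. entropy_cost (r * a) + entropy_cost (r * b) < 2 * entropy_cost q"
    using beat by (intro order_tendstoD(2)) auto
  moreover have "\<forall>\<^sub>F r in at_left (1::real). r \<in> {0<..<1}" by (intro eventually_at_left_real) simp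
  ultimately have "\<forall>\<^sub>F r in at_left (1::real). entropy_cost (r * a) + entropy_cost (r * b) < 2 * entropy_cost q \<and> r \<in> {0<..<1}"
    by eventually_elim auto
  then obtain r where r: "entropy_cost (r * a) + entropy_cost (r * b) < 2 * entropy_cost q" "0 < r" "r < 1"
    using eventually_happens'[of "at_left (1 :: real)"] by (auto simp: trivial_limit_at_left_real)
  have dens': "r * a * ((r * a)\<^sup>2 + 3 * (r * b)\<^sup>2) / 4 < \<eta>"
  proof -
    have "r * a * ((r * a)\<^sup>2 + 3 * (r * b)\<^sup>2) / 4 = r ^ 3 * (a * (a\<^sup>2 + 3 * b\<^sup>2) / 4)"
      by (simp add: power2_eq_square power3_eq_cube algebra_simps)
    also have "\<dots> = r ^ 3 * \<eta>" unfolding dens ..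
    also have "\<dots> < 1 * \<eta>" using r \<eta> by (intro mult_strict_right_mono) (auto simp: power_less_one_iff)
    finally show ?thesis by simp
  qed
  define K where "K = (entropy_cost (r * a) + entropy_cost (r * b)) / 4"
  have K: "- entropy_cost q / 2 < - K" using r(1) by (simp add: K_def)
  have "\<forall>\<^sub>F y in at_right q. rate \<eta> (act \<eta> y) y / act \<eta> y < - K"
    by (rule order_tendstoD(2)[OF rate_limit[OF q(1) q1 q(2)[symmetric]] K])
  moreover have "\<forall>\<^sub>F y in at_right q. y \<in> {q<..<1}" using q1 by (rule eventually_at_right_real)
  ultimately have "\<forall>\<^sub>F y in at_right q. rate \<eta> (act \<eta> y) y / act \<eta> y < - K \<and> y \<in> {q<..<1}"
    by eventually_elim auto
  then obtain y where y: "rate \<eta> (act \<eta> y) y / act \<eta> y < - K" "q < y" "y < 1"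
    using eventually_happens'[of "at_right q"] by (auto simp: trivial_limit_at_right_real)
  have pos: "0 < act \<eta> z" if "q < z" "z < 1" for z
    using that q by (intro act_pos) (auto intro!: power_strict_mono simp flip: q(2))
  have "phi \<eta> (act \<eta> y) = rate \<eta> (act \<eta> y) y"
    by (rule analytic_continuation_phi[of \<eta> q]) (use q q1 \<eta> y an pos in auto)
  moreover have "- act \<eta> y * (entropy_cost (r * a) + entropy_cost (r * b)) / 4 \<le> phi \<eta> (act \<eta> y)"
    using two_block_lower_bound[OF pos[OF y(2,3)] _ _ dens'] r ab by simp
  moreover have "- K * act \<eta> y = - act \<eta> y * (entropy_cost (r * a) + entropy_cost (r * b)) / 4" by (simp add: K_def)
  ultimately have "- K * act \<eta> y \<le> rate \<eta> (act \<eta> y) y" by (simp only:)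
  moreover have "rate \<eta> (act \<eta> y) y < - K * act \<eta> y" using y(1) pos[OF y(2,3)] by (simp add: pos_divide_less_eq)
  ultimately show False by simp
qed

theorem corollary1p3:
  shows "(\<exists>c::real. 1 / sqrt (exp 1) \<le> c \<and> c < 4.342 \<and> \<not> real_analytic_at (phi 0) c)
       \<and> (0.209 \<le> zhao_threshold \<and> zhao_threshold < 0.21 \<and> \<bar>eta_l - 0.0091\<bar> < 0.0002
          \<and> (\<forall>\<eta>::real. 0 \<le> \<eta> \<and> \<eta> < eta_l \<longrightarrow> (\<exists>c>0. \<not> real_analytic_at (phi \<eta>) c)))"
proof (intro conjI allI impI)
  show "\<bar>eta_l - 0.0091\<bar> < 0.0002"
  proof -
    have z: "0 \<le> zhao_threshold" using zhao_threshold_bounds(1) by (rule order_trans[rotated]) simp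
    \<comment> \<open>\<open>0.209 ^ 3\<close> is 0.009129... and \<open>0.21 ^ 3\<close> is
      0.009261, both within 0.0002 of 0.0091.\<close>
    have "0.209 ^ 3 \<le> eta_l" unfolding eta_l_def using zhao_threshold_bounds(1) by (rule power_mono) simp
    moreover have "eta_l < 0.21 ^ 3" unfolding eta_l_def
      by (rule power_strict_mono[OF zhao_threshold_bounds(2) z]) simp
    ultimately show ?thesis by (simp add: power3_eq_cube abs_less_iff)
  qed
  fix \<eta> :: real assume \<eta>: "0 \<le> \<eta> \<and> \<eta> < eta_l"
  show "\<exists>c>0. \<not> real_analytic_at (phi \<eta>) c"
  proof (cases "\<eta> = 0")
    case True
    obtain c where "1 / sqrt (exp 1) \<le> c" "\<not> real_analytic_at (phi 0) c" using nonanalytic_zero by blast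
    moreover have "0 < 1 / sqrt (exp 1 :: real)" by simp
    ultimately show ?thesis using True by (meson order_less_le_trans)
  next
    case False
    then show ?thesis using nonanalytic_pos \<eta> by simp
  qed
qed (use nonanalytic_zero zhao_threshold_bounds in auto)

end
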